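(* The universality problem and the inclusion problem for deterministic limit Parikh automata are decidable.
   Context: Universality: given a deterministic limit PA $\mathcal{A}$ over $\Sigma$, does $\mathcal{A}$ accept every word in $\Sigma^\omega$? Inclusion: given $\mathcal{A}_1$, which is either a safety automaton or a deterministic limit PA, and a deterministic limit PA $\mathcal{A}_2$, is the $\omega$-language of $\mathcal{A}_1$ a subset of that of $\mathcal{A}_2$? A safety automaton is a (non-deterministic) Büchi automaton all of whose states are accepting. $\mathbb{N}=\{0,1,2,\dots\}$ and $\mathbb{N}_\infty=\mathbb{N}\cup\{\infty\}$, with $z+\infty=\infty+z=\infty+\infty=\infty$ for $z\in\mathbb{N}$, $z\cdot\infty=\infty\cdot z=\infty$ for $z\ge 1$, and $0\cdot\infty=\infty\cdot 0=0$; operations on vectors are component-wise. A linear set over $\mathbb{N}_\infty^d$ is a set $C(\mathbf{b},P)=\{\mathbf{b}+\mathbf{p}_1z_1+\dots+\mathbf{p}_\ell z_\ell \mid z_1,\dots,z_\ell\in\mathbb{N}\}$ with $\mathbf{b}\in\mathbb{N}_\infty^d$ and $P=\{\mathbf{p}_1,\dots,\mathbf{p}_\ell\}\subseteq\mathbb{N}_\infty^d$ finite ($\ell\ge 0$); a semi-linear set is a finite union of linear sets, given explicitly by base and period vectors. A limit Parikh automaton (limit PA) of dimension $d\ge 1$ is a tuple $\mathcal{A}=(Q,\Sigma,q_0,\Delta,F,C)$ with a finite state set $Q$, a finite non-empty alphabet $\Sigma$, an initial state $q_0\in Q$, a finite set of labeled transitions $\Delta\subseteq Q\times\Sigma\times\mathbb{N}^d\times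 Q$, a set of accepting states $F\subseteq Q$, and a semi-linear set $C\subseteq\mathbb{N}_\infty^d$. It is deterministic if for every $(p,a)\in Q\times\Sigma$ there is exactly one transition $(p,a,\mathbf{v},q)\in\Delta$. A run on $\alpha=\alpha_1\alpha_2\dots\in\Sigma^\omega$ is an infinite sequence $r=r_1r_2\dots$ with $r_i=(p_{i-1},\alpha_i,\mathbf{v}_i,p_i)\in\Delta$ and $p_0=q_0$. It is accepting if $p_i\in F$ for infinitely many $i\ge 1$ and $\rho(r)\in C$, where the $j$th component of $\rho(r)\in\mathbb{N}_\infty^d$ is $\infty$ if infinitely many $\mathbf{v}_i$ have a non-zero $j$th component, and otherwise is the (finite) sum of the $j$th components of all $\mathbf{v}_i$. The automaton accepts $\alpha$ if there is an accepting run on $\alpha$; its $\omega$-language is the set of accepted words. *)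

theory Defs
  imports
    "HOL-Library.Extended_Nat"
    "HOL-Library.Nat_Bijection"
    "HOL-Library.Omega_Words_Fun"
begin

section \<open>Decidable sets of natural numbers\<close>

text \<open>
  Programs for the partial recursive functions: the basic functions, closed under composition,
  primitive recursion and unbounded minimisation. Arities are left implicit; a program without
  a value on an argument list (including one applied at a wrong arity) is related to no result.
\<close>

datatype recf =
    Zero
  | Succ
  | Proj nat
  | Comp recf "recf list"
  | PrimRec recf recf
  | Mu recf

inductive computes :: "recf \<Rightarrow> nat list \<Rightarrow> nat \<Rightarrow> bool" where
  computes_Zero: "computes Zero xs 0"
| computes_Succ: "computes Succ [x] (Suc x)"
| computes_Proj: "i < length xs \<Longrightarrow> computes (Proj i) xs (xs ! i)"
| computes_Comp: "list_all2 (\<lambda>g y. computes g xs y) gs ys \<Longrightarrow> computes f ys z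
    \<Longrightarrow> computes (Comp f gs) xs z"
| computes_PrimRec_0: "computes f xs y \<Longrightarrow> computes (PrimRec f g) (0 # xs) y"
| computes_PrimRec_Suc: "computes (PrimRec f g) (n # xs) y \<Longrightarrow> computes g (n # y # xs) z
    \<Longrightarrow> computes (PrimRec f g) (Suc n # xs) z"
| computes_Mu: "computes f (n # xs) 0 \<Longrightarrow> \<forall>m<n. \<exists>y. computes f (m # xs) (Suc y)
    \<Longrightarrow> computes (Mu f) xs n"

inductive_cases computes_elims:
  "computes Zero xs y"
  "computes Succ xs y"
  "computes (Proj i) xs y"
  "computes (Comp f gs) xs y"
  "computes (PrimRec f g) (0 # xs) y"
  "computes (PrimRec f g) (Suc n # xs) y"
  "computes (Mu f) xs y"

lemma computes_deterministic:
  "computes f xs y \<Longrightarrow> computes f xs y' \<Longrightarrow> y' = y"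
proof (induction arbitrary: y' rule: computes.induct)
  case (computes_Comp xs gs ys f z)
  from computes_Comp.prems obtain ys' where
    ys': "list_all2 (\<lambda>g y. computes g xs y) gs ys'" and z: "computes f ys' y'"
    by (rule computes_elims(4))
  have "ys' = ys"
  proof (rule nth_equalityI)
    show len: "length ys' = length ys"
      using list_all2_lengthD[OF ys'] list_all2_lengthD[OF computes_Comp.IH(1)] by simp
    fix i assume "i < length ys'"
    with ys' len computes_Comp.IH(1)
    have "computes (gs ! i) xs (ys' ! i)"
      and "\<forall>y'. computes (gs ! i) xs y' \<longrightarrow> y' = ys ! i"
      by (fastforce dest: list_all2_nthD2)+
    then show "ys' ! i = ys ! i" by blast
  qed
  with z have "computes f ys y'" by simp
  then show ?case by (rule computes_Comp.IH(2))
next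
  case (computes_PrimRec_Suc f g n xs y z)
  from computes_PrimRec_Suc.prems obtain w where
    w: "computes (PrimRec f g) (n # xs) w" "computes g (n # w # xs) y'"
    by (rule computes_elims(6))
  from computes_PrimRec_Suc.IH(1)[OF w(1)] w(2) have "computes g (n # y # xs) y'"
    by simp
  then show ?case by (rule computes_PrimRec_Suc.IH(2))
next
  case (computes_Mu f n xs)
  have 0: "computes f (y' # xs) 0"
    using computes_Mu.prems by (rule computes_elims(7))
  have below: "\<exists>y. computes f (m # xs) (Suc y)" if "m < y'" for m
    using computes_Mu.prems by (rule computes_elims(7)) (simp add: that)
  have "\<not> y' < n"
  proof
    assume "y' < n"
    with computes_Mu.IH(2)
    have "\<exists>y. \<forall>z. computes f (y' # xs) z \<longrightarrow> z = Suc y" by iprover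
    with 0 show False by auto
  qed
  moreover have "\<not> n < y'"
  proof
    assume "n < y'"
    then obtain y where "computes f (n # xs) (Suc y)" using below by iprover
    then have "Suc y = 0" by (rule computes_Mu.IH(1))
    then show False by simp
  qed
  ultimately show ?case by simp
next
  case (computes_PrimRec_0 f xs y g)
  from computes_PrimRec_0.prems have "computes f xs y'" by (rule computes_elims(5))
  then show ?case by (rule computes_PrimRec_0.IH)
qed (erule computes_elims, simp)+

definition decidable :: "nat set \<Rightarrow> bool" where
  "decidable S \<longleftrightarrow> (\<exists>f. \<forall>n. computes f [n] (if n \<in> S then 1 else 0))"


section \<open>Semi-linear sets over the naturals with infinity\<close>

text \<open>
  A vector of dimension \<open>d\<close> is a list of length \<open>d\<close>. The arithmetic of \<^typ>\<open>enat\<close> satisfies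
  \<open>0 * \<infinity> = 0\<close>. A pair \<open>(b, P)\<close> presents the linear set with base \<open>b\<close> and periods \<open>P\<close>, and
  a set of such pairs presents a semi-linear set.
\<close>

type_synonym linear_pres = "enat list \<times> enat list set"

definition linear_set :: "nat \<Rightarrow> linear_pres \<Rightarrow> enat list set" where
  "linear_set d = (\<lambda>(b, P).
     {x. length x = d \<and>
         (\<exists>z :: enat list \<Rightarrow> nat. \<forall>j<d. x ! j = b ! j + (\<Sum>p\<in>P. p ! j * enat (z p)))})"

definition semilinear_set :: "nat \<Rightarrow> linear_pres set \<Rightarrow> enat list set" where
  "semilinear_set d G = (\<Union>L\<in>G. linear_set d L)"

definition semilinear_pres :: "nat \<Rightarrow> linear_pres set \<Rightarrow> bool" where
  "semilinear_pres d G \<longleftrightarrow>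
     finite G \<and> (\<forall>(b, P)\<in>G. length b = d \<and> finite P \<and> (\<forall>p\<in>P. length p = d))"


section \<open>Limit Parikh automata\<close>

definition omega_words :: "'a set \<Rightarrow> 'a word set" where
  "omega_words A = {w. range w \<subseteq> A}"

text \<open>
  The field \<open>pa_constr\<close> holds base and period vectors; the semi-linear set \<open>C\<close> itself is
  \<open>semilinear_set (pa_dim A) (pa_constr A)\<close>.
\<close>

record ('q, 'a) limit_pa =
  pa_dim :: nat
  pa_states :: "'q set"
  pa_alphabet :: "'a set"
  pa_initial :: 'q
  pa_transitions :: "('q \<times> 'a \<times> nat list \<times> 'q) set"
  pa_accepting :: "'q set"
  pa_constr :: "linear_pres set"

definition limit_pa :: "('q, 'a) limit_pa \<Rightarrow> bool" where
  "limit_pa A \<longleftrightarrow>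
     pa_dim A \<ge> 1 \<and>
     finite (pa_states A) \<and>
     finite (pa_alphabet A) \<and> pa_alphabet A \<noteq> {} \<and>
     pa_initial A \<in> pa_states A \<and>
     finite (pa_transitions A) \<and>
     pa_transitions A
       \<subseteq> pa_states A \<times> pa_alphabet A \<times> {v. length v = pa_dim A} \<times> pa_states A \<and>
     pa_accepting A \<subseteq> pa_states A \<and>
     semilinear_pres (pa_dim A) (pa_constr A)"

definition deterministic_limit_pa :: "('q, 'a) limit_pa \<Rightarrow> bool" where
  "deterministic_limit_pa A \<longleftrightarrow>
     limit_pa A \<and>
     (\<forall>p\<in>pa_states A. \<forall>a\<in>pa_alphabet A.
        \<exists>!t. t \<in> pa_transitions A \<and> (\<exists>v q. t = (p, a, v, q)))"

fun tr_vec :: "'q \<times> 'a \<times> nat list \<times> 'q \<Rightarrow> nat list" where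
  "tr_vec (p, a, v, q) = v"

fun tr_target :: "'q \<times> 'a \<times> nat list \<times> 'q \<Rightarrow> 'q" where
  "tr_target (p, a, v, q) = q"

text \<open>
  Words and runs are indexed from 0: letter \<open>\<alpha> i\<close> is read by the transition \<open>r i\<close>, which leads
  from state \<open>s i\<close> to state \<open>s (Suc i)\<close>.
\<close>

definition pa_run :: "('q, 'a) limit_pa \<Rightarrow> 'a word \<Rightarrow> (nat \<Rightarrow> 'q \<times> 'a \<times> nat list \<times> 'q) \<Rightarrow> bool" where
  "pa_run A \<alpha> r \<longleftrightarrow>
     range r \<subseteq> pa_transitions A \<and>
     (\<exists>s v. s 0 = pa_initial A \<and> (\<forall>i. r i = (s i, \<alpha> i, v i, s (Suc i))))"

definition limit_parikh :: "nat \<Rightarrow> (nat \<Rightarrow> 'q \<times> 'a \<times> nat list \<times> 'q) \<Rightarrow> enat list" where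
  "limit_parikh d r =
     map (\<lambda>j. let N = {i. tr_vec (r i) ! j \<noteq> 0}
              in if infinite N then \<infinity> else enat (\<Sum>i\<in>N. tr_vec (r i) ! j)) [0..<d]"

definition pa_accepting_run ::
    "('q, 'a) limit_pa \<Rightarrow> 'a word \<Rightarrow> (nat \<Rightarrow> 'q \<times> 'a \<times> nat list \<times> 'q) \<Rightarrow> bool" where
  "pa_accepting_run A \<alpha> r \<longleftrightarrow>
     pa_run A \<alpha> r \<and>
     (\<exists>\<^sub>\<infinity>i. tr_target (r i) \<in> pa_accepting A) \<and>
     limit_parikh (pa_dim A) r \<in> semilinear_set (pa_dim A) (pa_constr A)"

definition pa_language :: "('q, 'a) limit_pa \<Rightarrow> 'a word set" where
  "pa_language A = {\<alpha> \<in> omega_words (pa_alphabet A). \<exists>r. pa_accepting_run A \<alpha> r}"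


section \<open>Safety automata\<close>

record ('q, 'a) buchi =
  ba_states :: "'q set"
  ba_alphabet :: "'a set"
  ba_initial :: 'q
  ba_transitions :: "('q \<times> 'a \<times> 'q) set"
  ba_accepting :: "'q set"

definition buchi :: "('q, 'a) buchi \<Rightarrow> bool" where
  "buchi A \<longleftrightarrow>
     finite (ba_states A) \<and>
     finite (ba_alphabet A) \<and> ba_alphabet A \<noteq> {} \<and>
     ba_initial A \<in> ba_states A \<and>
     ba_transitions A \<subseteq> ba_states A \<times> ba_alphabet A \<times> ba_states A \<and>
     ba_accepting A \<subseteq> ba_states A"

definition safety_automaton :: "('q, 'a) buchi \<Rightarrow> bool" where
  "safety_automaton A \<longleftrightarrow> buchi A \<and> ba_accepting A = ba_states A"

text \<open>Here a run is given by its states, as transitions carry no vectors.\<close>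

definition ba_run :: "('q, 'a) buchi \<Rightarrow> 'a word \<Rightarrow> (nat \<Rightarrow> 'q) \<Rightarrow> bool" where
  "ba_run A \<alpha> s \<longleftrightarrow>
     s 0 = ba_initial A \<and> (\<forall>i. (s i, \<alpha> i, s (Suc i)) \<in> ba_transitions A)"

definition ba_language :: "('q, 'a) buchi \<Rightarrow> 'a word set" where
  "ba_language A =
     {\<alpha> \<in> omega_words (ba_alphabet A). \<exists>s. ba_run A \<alpha> s \<and> (\<exists>\<^sub>\<infinity>i. s i \<in> ba_accepting A)}"


section \<open>Problem instances and their encoding\<close>

text \<open>
  An instance is a finite object, so its states and letters may be taken to be natural numbers.
  Instances are numbered with the bijections of \<^theory>\<open>HOL-Library.Nat_Bijection\<close>; the
  numbering is injective on well-formed instances, as shown below. \<^const>\<open>set_encode\<close>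
  is meaningful for finite sets only.
\<close>

definition universal_instances :: "(nat, nat) limit_pa set" where
  "universal_instances =
     {A. deterministic_limit_pa A \<and> pa_language A = omega_words (pa_alphabet A)}"

type_synonym inclusion_instance =
  "((nat, nat) buchi + (nat, nat) limit_pa) \<times> (nat, nat) limit_pa"

fun left_wf :: "(nat, nat) buchi + (nat, nat) limit_pa \<Rightarrow> bool" where
  "left_wf (Inl B) = safety_automaton B"
| "left_wf (Inr A) = deterministic_limit_pa A"

fun left_language :: "(nat, nat) buchi + (nat, nat) limit_pa \<Rightarrow> nat word set" where
  "left_language (Inl B) = ba_language B"
| "left_language (Inr A) = pa_language A"

definition inclusion_instances :: "inclusion_instance set" where
  "inclusion_instances =
     {(A1, A2). left_wf A1 \<and> deterministic_limit_pa A2 \<and> left_language A1 \<subseteq> pa_language A2}"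

fun enat_code :: "enat \<Rightarrow> nat" where
  "enat_code \<infinity> = 0"
| "enat_code (enat n) = Suc n"

definition evec_code :: "enat list \<Rightarrow> nat" where
  "evec_code x = list_encode (map enat_code x)"

definition linear_code :: "linear_pres \<Rightarrow> nat" where
  "linear_code = (\<lambda>(b, P). prod_encode (evec_code b, set_encode (evec_code ` P)))"

definition pa_transition_code :: "nat \<times> nat \<times> nat list \<times> nat \<Rightarrow> nat" where
  "pa_transition_code = (\<lambda>(p, a, v, q). list_encode [p, a, list_encode v, q])"

definition pa_code :: "(nat, nat) limit_pa \<Rightarrow> nat" where
  "pa_code A = list_encode
     [pa_dim A, set_encode (pa_states A), set_encode (pa_alphabet A), pa_initial A,
      set_encode (pa_transition_code ` pa_transitions A), set_encode (pa_accepting A),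
      set_encode (linear_code ` pa_constr A)]"

definition ba_transition_code :: "nat \<times> nat \<times> nat \<Rightarrow> nat" where
  "ba_transition_code = (\<lambda>(p, a, q). list_encode [p, a, q])"

definition ba_code :: "(nat, nat) buchi \<Rightarrow> nat" where
  "ba_code A = list_encode
     [set_encode (ba_states A), set_encode (ba_alphabet A), ba_initial A,
      set_encode (ba_transition_code ` ba_transitions A), set_encode (ba_accepting A)]"

definition inclusion_code :: "inclusion_instance \<Rightarrow> nat" where
  "inclusion_code = (\<lambda>(A1, A2).
     prod_encode (sum_encode (map_sum ba_code pa_code A1), pa_code A2))"

lemma inj_enat_code: "inj enat_code"
proof (rule injI)
  fix x y assume "enat_code x = enat_code y"
  then show "x = y" by (cases x; cases y) auto
qed

lemma evec_code_eq [simp]: "evec_code x = evec_code y \<longleftrightarrow> x = y"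
  by (simp add: evec_code_def list_encode_eq inj_map_eq_map inj_enat_code)

lemma set_encode_image_eqD:
  assumes "set_encode (f ` A) = set_encode (f ` B)" "finite A" "finite B" "inj_on f C"
    and "A \<subseteq> C" "B \<subseteq> C"
  shows "A = B"
  using assms by (simp add: set_encode_eq inj_on_image_eq_iff)

lemma inj_pa_transition_code: "inj pa_transition_code"
  by (auto simp: inj_def pa_transition_code_def list_encode_eq)

lemma inj_ba_transition_code: "inj ba_transition_code"
  by (auto simp: inj_def ba_transition_code_def list_encode_eq)

lemma inj_on_linear_code: "inj_on linear_code {(b, P). finite P}"
proof (rule inj_onI, clarify)
  fix b b' :: "enat list" and P P' :: "enat list set"
  assume fin: "finite P" "finite P'" and code: "linear_code (b, P) = linear_code (b', P')"
  then have "set_encode (evec_code ` P) = set_encode (evec_code ` P')"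
    by (simp add: linear_code_def)
  from this fin have "P = P'"
    by (rule set_encode_image_eqD[where C = UNIV]) (auto simp: inj_def)
  with code show "b = b' \<and> P = P'"
    by (simp add: linear_code_def)
qed

lemma inj_on_pa_code: "inj_on pa_code {A. limit_pa A}"
proof (rule inj_onI)
  fix A B :: "(nat, nat) limit_pa"
  assume "A \<in> {A. limit_pa A}" "B \<in> {A. limit_pa A}" and code: "pa_code A = pa_code B"
  then have wf: "limit_pa A" "limit_pa B" by simp_all
  have fin: "finite (pa_states A)" "finite (pa_states B)"
    "finite (pa_alphabet A)" "finite (pa_alphabet B)"
    "finite (pa_transitions A)" "finite (pa_transitions B)"
    "finite (pa_accepting A)" "finite (pa_accepting B)"
    "finite (pa_constr A)" "finite (pa_constr B)"
    using wf by (auto simp: limit_pa_def semilinear_pres_def intro: finite_subset)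
  have sub: "pa_constr A \<subseteq> {(b, P). finite P}" "pa_constr B \<subseteq> {(b, P). finite P}"
    using wf by (auto simp: limit_pa_def semilinear_pres_def)
  have tr: "pa_transitions A = pa_transitions B"
    by (rule set_encode_image_eqD[OF _ fin(5,6) inj_pa_transition_code])
      (use code in \<open>simp_all add: pa_code_def list_encode_eq\<close>)
  have co: "pa_constr A = pa_constr B"
    by (rule set_encode_image_eqD[OF _ fin(9,10) inj_on_linear_code sub])
      (use code in \<open>simp add: pa_code_def list_encode_eq\<close>)
  show "A = B"
    using code fin tr co by (intro limit_pa.equality) (simp_all add: pa_code_def list_encode_eq set_encode_eq)
qed

lemma inj_on_ba_code: "inj_on ba_code {A. buchi A}"
proof (rule inj_onI)
  fix A B :: "(nat, nat) buchi"
  assume "A \<in> {A. buchi A}" "B \<in> {A. buchi A}" and code: "ba_code A = ba_code B"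
  then have wf: "buchi A" "buchi B" by simp_all
  have fin: "finite (ba_states A)" "finite (ba_states B)"
    "finite (ba_alphabet A)" "finite (ba_alphabet B)"
    "finite (ba_transitions A)" "finite (ba_transitions B)"
    "finite (ba_accepting A)" "finite (ba_accepting B)"
    using wf by (auto simp: buchi_def intro: finite_subset finite_cartesian_product)
  have tr: "ba_transitions A = ba_transitions B"
    by (rule set_encode_image_eqD[OF _ fin(5,6) inj_ba_transition_code])
      (use code in \<open>simp_all add: ba_code_def list_encode_eq\<close>)
  show "A = B"
    using code fin tr by (intro buchi.equality) (simp_all add: ba_code_def list_encode_eq set_encode_eq)
qed

lemma inj_on_inclusion_code:
  "inj_on inclusion_code {(A1, A2). left_wf A1 \<and> deterministic_limit_pa A2}"
proof (rule inj_onI, clarify)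
  fix A1 B1 :: "(nat, nat) buchi + (nat, nat) limit_pa" and A2 B2 :: "(nat, nat) limit_pa"
  assume wf: "left_wf A1" "left_wf B1" "deterministic_limit_pa A2" "deterministic_limit_pa B2"
    and "inclusion_code (A1, A2) = inclusion_code (B1, B2)"
  then have code: "map_sum ba_code pa_code A1 = map_sum ba_code pa_code B1"
    "pa_code A2 = pa_code B2"
    by (simp_all add: inclusion_code_def sum_encode_eq)
  from code(1) wf(1,2) have "A1 = B1"
    by (cases A1; cases B1)
      (auto simp: deterministic_limit_pa_def safety_automaton_def
        dest: inj_onD[OF inj_on_pa_code] inj_onD[OF inj_on_ba_code])
  moreover from code(2) wf(3,4) have "A2 = B2"
    by (auto simp: deterministic_limit_pa_def dest: inj_onD[OF inj_on_pa_code])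
  ultimately show "A1 = B1 \<and> A2 = B2" ..
qed

end

theory Submission
  imports Defs "HOL-Library.FuncSet"
begin

text \<open>
  As the second automaton is deterministic, a word refuting the inclusion is an infinite path in the
  product of the two automata whose first component accepts and whose second does not. The limit
  vector of a path only depends on the edges it takes infinitely often and on a finite prefix, so a
  refuting path may be taken to be a lasso. Both parts of a lasso can be bounded. Cutting out cycles
  that contribute no new edge shortens the loop and turns the prefix into a short walk with
  copies of short cycles, so its vector ranges over a linear set. By reading the entries of a vector in
  binary, membership in all linear sets of bounded description is decided by a finite automaton; the
  pumping argument yields a small vector that belongs to the same linear sets and, in particular,
  satisfies the same acceptance conditions. Thus it suffices to search for a lasso below an explicit
  elementary bound, which is a computable predicate of the codes.

  Safety automata and the automaton accepting all words are limit Parikh automata of dimension 1 with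
  zero vectors.
\<close>

text \<open>The obstacle is the negated condition: a counterexample satisfies the constraint of the
  first automaton and violates that of the second. No complement of a semi-linear set is formed.
  Instead, the small vector agrees with the given one on a finite family of linear sets, in both
  directions. This family contains the constraints as well as the linear set realised by the prefix,
  so its entry bound \<open>V\<close> covers the base and period vectors of the automata and the
  vectors of short walks.

  The digit automaton tracks carries. If x = c + s with s in the cone of P, then x div 2 = c' + s',
  where c' is half of the sum of c and the generators with odd coefficient minus the parity of x. A
  box of carries is closed under this step; this gives \<open>box_size\<close> and
  \<open>witness_bound\<close>.

  Infinite coordinates and the Buechi conditions only depend on the edges of the loop, a set that
  the shortening keeps fixed. Determinism of the second automaton enters through uniqueness in
  \<open>path_run2\<close>, where rejection becomes a statement about a single run, and through
  totality in \<open>completed_run\<close>.\<close>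

section \<open>Computable functions and predicates\<close>

text \<open>An environment assigns values to all de Bruijn indices; a program is given the first \<open>k\<close>
  of them. A bounded quantifier or a recursion passes to a larger \<open>k\<close>.\<close>

definition computable :: "nat \<Rightarrow> ((nat \<Rightarrow> nat) \<Rightarrow> nat) \<Rightarrow> bool" where
  "computable k f \<longleftrightarrow> (\<exists>F. \<forall>e. computes F (map e [0..<k]) (f e))"

definition decidable_pred :: "nat \<Rightarrow> ((nat \<Rightarrow> nat) \<Rightarrow> bool) \<Rightarrow> bool" where
  "decidable_pred k P \<longleftrightarrow> computable k (\<lambda>e. if P e then 1 else 0)"

named_theorems computable_intros

lemma computable_var [computable_intros]: "i < k \<Longrightarrow> computable k (\<lambda>e. e i)"
  unfolding computable_def by (rule exI[of _ "Proj i"]) (auto intro: computes_Proj[of i, THEN back_subst[of "computes _ _"]])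

lemma computable_compose:
  assumes H: "computable n H" and G: "\<And>i. i < n \<Longrightarrow> computable k (G i)"
  shows "computable k (\<lambda>e. H (\<lambda>i. G i e))"
proof -
  from H obtain FH where FH: "\<And>e. computes FH (map e [0..<n]) (H e)" unfolding computable_def by blast
  from G have "\<forall>i. \<exists>F. i < n \<longrightarrow> (\<forall>e. computes F (map e [0..<k]) (G i e))" unfolding computable_def by blast
  then obtain FG where FG: "\<And>i e. i < n \<Longrightarrow> computes (FG i) (map e [0..<k]) (G i e)" by metis
  have "computes (Comp FH (map FG [0..<n])) (map e [0..<k]) (H (\<lambda>i. G i e))" for e
    by (rule computes_Comp[OF _ FH]) (auto simp: list_all2_conv_all_nth FG)
  then show ?thesis unfolding computable_def by blast
qed

lemma computable_Suc [computable_intros]: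
  assumes "computable k f" shows "computable k (\<lambda>e. Suc (f e))"
proof -
  have "computable 1 (\<lambda>e. Suc (e 0))"
    unfolding computable_def by (rule exI[of _ Succ]) (auto intro: computes_Succ)
  from computable_compose[OF this, of k "\<lambda>i. f"] assms show ?thesis by simp
qed

lemma computable_const [computable_intros]: "computable k (\<lambda>e. c)"
proof (induction c)
  case 0
  show ?case unfolding computable_def by (rule exI[of _ Zero]) (auto intro: computes_Zero)
qed (rule computable_Suc)

lemma computable_compose1:
  assumes "computable 1 (\<lambda>e. h (e 0))" "computable k f"
  shows "computable k (\<lambda>e. h (f e))"
  using computable_compose[OF assms(1), of k "\<lambda>i. f"] assms(2) by simp

lemma computable_compose2:
  assumes "computable 2 (\<lambda>e. h (e 0) (e 1))" "computable k f" "computable k g"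
  shows "computable k (\<lambda>e. h (f e) (g e))"
  using computable_compose[OF assms(1), of k "\<lambda>i. if i = 0 then f else g"] assms(2,3) by simp

lemma computable_compose4:
  assumes "computable 4 (\<lambda>e. h (e 0) (e 1) (e 2) (e 3))" "computable k a" "computable k b" "computable k c" "computable k d"
  shows "computable k (\<lambda>e. h (a e) (b e) (c e) (d e))"
  using computable_compose[OF assms(1), of k "\<lambda>i. if i = 0 then a else if i = 1 then b else if i = 2 then c else d"]
    assms(2-) by simp

lemma decidable_pred_compose1: "decidable_pred 1 (\<lambda>e. P (e 0)) \<Longrightarrow> computable k a \<Longrightarrow> decidable_pred k (\<lambda>e. P (a e))"
  unfolding decidable_pred_def by (rule computable_compose1[where h = "\<lambda>x. if P x then 1 else 0"])

lemma decidable_pred_compose2: "decidable_pred 2 (\<lambda>e. P (e 0) (e 1)) \<Longrightarrow> computable k a \<Longrightarrow> computable k b \<Longrightarrow> decidable_pred k (\<lambda>e. P (a e) (b e))"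
  unfolding decidable_pred_def by (rule computable_compose2[where h = "\<lambda>x y. if P x y then 1 else 0"])

lemma decidable_pred_compose4: "decidable_pred 4 (\<lambda>e. P (e 0) (e 1) (e 2) (e 3)) \<Longrightarrow> computable k a \<Longrightarrow> computable k b \<Longrightarrow> computable k c \<Longrightarrow> computable k d
   \<Longrightarrow> decidable_pred k (\<lambda>e. P (a e) (b e) (c e) (d e))"
  unfolding decidable_pred_def by (rule computable_compose4[where h = "\<lambda>x y z u. if P x y z u then 1 else 0"])

text \<open>The step function takes the whole environment as its last argument, so that unification
  with a goal determines \<open>s\<close>. In the premise the counter and the intermediate value
  occupy indices 0 and 1, and all other indices move up by two.\<close>

lemma computable_rec [computable_intros]:
  assumes m: "computable k m" and b: "computable k b"
    and s: "computable (Suc (Suc k)) (\<lambda>e. s (e 0) (e 1) (\<lambda>i. e (Suc (Suc i))))"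
  shows "computable k (\<lambda>e. rec_nat (b e) (\<lambda>i y. s i y e) (m e))"
proof -
  from b obtain B where B: "\<And>e. computes B (map e [0..<k]) (b e)" unfolding computable_def by blast
  from s obtain S where S: "\<And>e. computes S (map e [0..<Suc (Suc k)]) (s (e 0) (e 1) (\<lambda>i. e (Suc (Suc i))))"
    unfolding computable_def by blast
  from m obtain M where M: "\<And>e. computes M (map e [0..<k]) (m e)" unfolding computable_def by blast
  have S': "computes S (n # y # map e [0..<k]) (s n y e)" for n y e
  proof -
    have "map (case_nat n (case_nat y e)) [0..<Suc (Suc k)] = n # y # map e [0..<k]"
      by (simp del: upt_Suc add: upt_conv_Cons flip: map_Suc_upt)
    with S[of "case_nat n (case_nat y e)"] show ?thesis by simp
  qed
  have R: "computes (PrimRec B S) (n # map e [0..<k]) (rec_nat (b e) (\<lambda>i y. s i y e) n)" for n e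
  proof (induction n)
    case 0
    show ?case by (simp add: computes_PrimRec_0 B)
  next
    case (Suc n)
    from computes_PrimRec_Suc[OF Suc S'] show ?case by simp
  qed
  have "computes (Comp (PrimRec B S) (M # map Proj [0..<k])) (map e [0..<k])
     (rec_nat (b e) (\<lambda>i y. s i y e) (m e))" for e
    by (rule computes_Comp[OF _ R])
      (auto simp: list_all2_conv_all_nth M nth_Cons split: nat.split
        intro: computes_Proj[THEN back_subst[of "computes _ _"]])
  then show ?thesis unfolding computable_def by blast
qed

section \<open>Arithmetic, connectives and bounded quantifiers\<close>

lemma computable_cong: "computable k g \<Longrightarrow> (\<And>e. f e = g e) \<Longrightarrow> computable k f"
  by presburger

lemma computable_add [computable_intros]: assumes "computable k f" "computable k g" shows "computable k (\<lambda>e. f e + g e)"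
proof (rule computable_cong)
  show "computable k (\<lambda>e. rec_nat (g e) (\<lambda>i y. Suc y) (f e))" by (intro computable_intros assms) simp
  have "x + y = rec_nat y (\<lambda>i y. Suc y) x" for x y :: nat by (induction x) auto
  then show "f e + g e = rec_nat (g e) (\<lambda>i y. Suc y) (f e)" for e .
qed

lemma computable_mult [computable_intros]: assumes "computable k f" "computable k g" shows "computable k (\<lambda>e. f e * g e)"
\<comment> \<open>Reduction to variables: inside the recursion the environment is shifted, and an
  arbitrary \<open>g\<close> in the step would have to be known computable at the shifted indices.
  Composition before unfolding serves the same purpose in later proofs.\<close>
proof (rule computable_compose2[OF _ assms], rule computable_cong)
  show "computable 2 (\<lambda>e. rec_nat 0 (\<lambda>i y. y + e 1) (e 0))" by (intro computable_intros) simp_all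
  have "x * y = rec_nat 0 (\<lambda>i z. z + y) x" for x y :: nat by (induction x) auto
  then show "e 0 * e 1 = rec_nat 0 (\<lambda>i y. y + e 1) (e 0)" for e :: "nat \<Rightarrow> nat" .
qed

lemma computable_power [computable_intros]: assumes "computable k f" "computable k g" shows "computable k (\<lambda>e. f e ^ g e)"
proof (rule computable_compose2[OF _ assms], rule computable_cong)
  show "computable 2 (\<lambda>e. rec_nat 1 (\<lambda>i y. y * e 0) (e 1))" by (intro computable_intros) simp_all
  have "x ^ y = rec_nat 1 (\<lambda>i z. z * x) y" for x y :: nat by (induction y) auto
  then show "e 0 ^ e 1 = rec_nat 1 (\<lambda>i y. y * e 0) (e 1)" for e :: "nat \<Rightarrow> nat" .
qed

lemma computable_diff [computable_intros]: assumes "computable k f" "computable k g" shows "computable k (\<lambda>e. f e - g e)"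
proof (rule computable_compose2[OF _ assms], rule computable_cong)
  \<comment> \<open>The recursion that returns its own counter yields the truncated
    predecessor.\<close>
  have 1: "computable 1 (\<lambda>e. rec_nat 0 (\<lambda>i y. i) (e 0))" by (intro computable_intros) simp_all
  have 2: "rec_nat 0 (\<lambda>i y. i) x = x - 1" for x :: nat by (induction x) auto
  have pred: "computable k (\<lambda>e. h e - 1)" if "computable k h" for k h
    using computable_compose1[OF 1 that] by (simp only: 2)
  show "computable 2 (\<lambda>e. rec_nat (e 0) (\<lambda>i y. y - 1) (e 1))" by (intro computable_intros pred) simp_all
  have "x - y = rec_nat x (\<lambda>i z. z - 1) y" for x y :: nat by (induction y) auto
  then show "e 0 - e 1 = rec_nat (e 0) (\<lambda>i y. y - 1) (e 1)" for e :: "nat \<Rightarrow> nat" .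
qed

lemma decidable_pred_not [computable_intros]: assumes "decidable_pred k P" shows "decidable_pred k (\<lambda>e. \<not> P e)"
  unfolding decidable_pred_def
  by (rule computable_cong[of _ "\<lambda>e. 1 - (if P e then 1 else 0)"]) (intro computable_intros assms[unfolded decidable_pred_def], simp)

lemma decidable_pred_conj [computable_intros]: assumes "decidable_pred k P" "decidable_pred k Q" shows "decidable_pred k (\<lambda>e. P e \<and> Q e)"
  unfolding decidable_pred_def
  by (rule computable_cong[of _ "\<lambda>e. (if P e then 1 else 0) * (if Q e then 1 else 0)"])
    (intro computable_intros assms[unfolded decidable_pred_def], simp)

lemma decidable_pred_cong: "decidable_pred k Q \<Longrightarrow> (\<And>e. P e = Q e) \<Longrightarrow> decidable_pred k P"
  by presburger

lemma decidable_pred_disj [computable_intros]: assumes "decidable_pred k P" "decidable_pred k Q" shows "decidable_pred k (\<lambda>e. P e \<or> Q e)"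
  by (rule decidable_pred_cong[of _ "\<lambda>e. \<not> (\<not> P e \<and> \<not> Q e)"]) (intro computable_intros assms, simp)

lemma decidable_pred_imp [computable_intros]: assumes "decidable_pred k P" "decidable_pred k Q" shows "decidable_pred k (\<lambda>e. P e \<longrightarrow> Q e)"
  by (rule decidable_pred_cong[of _ "\<lambda>e. \<not> P e \<or> Q e"]) (intro computable_intros assms, simp)

lemma decidable_pred_iff [computable_intros]: assumes "decidable_pred k P" "decidable_pred k Q" shows "decidable_pred k (\<lambda>e. P e \<longleftrightarrow> Q e)"
  by (rule decidable_pred_cong[of _ "\<lambda>e. (P e \<longrightarrow> Q e) \<and> (Q e \<longrightarrow> P e)"]) (intro computable_intros assms, auto)

lemma decidable_pred_eq0: assumes "computable k f" shows "decidable_pred k (\<lambda>e. f e = 0)"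
  unfolding decidable_pred_def by (rule computable_cong[of _ "\<lambda>e. 1 - f e"]) (intro computable_intros assms, simp)

lemma decidable_pred_le [computable_intros]: assumes "computable k f" "computable k g" shows "decidable_pred k (\<lambda>e. f e \<le> g e)"
  by (rule decidable_pred_cong[of _ "\<lambda>e. f e - g e = 0"]) (intro computable_intros decidable_pred_eq0 assms, simp)

lemma decidable_pred_less [computable_intros]: assumes "computable k f" "computable k g" shows "decidable_pred k (\<lambda>e. f e < g e)"
  by (rule decidable_pred_cong[of _ "\<lambda>e. \<not> g e \<le> f e"]) (intro computable_intros assms, auto)

lemma decidable_pred_eq [computable_intros]: assumes "computable k f" "computable k g" shows "decidable_pred k (\<lambda>e. f e = g e)"
  by (rule decidable_pred_cong[of _ "\<lambda>e. f e \<le> g e \<and> g e \<le> f e"]) (intro computable_intros assms, auto)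

lemma computable_if [computable_intros]: assumes "decidable_pred k P" "computable k f" "computable k g" shows "computable k (\<lambda>e. if P e then f e else g e)"
  by (rule computable_cong[of _ "\<lambda>e. (if P e then 1 else 0) * f e + (1 - (if P e then 1 else 0)) * g e"])
    (intro computable_intros assms assms[unfolded decidable_pred_def], simp)

lemma computable_sum [computable_intros]:
  assumes g: "computable k g" and f: "computable (Suc k) (\<lambda>e. f (e 0) (\<lambda>i. e (Suc i)))"
  shows "computable k (\<lambda>e. \<Sum>m<g e. f m e)"
proof (rule computable_cong)
  \<comment> \<open>The summand is evaluated in the environment without the accumulator, which the
    recursion keeps at index 1.\<close>
  have "computable (Suc (Suc k)) (\<lambda>e. f (e 0) (\<lambda>i. e (Suc (Suc i))))"
    using computable_compose[OF f, of "Suc (Suc k)" "\<lambda>i e. case i of 0 \<Rightarrow> e 0 | Suc i \<Rightarrow> e (Suc (Suc i))"]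
    by (force simp: less_Suc_eq_0_disj intro: computable_var)
  then show "computable k (\<lambda>e. rec_nat 0 (\<lambda>m y. y + f m e) (g e))" by (intro computable_intros g) simp_all
  have "(\<Sum>m<n. f m e) = rec_nat 0 (\<lambda>m y. y + f m e) n" for n e by (induction n) auto
  then show "(\<Sum>m<g e. f m e) = rec_nat 0 (\<lambda>m y. y + f m e) (g e)" for e .
qed

lemma decidable_pred_ex [computable_intros]:
  assumes g: "computable k g" and P: "decidable_pred (Suc k) (\<lambda>e. P (e 0) (\<lambda>i. e (Suc i)))"
  shows "decidable_pred k (\<lambda>e. \<exists>m<g e. P m e)"
proof (rule decidable_pred_cong)
  show "decidable_pred k (\<lambda>e. \<not> (\<Sum>m<g e. if P m e then 1 else 0) = (0::nat))"
    by (intro computable_intros g P[unfolded decidable_pred_def])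
qed auto

lemma decidable_pred_all [computable_intros]:
  assumes g: "computable k g" and P: "decidable_pred (Suc k) (\<lambda>e. P (e 0) (\<lambda>i. e (Suc i)))"
  shows "decidable_pred k (\<lambda>e. \<forall>m<g e. P m e)"
  by (rule decidable_pred_cong[of _ "\<lambda>e. \<not> (\<exists>m<g e. \<not> P m e)"]) (intro computable_intros g P, auto)

text \<open>Bounded search without minimisation: in the sum over all candidates only the value of
  \<open>f\<close> itself survives. Inverses such as the projections of the pairing are obtained in
  this way.\<close>

lemma computable_graph:
  assumes g: "computable k g" and P: "decidable_pred (Suc k) (\<lambda>e. P (e 0) (\<lambda>i. e (Suc i)))"
    and f: "\<And>m e. P m e \<longleftrightarrow> m = f e" "\<And>e. f e < g e"
  shows "computable k f"
proof (rule computable_cong)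
  show "computable k (\<lambda>e. \<Sum>m<g e. if P m e then m else 0)" by (intro computable_intros g P) simp
  show "f e = (\<Sum>m<g e. if P m e then m else 0)" for e
    using f(2)[of e] by (simp add: f(1) sum.delta)
qed

section \<open>Pairing, division and codes of finite sets\<close>

lemma computable_triangle [computable_intros]: assumes "computable k f" shows "computable k (\<lambda>e. triangle (f e))"
proof (rule computable_compose1[OF _ assms], rule computable_cong)
  show "computable 1 (\<lambda>e. rec_nat 0 (\<lambda>i y. y + Suc i) (e 0))" by (intro computable_intros) simp_all
  have "triangle x = rec_nat 0 (\<lambda>i y. y + Suc i) x" for x by (induction x) auto
  then show "triangle (e 0) = rec_nat 0 (\<lambda>i y. y + Suc i) (e 0)" for e :: "nat \<Rightarrow> nat" .
qed

lemma computable_prod_encode [computable_intros]: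
  assumes "computable k f" "computable k g" shows "computable k (\<lambda>e. prod_encode (f e, g e))"
  unfolding prod_encode_def prod.case by (intro computable_intros assms)

lemma computable_fst [computable_intros]: assumes "computable k f" shows "computable k (\<lambda>e. fst (prod_decode (f e)))"
proof (rule computable_compose1[OF _ assms, of "\<lambda>x. fst (prod_decode x)"], rule computable_graph)
  show "computable 1 (\<lambda>e. Suc (e 0))" by (intro computable_intros) simp
  show "decidable_pred (Suc 1) (\<lambda>e. \<exists>n<Suc (e (Suc 0)). prod_encode (e 0, n) = e (Suc 0))" by (intro computable_intros) simp_all
  show "(\<exists>n<Suc (e 0). prod_encode (m, n) = e 0) \<longleftrightarrow> m = fst (prod_decode (e 0))" for m and e :: "nat \<Rightarrow> nat"
    by (metis le_imp_less_Suc le_prod_encode_2 prod_decode_inverse prod_encode_inverse fst_conv surj_pair)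
  show "fst (prod_decode (e 0)) < Suc (e 0)" for e :: "nat \<Rightarrow> nat"
    by (metis le_imp_less_Suc le_prod_encode_1 prod_decode_inverse prod.collapse)
qed

lemma computable_snd [computable_intros]: assumes "computable k f" shows "computable k (\<lambda>e. snd (prod_decode (f e)))"
proof (rule computable_compose1[OF _ assms, of "\<lambda>x. snd (prod_decode x)"], rule computable_graph)
  show "computable 1 (\<lambda>e. Suc (e 0))" by (intro computable_intros) simp
  show "decidable_pred (Suc 1) (\<lambda>e. \<exists>n<Suc (e (Suc 0)). prod_encode (n, e 0) = e (Suc 0))" by (intro computable_intros) simp_all
  show "(\<exists>n<Suc (e 0). prod_encode (n, m) = e 0) \<longleftrightarrow> m = snd (prod_decode (e 0))" for m and e :: "nat \<Rightarrow> nat"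
    by (metis le_imp_less_Suc le_prod_encode_1 prod_decode_inverse prod_encode_inverse snd_conv surj_pair)
  show "snd (prod_decode (e 0)) < Suc (e 0)" for e :: "nat \<Rightarrow> nat"
    by (metis le_imp_less_Suc le_prod_encode_2 prod_decode_inverse prod.collapse)
qed

lemma computable_div [computable_intros]: assumes "computable k f" "computable k g" shows "computable k (\<lambda>e. f e div g e)"
proof (rule computable_compose2[OF _ assms], rule computable_graph)
  show "computable 2 (\<lambda>e. Suc (e 0))" by (intro computable_intros) simp
  \<comment> \<open>Index 0 holds the candidate quotient, so dividend and divisor move to 1 and 2.
    The first disjunct reflects that division by zero yields 0.\<close>
  show "decidable_pred (Suc 2) (\<lambda>e. e (Suc 1) = 0 \<and> e 0 = 0 \<or>
    e 0 * e (Suc 1) \<le> e (Suc 0) \<and> e (Suc 0) < Suc (e 0) * e (Suc 1))" by (intro computable_intros) simp_all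
  show "(e 1 = 0 \<and> m = 0 \<or> m * e 1 \<le> e 0 \<and> e 0 < Suc m * e 1) \<longleftrightarrow> m = e 0 div e 1"
    for m and e :: "nat \<Rightarrow> nat"
  proof (cases "e 1 = 0")
    case False
    then have "e 0 < Suc (e 0 div e 1) * e 1"
      using dividend_less_div_times[of "e 1" "e 0"] by (simp add: algebra_simps)
    then show ?thesis
      using False div_nat_eqI[of "e 1" m "e 0"] div_times_less_eq_dividend[of "e 0" "e 1"]
      by (auto simp: mult.commute simp del: mult_Suc mult_Suc_right)
  qed auto
  show "e 0 div e 1 < Suc (e 0)" for e :: "nat \<Rightarrow> nat" by (simp add: le_imp_less_Suc)
qed

lemma decidable_pred_even [computable_intros]: assumes "computable k f" shows "decidable_pred k (\<lambda>e. even (f e))"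
  by (rule decidable_pred_cong[of _ "\<lambda>e. 2 * (f e div 2) = f e"]) (intro computable_intros assms, metis dvd_mult_div_cancel dvd_triv_left)

lemma decidable_pred_set_decode [computable_intros]: assumes "computable k f" "computable k g" shows "decidable_pred k (\<lambda>e. f e \<in> set_decode (g e))"
  unfolding set_decode_def mem_Collect_eq by (intro computable_intros assms)

section \<open>Codes of lists\<close>

definition code_nth :: "nat \<Rightarrow> nat \<Rightarrow> nat" where
  "code_nth c i = (if i < length (list_decode c) then list_decode c ! i else 0)"

definition code_length :: "nat \<Rightarrow> nat" where
  "code_length c = length (list_decode c)"

lemma prod_decode_0: "prod_decode 0 = (0, 0)"
  using prod_encode_inverse[of "(0, 0)"] by (simp add: prod_encode_def)

lemma list_decode_drop:
  "list_encode (drop i (list_decode c)) = ((\<lambda>c. snd (prod_decode (c - 1))) ^^ i) c"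
proof (induction i)
  case (Suc i)
  \<comment> \<open>For the empty list this uses that 0 - 1 = 0 and that 0 decodes to the pair of
    zeros, so the empty list is its own tail.\<close>
  have tl: "list_encode (tl xs) = snd (prod_decode (list_encode xs - 1))" for xs
    by (cases xs) (simp_all add: prod_decode_0)
  have "list_encode (drop (Suc i) (list_decode c)) = list_encode (tl (drop i (list_decode c)))"
    by (simp add: drop_Suc tl_drop)
  then show ?case by (simp add: tl Suc)
qed simp

lemma computable_drop [computable_intros]:
  assumes "computable k f" "computable k g" shows "computable k (\<lambda>e. list_encode (drop (g e) (list_decode (f e))))"
proof (rule computable_compose2[OF _ assms, of "\<lambda>x y. list_encode (drop y (list_decode x))"], rule computable_cong)
  show "computable 2 (\<lambda>e. rec_nat (e 0) (\<lambda>i c. snd (prod_decode (c - 1))) (e 1))" by (intro computable_intros) simp_all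
  have "((\<lambda>c. snd (prod_decode (c - 1))) ^^ i) c = rec_nat c (\<lambda>i c. snd (prod_decode (c - 1))) i" for i c
    by (induction i) auto
  then show "list_encode (drop (e 1) (list_decode (e 0))) = rec_nat (e 0) (\<lambda>i c. snd (prod_decode (c - 1))) (e 1)"
    for e :: "nat \<Rightarrow> nat" by (simp add: list_decode_drop)
qed

text \<open>The default 0 of \<open>code_nth\<close> is what decoding the head of the empty list
  yields, hence no case distinction on the right.\<close>

lemma code_nth_eq: "code_nth c i = fst (prod_decode (list_encode (drop i (list_decode c)) - 1))"
proof (cases "i < length (list_decode c)")
  case True
  then show ?thesis by (simp add: code_nth_def flip: Cons_nth_drop_Suc)
qed (simp add: code_nth_def prod_decode_0)

lemma computable_code_nth [computable_intros]: assumes "computable k f" "computable k g" shows "computable k (\<lambda>e. code_nth (f e) (g e))"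
  unfolding code_nth_eq by (intro computable_intros assms)

lemma length_le_list_encode: "length xs \<le> list_encode xs"
proof (induction xs)
  case (Cons x xs)
  then show ?case using le_prod_encode_2[of "list_encode xs" x] by simp
qed simp

lemma nth_less_list_encode: "x \<in> set xs \<Longrightarrow> x < list_encode xs"
proof (induction xs)
  case (Cons y xs)
  then show ?case using le_prod_encode_2[of "list_encode xs" y] le_prod_encode_1[of y "list_encode xs"] by auto
qed simp

lemma code_nth_le: "code_nth c i \<le> c"
  using nth_less_list_encode[of "code_nth c i" "list_decode c"] by (auto simp: code_nth_def less_imp_le)

lemma code_length_le: "code_length c \<le> c"
  using length_le_list_encode[of "list_decode c"] by (simp add: code_length_def)

lemma computable_code_length [computable_intros]: assumes "computable k f" shows "computable k (\<lambda>e. code_length (f e))"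
proof (rule computable_compose1[OF _ assms], rule computable_graph)
  show "computable 1 (\<lambda>e. Suc (e 0))" by (intro computable_intros) simp
  show "decidable_pred (Suc 1) (\<lambda>e. list_encode (drop (e 0) (list_decode (e (Suc 0)))) = 0 \<and>
     (\<forall>i<e 0. \<not> list_encode (drop i (list_decode (e (Suc 0)))) = 0))" by (intro computable_intros) simp_all
  have *: "list_encode xs = 0 \<longleftrightarrow> xs = []" for xs by (cases xs) auto
  show "(list_encode (drop m (list_decode (e 0))) = 0 \<and>
     (\<forall>i<m. \<not> list_encode (drop i (list_decode (e 0))) = 0)) \<longleftrightarrow> m = code_length (e 0)" for m and e :: "nat \<Rightarrow> nat"
    by (auto simp: * code_length_def not_le) (metis le_antisym linorder_not_le order_refl)
  show "code_length (e 0) < Suc (e 0)" for e :: "nat \<Rightarrow> nat" by (simp add: code_length_le le_imp_less_Suc)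
qed

text \<open>The code of the list of \<open>l\<close> copies of \<open>m\<close>. Monotonicity of the
  pairing makes it the largest code of a list with at most \<open>l\<close> entries, all of them at
  most \<open>m\<close>.\<close>

primrec list_bound :: "nat \<Rightarrow> nat \<Rightarrow> nat" where
  "list_bound m 0 = 0"
| "list_bound m (Suc l) = Suc (prod_encode (m, list_bound m l))"

lemma prod_encode_mono: "a \<le> a' \<Longrightarrow> b \<le> b' \<Longrightarrow> prod_encode (a, b) \<le> prod_encode (a', b')"
proof -
  have "triangle m \<le> triangle n" if "m \<le> n" for m n using that by (induction rule: dec_induct) auto
  then show "a \<le> a' \<Longrightarrow> b \<le> b' \<Longrightarrow> prod_encode (a, b) \<le> prod_encode (a', b')"
    by (simp add: prod_encode_def add_mono)
qed

lemma list_encode_le: "length xs \<le> l \<Longrightarrow> (\<And>x. x \<in> set xs \<Longrightarrow> x \<le> m) \<Longrightarrow> list_encode xs \<le> list_bound m l"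
proof (induction xs arbitrary: l)
  case (Cons x xs)
  then show ?case by (cases l) (auto intro: prod_encode_mono)
qed simp

lemma computable_list_bound [computable_intros]: assumes "computable k f" "computable k g" shows "computable k (\<lambda>e. list_bound (f e) (g e))"
proof (rule computable_compose2[OF _ assms], rule computable_cong)
  show "computable 2 (\<lambda>e. rec_nat 0 (\<lambda>i c. Suc (prod_encode (e 0, c))) (e 1))" by (intro computable_intros) simp_all
  have "list_bound m l = rec_nat 0 (\<lambda>i c. Suc (prod_encode (m, c))) l" for m l
    by (induction l) auto
  then show "list_bound (e 0) (e 1) = rec_nat 0 (\<lambda>i c. Suc (prod_encode (e 0, c))) (e 1)"
    for e :: "nat \<Rightarrow> nat" .
qed

lemma computable_list_encode_Cons [computable_intros]:
  assumes "computable k f" "computable k (\<lambda>e. list_encode (g e))" shows "computable k (\<lambda>e. list_encode (f e # g e))"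
  unfolding list_encode.simps by (intro computable_intros assms)

lemma decidable_cp: assumes "decidable_pred 1 (\<lambda>e. e 0 \<in> S)" shows "decidable S"
proof -
  from assms obtain F where F: "\<And>e. computes F (map e [0..<1]) (if e 0 \<in> S then 1 else 0)"
    unfolding decidable_pred_def computable_def by blast
  have "computes F [n] (if n \<in> S then 1 else 0)" for n
    using F[of "\<lambda>_. n"] by simp
  then show ?thesis unfolding decidable_def by blast
qed

section \<open>Linear sets and binary digits\<close>

inductive_set cone :: "('i \<Rightarrow> nat) set \<Rightarrow> ('i \<Rightarrow> nat) set" for P where
  cone_zero: "(\<lambda>_. 0) \<in> cone P"
| cone_step: "x \<in> cone P \<Longrightarrow> p \<in> P \<Longrightarrow> (\<lambda>j. x j + p j) \<in> cone P"

text \<open>The base is integral because it later plays the role of a carry, which may be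
  negative.\<close>

definition lin :: "('i \<Rightarrow> int) \<Rightarrow> ('i \<Rightarrow> nat) set \<Rightarrow> ('i \<Rightarrow> nat) set" where
  "lin c P = {x. \<exists>s\<in>cone P. \<forall>j. int (x j) = c j + int (s j)}"

lemma cone_add: assumes "x \<in> cone P" "y \<in> cone P" shows "(\<lambda>j. x j + y j) \<in> cone P"
  using assms(2)
proof (induction rule: cone.induct)
  case (cone_step y p)
  from cone.cone_step[OF cone_step(3,2)] show ?case by (simp add: add.assoc)
qed (simp add: assms(1))

lemma cone_base: "p \<in> P \<Longrightarrow> p \<in> cone P"
  using cone_step[OF cone_zero] by simp

lemma cone_mult: "x \<in> cone P \<Longrightarrow> (\<lambda>j. n * x j) \<in> cone P"
proof (induction n)
  case (Suc n)
  with cone_add[of x P "\<lambda>j. n * x j"] show ?case by simp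
qed (simp add: cone_zero)

lemma cone_sum: "finite I \<Longrightarrow> (\<And>i. i \<in> I \<Longrightarrow> x i \<in> cone P) \<Longrightarrow> (\<lambda>j. \<Sum>i\<in>I. x i j) \<in> cone P"
proof (induction rule: finite_induct)
  case (insert i I)
  with cone_add[of "x i" P "\<lambda>j. \<Sum>i\<in>I. x i j"] show ?case by simp
qed (simp add: cone_zero)

text \<open>\<open>P0\<close> collects the generators with an odd coefficient, and \<open>s'\<close>
  takes half of what remains. Coefficients are never made explicit: adding a generator toggles its
  membership in \<open>P0\<close>.\<close>

lemma cone_halve:
  assumes "s \<in> cone P" "finite P"
  shows "\<exists>P0\<subseteq>P. \<exists>s'\<in>cone P. \<forall>j. s j = (\<Sum>p\<in>P0. p j) + 2 * s' j"
  using assms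
proof (induction rule: cone.induct)
  case cone_zero
  show ?case by (rule exI[of _ "{}"]) (auto intro!: bexI[of _ "\<lambda>_. 0"] cone.cone_zero)
next
  case (cone_step x q)
  then obtain P0 s' where P0: "P0 \<subseteq> P" "s' \<in> cone P" and x: "\<And>j. x j = (\<Sum>p\<in>P0. p j) + 2 * s' j"
    by blast
  have fin: "finite P0" using P0 cone_step.prems finite_subset by blast
  show ?case
  proof (cases "q \<in> P0")
    case True
    \<comment> \<open>A second copy of \<open>q\<close> makes its coefficient even, and the pair
      moves to the halved part.\<close>
    have "x j + q j = (\<Sum>p\<in>P0 - {q}. p j) + 2 * (s' j + q j)" for j
      using True fin by (simp add: x sum.remove)
    moreover have "(\<lambda>j. s' j + q j) \<in> cone P" using P0(2) cone_step.hyps(2) by (rule cone.cone_step)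
    ultimately show ?thesis using P0(1) 
      by (intro exI[of _ "P0 - {q}"] conjI bexI[of _ "\<lambda>j. s' j + q j"]) auto
  next
    case False
    have "x j + q j = (\<Sum>p\<in>insert q P0. p j) + 2 * s' j" for j
      using False fin by (simp add: x)
    then show ?thesis using P0 cone_step.hyps(2) by (intro exI[of _ "insert q P0"]) blast
  qed
qed

lemma finite_bounded_functions:
  fixes D :: nat
  assumes "finite A"
  shows "finite {f. (\<forall>j<D. f j \<in> A) \<and> (\<forall>j\<ge>D. f j = z)}" (is "finite ?F")
    and "card {f. (\<forall>j<D. f j \<in> A) \<and> (\<forall>j\<ge>D. f j = z)} \<le> card A ^ D"
proof -
  let ?h = "\<lambda>g j. if j < D then g j else z"
  have sub: "?F \<subseteq> ?h ` (\<Pi>\<^sub>E j\<in>{..<D}. A)"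
  proof
    fix f assume "f \<in> ?F"
    then have "f = ?h (restrict f {..<D})" "restrict f {..<D} \<in> (\<Pi>\<^sub>E j\<in>{..<D}. A)" by auto
    then show "f \<in> ?h ` (\<Pi>\<^sub>E j\<in>{..<D}. A)" by blast
  qed
  have fin: "finite (\<Pi>\<^sub>E j\<in>{..<D}. A)" using assms by (intro finite_PiE) auto
  show "finite ?F" by (rule finite_subset[OF sub]) (use fin in blast)
  have "card ?F \<le> card (\<Pi>\<^sub>E j\<in>{..<D}. A)"
    using card_mono[OF _ sub] card_image_le[OF fin, of ?h] fin by (meson finite_imageI le_trans)
  then show "card ?F \<le> card A ^ D" by (simp add: card_PiE)
qed

section \<open>Profiles: membership in all linear sets of bounded description\<close>

definition vecs :: "nat \<Rightarrow> nat \<Rightarrow> (nat \<Rightarrow> nat) set" where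
  "vecs D V = {p. (\<forall>j<D. p j \<in> {..V}) \<and> (\<forall>j\<ge>D. p j = 0)}"

definition int_box :: "nat \<Rightarrow> nat \<Rightarrow> (nat \<Rightarrow> int) set" where
  "int_box D K = {c. (\<forall>j<D. c j \<in> {- int K..int K}) \<and> (\<forall>j\<ge>D. c j = 0)}"

lemma finite_vecs: "finite (vecs D V)" and card_vecs: "card (vecs D V) \<le> Suc V ^ D"
  unfolding vecs_def using finite_bounded_functions[of "{..V}" D 0] by simp_all

lemma finite_int_box: "finite (int_box D K)" and card_int_box: "card (int_box D K) \<le> (2 * K + 1) ^ D"
proof -
  have "card {- int K..int K} = 2 * K + 1" by simp
  then show "finite (int_box D K)" "card (int_box D K) \<le> (2 * K + 1) ^ D"
    unfolding int_box_def using finite_bounded_functions[of "{- int K..int K}" D 0] by simp_all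
qed

text \<open>A bound K on carries. A sum S of distinct vectors from \<open>vecs D V\<close> has
  entries at most \<open>Suc V ^ D * V\<close>, so S + 1 is at most K. If the old carry is at most K
  in absolute value, then so is half of it plus S minus a digit. The summand \<open>V\<close> makes
  room for bases taken from \<open>vecs D V\<close>.\<close>

definition box_size :: "nat \<Rightarrow> nat \<Rightarrow> nat" where
  "box_size D V = Suc V ^ D * V + V + 1"

text \<open>The state of a deterministic automaton that reads the binary digits of all coordinates
  in parallel, the most significant first, and tracks every linear set of the family.\<close>

definition profile :: "nat \<Rightarrow> nat \<Rightarrow> (nat \<Rightarrow> nat) \<Rightarrow> ((nat \<Rightarrow> int) \<times> (nat \<Rightarrow> nat) set) set" where
  "profile D V x = {(c, P). c \<in> int_box D (box_size D V) \<and> P \<subseteq> vecs D V \<and> x \<in> lin c P}"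

text \<open>Splitting off the last digit of x = c + s and, by \<open>cone_halve\<close>, the odd
  part of s leaves x div 2 = c' + s' for a new carry c' in the same box.\<close>

lemma lin_digit:
  assumes c: "c \<in> int_box D (box_size D V)" and P: "P \<subseteq> vecs D V" and x: "\<forall>j\<ge>D. x j = 0"
  shows "x \<in> lin c P \<longleftrightarrow> (\<exists>P0\<subseteq>P. \<exists>c'\<in>int_box D (box_size D V).
    (\<forall>j. 2 * c' j = c j + int (\<Sum>p\<in>P0. p j) - int (x j mod 2)) \<and> (\<lambda>j. x j div 2) \<in> lin c' P)"
proof
  have finP: "finite P" using P finite_vecs finite_subset by blast
  assume "x \<in> lin c P"
  then obtain s where s: "s \<in> cone P" "\<And>j. int (x j) = c j + int (s j)" by (auto simp: lin_def)
  then obtain P0 s' where P0: "P0 \<subseteq> P" "s' \<in> cone P" "\<And>j. s j = (\<Sum>p\<in>P0. p j) + 2 * s' j"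
    using cone_halve finP by metis
  \<comment> \<open>Defined as a difference, the carry is an integer by construction; the formula
    with the factor 2 becomes a consequence.\<close>
  define c' where "c' j = int (x j div 2) - int (s' j)" for j
  have c': "2 * c' j = c j + int (\<Sum>p\<in>P0. p j) - int (x j mod 2)" for j
  proof -
    have "int (x j) = int (2 * (x j div 2) + x j mod 2)" by simp
    then have "int (x j) = 2 * int (x j div 2) + int (x j mod 2)"
      by (simp only: of_nat_add of_nat_mult of_nat_numeral)
    with s(2)[of j] P0(3)[of j] show ?thesis by (simp add: c'_def)
  qed
  have "c' \<in> int_box D (box_size D V)"
    unfolding int_box_def
  proof safe
    fix j :: nat assume j: "j \<ge> D"
    have "(\<Sum>p\<in>P0. p j) = 0" using P0(1) P j by (intro sum.neutral) (auto simp: vecs_def)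
    with c'[of j] c x j show "c' j = 0" by (simp add: int_box_def)
  next
    fix j assume j: "j < D"
    define S where "S = (\<Sum>p\<in>P0. p j)"
    have "S \<le> of_nat (card P0) * V"
      unfolding S_def using P0(1) P j by (intro sum_bounded_above) (auto simp: vecs_def)
    moreover have "card P0 \<le> Suc V ^ D"
      using card_mono[OF finite_vecs, of P0] card_vecs[of D V] P0(1) P by (meson order_trans)
    then have "card P0 * V \<le> Suc V ^ D * V" by (rule mult_le_mono1)
    ultimately have "S + 1 \<le> box_size D V" unfolding box_size_def of_nat_id by linarith
    then have "int S + 1 \<le> int (box_size D V)" by linarith
    moreover have "- int (box_size D V) \<le> c j" "c j \<le> int (box_size D V)" using c j by (auto simp: int_box_def)
    moreover have "0 \<le> int (x j mod 2)" "int (x j mod 2) \<le> 1" by auto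
    moreover have "2 * c' j = c j + int S - int (x j mod 2)" using c'[of j] by (simp only: S_def)
    \<comment> \<open>With K for the box size, the facts give -K - 1 <= 2 c' <= 2 K - 1, and K is at
      least 1.\<close>
    ultimately have "- int (box_size D V) \<le> c' j" "c' j \<le> int (box_size D V)" by linarith+
    then show "c' j \<in> {- int (box_size D V)..int (box_size D V)}" by simp
  qed
  moreover have "(\<lambda>j. x j div 2) \<in> lin c' P"
    using P0(2) by (auto simp: lin_def c'_def)
  ultimately show "\<exists>P0\<subseteq>P. \<exists>c'\<in>int_box D (box_size D V).
    (\<forall>j. 2 * c' j = c j + int (\<Sum>p\<in>P0. p j) - int (x j mod 2)) \<and> (\<lambda>j. x j div 2) \<in> lin c' P"
    using P0(1) c' by blast
next
  have finP: "finite P" using P finite_vecs finite_subset by blast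
  assume "\<exists>P0\<subseteq>P. \<exists>c'\<in>int_box D (box_size D V).
    (\<forall>j. 2 * c' j = c j + int (\<Sum>p\<in>P0. p j) - int (x j mod 2)) \<and> (\<lambda>j. x j div 2) \<in> lin c' P"
  then obtain P0 c' s' where P0: "P0 \<subseteq> P" and c': "\<And>j. 2 * c' j = c j + int (\<Sum>p\<in>P0. p j) - int (x j mod 2)"
    and s': "s' \<in> cone P" "\<And>j. int (x j div 2) = c' j + int (s' j)"
    by (auto simp: lin_def)
  have "(\<lambda>j. (\<Sum>p\<in>P0. p j) + 2 * s' j) \<in> cone P"
    using P0 finP finite_subset[OF P0]
    by (intro cone_add cone_mult s' cone_sum cone_base) auto
  moreover have "int (x j) = c j + int ((\<Sum>p\<in>P0. p j) + 2 * s' j)" for j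
  proof -
    have "int (x j) = int (2 * (x j div 2) + x j mod 2)" by simp
    then have "int (x j) = 2 * int (x j div 2) + int (x j mod 2)"
      by (simp only: of_nat_add of_nat_mult of_nat_numeral)
    with c'[of j] s'(2)[of j] show ?thesis by simp
  qed
  ultimately show "x \<in> lin c P"
    unfolding lin_def by (intro CollectI bexI[of _ "\<lambda>j. (\<Sum>p\<in>P0. p j) + 2 * s' j"]) auto
qed

text \<open>The transition function of the automaton: the right-hand sides of
  \<open>lin_digit\<close> are determined by the last digits and the profile of the halves.\<close>

lemma profile_digit:
  assumes "\<And>j. j \<ge> D \<Longrightarrow> x j = 0" "\<And>j. j \<ge> D \<Longrightarrow> y j = 0"
    and "\<And>j. x j mod 2 = y j mod 2"
    and "profile D V (\<lambda>j. x j div 2) = profile D V (\<lambda>j. y j div 2)"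
  shows "profile D V x = profile D V y"
proof -
  have xy: "\<forall>j\<ge>D. x j = 0" "\<forall>j\<ge>D. y j = 0" using assms(1,2) by auto
  have *: "(\<lambda>j. x j div 2) \<in> lin c' P \<longleftrightarrow> (\<lambda>j. y j div 2) \<in> lin c' P"
    if "c' \<in> int_box D (box_size D V)" "P \<subseteq> vecs D V" for c' P
    using assms(4) that unfolding profile_def by blast
  have "x \<in> lin c P \<longleftrightarrow> y \<in> lin c P" if "c \<in> int_box D (box_size D V)" "P \<subseteq> vecs D V" for c P
    unfolding lin_digit[OF that xy(1)] lin_digit[OF that xy(2)]
    using * that(2) assms(3) by (simp cong: bex_cong)
  then show ?thesis unfolding profile_def by blast
qed

lemma profile_digits:
  assumes "\<And>j. j \<ge> D \<Longrightarrow> x j = 0" "\<And>j. j \<ge> D \<Longrightarrow> y j = 0"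
    and "\<And>j. x j mod 2 ^ i = y j mod 2 ^ i"
    and "profile D V (\<lambda>j. x j div 2 ^ i) = profile D V (\<lambda>j. y j div 2 ^ i)"
  shows "profile D V x = profile D V y"
  using assms
proof (induction i arbitrary: x y)
  case (Suc i)
  have mod: "z mod 2 = (z mod 2 ^ Suc i) mod 2" "z div 2 mod 2 ^ i = (z mod 2 ^ Suc i) div 2" for z :: nat
    by (simp_all add: mod_mod_cancel mod_mult2_eq)
  show ?case
  proof (rule profile_digit)
    show "x j mod 2 = y j mod 2" for j using Suc.prems(3)[of j] by (metis mod(1))
    show "profile D V (\<lambda>j. x j div 2) = profile D V (\<lambda>j. y j div 2)"
    proof (rule Suc.IH)
      show "x j div 2 mod 2 ^ i = y j div 2 mod 2 ^ i" for j using Suc.prems(3)[of j] by (metis mod(2))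
      show "profile D V (\<lambda>j. x j div 2 div 2 ^ i) = profile D V (\<lambda>j. y j div 2 div 2 ^ i)"
        using Suc.prems(4) by (simp flip: div_mult2_eq)
    qed (use Suc.prems in auto)
  qed (use Suc.prems in auto)
qed simp

text \<open>The exponent of the outer power bounds the number of profiles, which are sets of pairs
  of a carry in the box and a generating set. Numbers below \<open>witness_bound\<close> are those
  with at most that many binary digits.\<close>

definition witness_bound :: "nat \<Rightarrow> nat \<Rightarrow> nat" where
  "witness_bound D V = 2 ^ 2 ^ ((2 * box_size D V + 1) ^ D * 2 ^ (Suc V ^ D))"

text \<open>A vector with more binary digits than there are profiles has two suffixes of its digit sequence
  with the same profile; cutting out the digits in between keeps the profile.\<close>

lemma small_profile:
  assumes "\<And>j. j \<ge> D \<Longrightarrow> x j = 0"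
  obtains y where "\<And>j. j \<ge> D \<Longrightarrow> y j = 0" "\<And>j. y j < witness_bound D V" "profile D V y = profile D V x"
proof -
  let ?Q = "\<lambda>y. (\<forall>j\<ge>D. y j = 0) \<and> profile D V y = profile D V x"
  \<comment> \<open>Taking a vector with minimal sum of entries replaces an iteration of the cutting
    argument.\<close>
  obtain y where y: "?Q y" and min: "\<And>z. ?Q z \<Longrightarrow> (\<Sum>j<D. y j) \<le> (\<Sum>j<D. z j)"
    using ex_has_least_nat[of ?Q x "\<lambda>y. \<Sum>j<D. y j"] assms by blast
  define W where "W = Pow (int_box D (box_size D V) \<times> Pow (vecs D V))"
  define m :: nat where "m = 2 ^ ((2 * box_size D V + 1) ^ D * 2 ^ (Suc V ^ D))"
  have finW: "finite W" unfolding W_def by (simp add: finite_int_box finite_vecs)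
  have "card W = 2 ^ (card (int_box D (box_size D V)) * 2 ^ card (vecs D V))"
    unfolding W_def by (simp add: card_Pow card_cartesian_product finite_int_box finite_vecs)
  also have "\<dots> \<le> m" unfolding m_def
    by (intro power_increasing mult_le_mono card_int_box card_vecs) auto
  finally have cardW: "card W \<le> m" .
  have "y j < 2 ^ m" for j
  proof (rule ccontr)
    assume "\<not> y j < 2 ^ m"
    then have large: "y j \<ge> 2 ^ m" by simp
    have "(\<lambda>i. profile D V (\<lambda>j. y j div 2 ^ i)) ` {..m} \<subseteq> W"
      unfolding W_def profile_def by auto
    \<comment> \<open>There are \<open>m + 1\<close> shifts but at most \<open>m\<close>
      profiles.\<close>
    then have "\<not> inj_on (\<lambda>i. profile D V (\<lambda>j. y j div 2 ^ i)) {..m}"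
      using card_inj_on_le[of _ "{..m}" W] finW cardW by fastforce
    then obtain i i' where ii: "i < i'" "i' \<le> m"
      "profile D V (\<lambda>j. y j div 2 ^ i) = profile D V (\<lambda>j. y j div 2 ^ i')"
      unfolding inj_on_def by (metis atMost_iff linorder_neqE_nat)
    \<comment> \<open>Remove the digits at positions \<open>i\<close> to \<open>i' - 1\<close> from
      every coordinate.\<close>
    define z where "z j = y j mod 2 ^ i + 2 ^ i * (y j div 2 ^ i')" for j
    have zmod: "z j mod 2 ^ i = y j mod 2 ^ i" and zdiv: "z j div 2 ^ i = y j div 2 ^ i'" for j
      by (simp_all add: z_def)
    have z0: "z j = 0" if "j \<ge> D" for j using that y by (simp add: z_def)
    have "profile D V z = profile D V y"
      by (rule profile_digits[of D _ _ i]) (use z0 y zmod zdiv ii in auto)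
    with z0 y have "?Q z" by simp
    have div: "y j div 2 ^ i' = y j div 2 ^ i div 2 ^ (i' - i)" for j
      using ii(1) by (simp flip: div_mult2_eq power_add)
    have y_eq: "y j mod 2 ^ i + 2 ^ i * (y j div 2 ^ i) = y j" for j by simp
    have le: "z j \<le> y j" for j
    proof -
      have "z j \<le> y j mod 2 ^ i + 2 ^ i * (y j div 2 ^ i)"
        unfolding z_def div by (intro add_left_mono mult_le_mono2 div_le_dividend)
      then show ?thesis by (simp only: y_eq)
    qed
    \<comment> \<open>A coordinate of size at least \<open>2 ^ m\<close> has a non-zero digit at
      position \<open>i\<close> or above, so the cut makes it strictly smaller.\<close>
    have lt: "z j < y j"
    proof -
      have "2 ^ i \<le> (2::nat) ^ m" using ii by (intro power_increasing) auto
      then have "2 ^ i \<le> y j" using large by (rule order_trans)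
      then have "y j div 2 ^ i > 0" by (simp add: div_greater_zero_iff)
      moreover have "(2::nat) ^ (i' - i) > 1" using ii(1) by (intro one_less_power) auto
      ultimately have "y j div 2 ^ i' < y j div 2 ^ i" unfolding div by (rule div_less_dividend[rotated])
      then have "z j < y j mod 2 ^ i + 2 ^ i * (y j div 2 ^ i)"
        unfolding z_def by (intro add_strict_left_mono) simp
      then show ?thesis by (simp only: y_eq)
    qed
    then have "j < D" using y by (metis not_less_zero not_le)
    then have "(\<Sum>j<D. z j) < (\<Sum>j<D. y j)"
      using le lt by (intro sum_strict_mono_ex1) auto
    with min[OF \<open>?Q z\<close>] show False by simp
  qed
  then show thesis using that[of y] y unfolding witness_bound_def m_def by blast
qed

lemma profile_lin:
  assumes "profile D V x = profile D V y" "c \<in> vecs D V" "P \<subseteq> vecs D V"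
  shows "x \<in> lin (\<lambda>j. int (c j)) P \<longleftrightarrow> y \<in> lin (\<lambda>j. int (c j)) P"
proof -
  have "c j \<le> box_size D V" if "j < D" for j
    using assms(2) that by (auto simp: vecs_def box_size_def intro: order_trans)
  then have "(\<lambda>j. int (c j)) \<in> int_box D (box_size D V)"
    using assms(2) by (auto simp: int_box_def vecs_def intro: order_trans[of _ "0::int"])
  then show ?thesis using assms(1,3) unfolding profile_def by blast
qed

section \<open>Limit vectors in semi-linear sets\<close>

text \<open>The value 0 at infinity is harmless: where a linear combination is finite, infinite
  period entries occur with coefficient zero only.\<close>

fun efin :: "enat \<Rightarrow> nat" where
  "efin (enat n) = n"
| "efin \<infinity> = 0"

lemma enat_linear_combination:
  assumes "finite P"
  shows "b + (\<Sum>p\<in>P. f p * enat (z p)) =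
    (if b = \<infinity> \<or> (\<exists>p\<in>P. f p = \<infinity> \<and> z p \<noteq> 0) then \<infinity> else enat (efin b + (\<Sum>p\<in>P. efin (f p) * z p)))"
  using assms
proof (induction P rule: finite_induct)
  case empty
  show ?case by (cases b) auto
next
  case (insert p P)
  have "b + (\<Sum>p\<in>insert p P. f p * enat (z p)) = f p * enat (z p) + (b + (\<Sum>p\<in>P. f p * enat (z p)))"
    using insert.hyps by (simp add: ac_simps)
  also have "\<dots> = (if b = \<infinity> \<or> (\<exists>p\<in>insert p P. f p = \<infinity> \<and> z p \<noteq> 0) then \<infinity>
    else enat (efin b + (\<Sum>p\<in>insert p P. efin (f p) * z p)))"
    unfolding insert.IH using insert.hyps
    by (cases "f p"; cases "z p = 0") (auto simp: zero_enat_def[symmetric] ac_simps)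
  finally show ?case .
qed

text \<open>\<open>J\<close> marks the infinite coordinates and \<open>x\<close> supplies the finite
  ones. The offset \<open>k\<close> selects one block of the joint vector of the two automata, so
  that both constraints speak about the same \<open>x\<close>.\<close>

definition limit_vec :: "(nat \<Rightarrow> bool) \<Rightarrow> (nat \<Rightarrow> nat) \<Rightarrow> nat \<Rightarrow> nat \<Rightarrow> enat list" where
  "limit_vec J x k d = map (\<lambda>j. if J (k + j) then \<infinity> else enat (x (k + j))) [0..<d]"

lemma limit_vec_in_linear_set:
  assumes "finite P"
  shows "limit_vec J x k d \<in> linear_set d (b, P) \<longleftrightarrow>
    (\<exists>z. \<forall>j<d. (J (k + j) \<longleftrightarrow> b ! j = \<infinity> \<or> (\<exists>p\<in>P. p ! j = \<infinity> \<and> z p \<noteq> 0)) \<and>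
      (\<not> J (k + j) \<longrightarrow> x (k + j) = efin (b ! j) + (\<Sum>p\<in>P. efin (p ! j) * z p)))"
proof -
  have if_eq: "(if A then \<infinity> else enat m) = (if B then \<infinity> else enat n) \<longleftrightarrow> (A \<longleftrightarrow> B) \<and> (\<not> A \<longrightarrow> m = n)" for A B m n
    by simp
  have "limit_vec J x k d ! j = b ! j + (\<Sum>p\<in>P. p ! j * enat (z p)) \<longleftrightarrow>
      (J (k + j) \<longleftrightarrow> b ! j = \<infinity> \<or> (\<exists>p\<in>P. p ! j = \<infinity> \<and> z p \<noteq> 0)) \<and>
      (\<not> J (k + j) \<longrightarrow> x (k + j) = efin (b ! j) + (\<Sum>p\<in>P. efin (p ! j) * z p))" if "j < d" for j z
    using that unfolding enat_linear_combination[OF assms] limit_vec_def by (simp only: if_eq nth_map_upt) simp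
  then show ?thesis unfolding linear_set_def by (simp add: limit_vec_def)
qed

definition coord :: "(nat \<Rightarrow> bool) \<Rightarrow> nat \<Rightarrow> nat \<Rightarrow> nat \<Rightarrow> bool" where
  "coord J k d i \<longleftrightarrow> k \<le> i \<and> i < k + d \<and> \<not> J i"

definition finite_part :: "(nat \<Rightarrow> bool) \<Rightarrow> nat \<Rightarrow> nat \<Rightarrow> enat list \<Rightarrow> nat \<Rightarrow> nat" where
  "finite_part J k d p i = (if coord J k d i then efin (p ! (i - k)) else 0)"

definition unit_vec :: "nat \<Rightarrow> nat \<Rightarrow> nat" where
  "unit_vec i j = (if j = i then 1 else 0)"

definition free_units :: "(nat \<Rightarrow> bool) \<Rightarrow> nat \<Rightarrow> nat \<Rightarrow> nat \<Rightarrow> (nat \<Rightarrow> nat) set" where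
  "free_units J k d D = {unit_vec i | i. i < D \<and> \<not> coord J k d i}"

text \<open>Distinct periods may have equal finite parts, so the coefficients are built up by
  induction on the cone; the unit vectors vanish on the coordinates in question.\<close>

lemma cone_finite_part:
  assumes "s \<in> cone (finite_part J k d ` P \<union> free_units J k d D)" "finite P"
  shows "\<exists>z. \<forall>i. coord J k d i \<longrightarrow> s i = (\<Sum>p\<in>P. z p * efin (p ! (i - k)))"
  using assms(1)
proof (induction rule: cone.induct)
  case cone_zero
  show ?case by (rule exI[of _ "\<lambda>_. 0"]) simp
next
  case (cone_step s q)
  then obtain z where z: "\<And>i. coord J k d i \<Longrightarrow> s i = (\<Sum>p\<in>P. z p * efin (p ! (i - k)))" by blast
  from cone_step.hyps(2) show ?case
  proof
    assume "q \<in> finite_part J k d ` P"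
    then obtain p where p: "p \<in> P" "q = finite_part J k d p" by blast
    have "s i + q i = (\<Sum>p'\<in>P. (z(p := Suc (z p))) p' * efin (p' ! (i - k)))" if "coord J k d i" for i
    proof -
      have "(\<Sum>p'\<in>P - {p}. (z(p := Suc (z p))) p' * efin (p' ! (i - k)))
          = (\<Sum>p'\<in>P - {p}. z p' * efin (p' ! (i - k)))"
        by (rule sum.cong) auto
      then show ?thesis
        using that p z[OF that] assms(2) by (simp add: finite_part_def sum.remove[of P p])
    qed
    then show ?thesis by blast
  next
    assume "q \<in> free_units J k d D"
    then have "q i = 0" if "coord J k d i" for i
      using that by (auto simp: free_units_def unit_vec_def)
    then show ?thesis using z by (intro exI[of _ z]) simp
  qed
qed

text \<open>After fixing the set of periods with a non-zero coefficient, the infinite coordinates are settled,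
  and the finite ones form a linear set in which the remaining coordinates are unconstrained.\<close>

lemma limit_vec_in_linear_set_iff_lin:
  assumes P: "finite P" and x: "\<forall>i\<ge>D. x i = 0"
  shows "limit_vec J x k d \<in> linear_set d (b, P) \<longleftrightarrow>
    (\<exists>P'\<subseteq>P. (\<forall>j<d. J (k + j) \<longleftrightarrow> b ! j = \<infinity> \<or> (\<exists>p\<in>P'. p ! j = \<infinity>)) \<and>
      x \<in> lin (\<lambda>i. int (finite_part J k d b i + (\<Sum>p\<in>P'. finite_part J k d p i)))
        (finite_part J k d ` P' \<union> free_units J k d D))" (is "?L \<longleftrightarrow> ?R")
proof
  assume ?L
  then obtain z where z: "\<And>j. j < d \<Longrightarrow> J (k + j) \<longleftrightarrow> b ! j = \<infinity> \<or> (\<exists>p\<in>P. p ! j = \<infinity> \<and> z p \<noteq> 0)"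
    "\<And>j. j < d \<Longrightarrow> \<not> J (k + j) \<Longrightarrow> x (k + j) = efin (b ! j) + (\<Sum>p\<in>P. efin (p ! j) * z p)"
    unfolding limit_vec_in_linear_set[OF P] by blast
  define P' where "P' = {p \<in> P. z p \<noteq> 0}"
  have P': "P' \<subseteq> P" "finite P'" using P by (auto simp: P'_def)
  let ?fp = "finite_part J k d"
  let ?free = "{i. i < D \<and> \<not> coord J k d i}"
  \<comment> \<open>The base already contains each period of \<open>P'\<close> once, hence the
    coefficient \<open>z p - 1\<close>. The unit vectors supply the unconstrained
    coordinates.\<close>
  define s where "s i = (\<Sum>p\<in>P'. (z p - 1) * ?fp p i) + (\<Sum>m\<in>?free. x m * unit_vec m i)" for i
  have "s \<in> cone (?fp ` P' \<union> free_units J k d D)"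
    unfolding s_def using P'
    by (intro cone_add cone_sum cone_mult cone_base) (auto simp: free_units_def)
  moreover have "int (x i) = int (?fp b i + (\<Sum>p\<in>P'. ?fp p i)) + int (s i)" for i
  proof (cases "coord J k d i")
    case True
    then obtain j where j: "i = k + j" "j < d" "\<not> J (k + j)"
      unfolding coord_def by (metis add.commute add_less_cancel_left le_Suc_ex)
    have free: "(\<Sum>m\<in>?free. x m * unit_vec m i) = 0"
      using True by (intro sum.neutral) (auto simp: unit_vec_def)
    have "(\<Sum>p\<in>P. efin (p ! j) * z p) = (\<Sum>p\<in>P'. efin (p ! j) * z p)"
      using P by (intro sum.mono_neutral_right) (auto simp: P'_def)
    also have "\<dots> = (\<Sum>p\<in>P'. efin (p ! j) + (z p - 1) * efin (p ! j))"
    proof (rule sum.cong[OF refl])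
      fix p assume "p \<in> P'"
      then obtain n where "z p = Suc n" by (auto simp: P'_def gr0_conv_Suc)
      then show "efin (p ! j) * z p = efin (p ! j) + (z p - 1) * efin (p ! j)" by simp
    qed
    also have "\<dots> = (\<Sum>p\<in>P'. efin (p ! j)) + (\<Sum>p\<in>P'. (z p - 1) * efin (p ! j))"
      by (rule sum.distrib)
    finally have "x i = ?fp b i + (\<Sum>p\<in>P'. ?fp p i) + s i"
      unfolding s_def free using True z(2)[OF j(2,3)] j(1) by (simp add: finite_part_def)
    then show ?thesis by simp
  next
    case False
    have "(\<Sum>m\<in>?free. x m * unit_vec m i) = (\<Sum>m\<in>?free. if i = m then x m else 0)"
      by (rule sum.cong) (auto simp: unit_vec_def)
    also have "\<dots> = x i" using False x by (auto simp: not_less)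
    finally show ?thesis using False by (simp add: finite_part_def s_def)
  qed
  ultimately have "x \<in> lin (\<lambda>i. int (?fp b i + (\<Sum>p\<in>P'. ?fp p i))) (?fp ` P' \<union> free_units J k d D)"
    unfolding lin_def by blast
  moreover have "\<forall>j<d. J (k + j) \<longleftrightarrow> b ! j = \<infinity> \<or> (\<exists>p\<in>P'. p ! j = \<infinity>)"
    using z(1) by (auto simp: P'_def)
  ultimately show ?R using P'(1) by blast
next
  assume ?R
  then obtain P' s where P': "P' \<subseteq> P" and J: "\<And>j. j < d \<Longrightarrow> J (k + j) \<longleftrightarrow> b ! j = \<infinity> \<or> (\<exists>p\<in>P'. p ! j = \<infinity>)"
    and s: "s \<in> cone (finite_part J k d ` P' \<union> free_units J k d D)"
    and xs: "\<And>i. int (x i) = int (finite_part J k d b i + (\<Sum>p\<in>P'. finite_part J k d p i)) + int (s i)"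
    unfolding lin_def by blast
  have fin: "finite P'" using P P' finite_subset by blast
  from cone_finite_part[OF s fin] obtain z
    where z: "\<And>i. coord J k d i \<Longrightarrow> s i = (\<Sum>p\<in>P'. z p * efin (p ! (i - k)))" by blast
  \<comment> \<open>The successor accounts for the copy in the base and ensures that exactly the
    periods in \<open>P'\<close> have a non-zero coefficient, as the infinite coordinates
    demand.\<close>
  define z' where "z' p = (if p \<in> P' then Suc (z p) else 0)" for p
  have "x (k + j) = efin (b ! j) + (\<Sum>p\<in>P. efin (p ! j) * z' p)" if j: "j < d" "\<not> J (k + j)" for j
  proof -
    have c: "coord J k d (k + j)" using j by (simp add: coord_def)
    have "(\<Sum>p\<in>P. efin (p ! j) * z' p) = (\<Sum>p\<in>P'. efin (p ! j) * z' p)"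
      using P P' by (intro sum.mono_neutral_right) (auto simp: z'_def)
    also have "\<dots> = (\<Sum>p\<in>P'. efin (p ! j) + z p * efin (p ! j))"
      by (rule sum.cong) (auto simp: z'_def)
    also have "\<dots> = (\<Sum>p\<in>P'. efin (p ! j)) + (\<Sum>p\<in>P'. z p * efin (p ! j))"
      by (rule sum.distrib)
    finally have "int (efin (b ! j) + (\<Sum>p\<in>P. efin (p ! j) * z' p)) = int (x (k + j))"
      using c by (simp add: xs finite_part_def z)
    then show ?thesis by (simp only: of_nat_eq_iff)
  qed
  moreover have "J (k + j) \<longleftrightarrow> b ! j = \<infinity> \<or> (\<exists>p\<in>P. p ! j = \<infinity> \<and> z' p \<noteq> 0)" if "j < d" for j
    using J[OF that] P' by (auto simp: z'_def)
  ultimately show ?L unfolding limit_vec_in_linear_set[OF P] by blast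
qed

text \<open>For fixed \<open>J\<close>, the linear sets in
  \<open>limit_vec_in_linear_set_iff_lin\<close> do not depend on the vector. \<open>V\<close>
  bounds their bases, in which all periods of \<open>P'\<close> are added up, and
  \<open>1 \<le> V\<close> admits the unit vectors.\<close>

lemma limit_vec_profile:
  assumes P: "finite P" and "k + d \<le> D" and V: "1 \<le> V"
    "\<And>j. j < d \<Longrightarrow> efin (b ! j) + (\<Sum>p\<in>P. efin (p ! j)) \<le> V"
    and xy: "\<forall>i\<ge>D. x i = 0" "\<forall>i\<ge>D. y i = 0" "profile D V x = profile D V y"
  shows "limit_vec J x k d \<in> linear_set d (b, P) \<longleftrightarrow> limit_vec J y k d \<in> linear_set d (b, P)"
proof -
  have "x \<in> lin (\<lambda>i. int (finite_part J k d b i + (\<Sum>p\<in>P'. finite_part J k d p i)))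
        (finite_part J k d ` P' \<union> free_units J k d D) \<longleftrightarrow>
      y \<in> lin (\<lambda>i. int (finite_part J k d b i + (\<Sum>p\<in>P'. finite_part J k d p i)))
        (finite_part J k d ` P' \<union> free_units J k d D)" if P': "P' \<subseteq> P" for P'
  proof (rule profile_lin[OF xy(3)])
    show "(\<lambda>i. finite_part J k d b i + (\<Sum>p\<in>P'. finite_part J k d p i)) \<in> vecs D V"
      unfolding vecs_def
    proof (intro CollectI conjI allI impI)
      fix i assume "i < D"
      show "finite_part J k d b i + (\<Sum>p\<in>P'. finite_part J k d p i) \<in> {..V}"
      proof (cases "coord J k d i")
        case True
        then have "i - k < d" unfolding coord_def by linarith
        moreover have "(\<Sum>p\<in>P'. efin (p ! (i - k))) \<le> (\<Sum>p\<in>P. efin (p ! (i - k)))"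
          using P P' by (intro sum_mono2) auto
        ultimately show ?thesis using True V(2)[of "i - k"] by (simp add: finite_part_def)
      qed (simp add: finite_part_def)
    next
      fix i assume "D \<le> i"
      then show "finite_part J k d b i + (\<Sum>p\<in>P'. finite_part J k d p i) = 0"
        using assms(2) by (simp add: finite_part_def coord_def)
    qed
    show "finite_part J k d ` P' \<union> free_units J k d D \<subseteq> vecs D V"
    proof
      fix q assume "q \<in> finite_part J k d ` P' \<union> free_units J k d D"
      then show "q \<in> vecs D V"
      proof
        assume "q \<in> finite_part J k d ` P'"
        then obtain p where p: "p \<in> P" "q = finite_part J k d p" using P' by blast
        have "efin (p ! j) \<le> V" if "j < d" for j
          using V(2)[OF that] member_le_sum[of p P "\<lambda>p. efin (p ! j)"] P p(1) by simp
        with p(2) assms(2) show ?thesis by (auto simp: vecs_def finite_part_def coord_def)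
      next
        assume "q \<in> free_units J k d D"
        then show ?thesis using V(1) by (auto simp: vecs_def free_units_def unit_vec_def)
      qed
    qed
  qed
  then show ?thesis
    unfolding limit_vec_in_linear_set_iff_lin[OF P xy(1)] limit_vec_in_linear_set_iff_lin[OF P xy(2)]
    by blast
qed

section \<open>Lassos in graphs with vector labels\<close>

fun walk :: "'e set \<Rightarrow> ('e \<Rightarrow> 's) \<Rightarrow> ('e \<Rightarrow> 's) \<Rightarrow> 's \<Rightarrow> 'e list \<Rightarrow> 's \<Rightarrow> bool" where
  "walk E src tgt p [] q \<longleftrightarrow> p = q"
| "walk E src tgt p (e # es) q \<longleftrightarrow> e \<in> E \<and> src e = p \<and> walk E src tgt (tgt e) es q"

lemma INFM_iff_limit:
  assumes "finite (range \<pi>)"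
  shows "(\<exists>\<^sub>\<infinity>i. P (\<pi> i)) \<longleftrightarrow> (\<exists>e\<in>limit \<pi>. P e)"
proof
  assume inf: "\<exists>\<^sub>\<infinity>i. P (\<pi> i)"
  from limit_is_suffix[OF assms] obtain k where k: "limit \<pi> = range (suffix k \<pi>)" by blast
  from inf obtain i where "i \<ge> k" "P (\<pi> i)" unfolding INFM_nat_le by blast
  moreover from this have "\<pi> i \<in> limit \<pi>" unfolding k using rangeI[of "suffix k \<pi>" "i - k"] by simp
  ultimately show "\<exists>e\<in>limit \<pi>. P e" by blast
next
  assume "\<exists>e\<in>limit \<pi>. P e"
  then obtain e where "\<exists>\<^sub>\<infinity>i. \<pi> i = e" "P e" by (auto simp: limit_def)
  then show "\<exists>\<^sub>\<infinity>i. P (\<pi> i)" by (auto elim: INFM_mono)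
qed

locale vec_graph =
  fixes E :: "'e set" and src tgt :: "'e \<Rightarrow> 's" and vec :: "'e \<Rightarrow> nat \<Rightarrow> nat" and D :: nat
  assumes finite_E: "finite E" and vec_support: "j \<ge> D \<Longrightarrow> vec e j = 0"
begin

abbreviation "awalk \<equiv> walk E src tgt"

definition vec_sum :: "'e list \<Rightarrow> nat \<Rightarrow> nat" where
  "vec_sum es j = (\<Sum>e\<leftarrow>es. vec e j)"

definition path :: "'s \<Rightarrow> (nat \<Rightarrow> 'e) \<Rightarrow> bool" where
  "path s \<pi> \<longleftrightarrow> src (\<pi> 0) = s \<and> (\<forall>i. \<pi> i \<in> E \<and> src (\<pi> (Suc i)) = tgt (\<pi> i))"

definition path_limit :: "(nat \<Rightarrow> 'e) \<Rightarrow> nat \<Rightarrow> nat \<Rightarrow> enat list" where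
  "path_limit \<pi> = limit_vec (\<lambda>j. \<exists>\<^sub>\<infinity>i. vec (\<pi> i) j \<noteq> 0) (\<lambda>j. \<Sum>i\<in>{i. vec (\<pi> i) j \<noteq> 0}. vec (\<pi> i) j)"

text \<open>An edge of the loop is repeated forever, so a non-zero entry makes its coordinate
  infinite; where the loop vanishes, the prefix alone contributes.\<close>

definition lasso_limit :: "'e list \<Rightarrow> 'e list \<Rightarrow> nat \<Rightarrow> nat \<Rightarrow> enat list" where
  "lasso_limit u w = limit_vec (\<lambda>j. \<exists>e\<in>set w. vec e j \<noteq> 0) (vec_sum u)"

definition lasso :: "'s \<Rightarrow> 'e list \<Rightarrow> 'e list \<Rightarrow> bool" where
  "lasso s u w \<longleftrightarrow> w \<noteq> [] \<and> (\<exists>p. awalk s u p \<and> awalk p w p)"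

lemma vec_sum_append [simp]: "vec_sum (u @ v) j = vec_sum u j + vec_sum v j"
  by (simp add: vec_sum_def)

lemma vec_sum_support: "j \<ge> D \<Longrightarrow> vec_sum u j = 0"
  by (simp add: vec_sum_def vec_support)

lemma walk_append: "awalk p (u @ v) q \<longleftrightarrow> (\<exists>m. awalk p u m \<and> awalk m v q)"
  by (induction u arbitrary: p) auto

lemma walk_edges: "awalk p u q \<Longrightarrow> set u \<subseteq> E"
  by (induction u arbitrary: p) auto

text \<open>A non-empty edge sequence determines both ends of any walk along it. Thus a cycle found
  by its edges can be removed from the walk around it.\<close>

lemma closed_walk_ends: "awalk p c q \<Longrightarrow> awalk v c v \<Longrightarrow> c \<noteq> [] \<Longrightarrow> p = v \<and> q = v"
proof -
  have end_unique: "awalk p u q \<Longrightarrow> awalk p u q' \<Longrightarrow> q = q'" for u p q q'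
    by (induction u arbitrary: p) auto
  show "awalk p c q \<Longrightarrow> awalk v c v \<Longrightarrow> c \<noteq> [] \<Longrightarrow> p = v \<and> q = v"
    by (cases c) (auto dest: end_unique)
qed

lemma walk_nth_iff:
  "awalk p u q \<longleftrightarrow> set u \<subseteq> E \<and> (if u = [] then p = q else src (u ! 0) = p \<and> tgt (u ! (length u - 1)) = q) \<and>
     (\<forall>i. Suc i < length u \<longrightarrow> src (u ! Suc i) = tgt (u ! i))"
proof (induction u arbitrary: p)
  case (Cons e u)
  have "(\<forall>i. Suc i < length (e # u) \<longrightarrow> src ((e # u) ! Suc i) = tgt ((e # u) ! i)) \<longleftrightarrow>
    (u \<noteq> [] \<longrightarrow> src (u ! 0) = tgt e) \<and> (\<forall>i. Suc i < length u \<longrightarrow> src (u ! Suc i) = tgt (u ! i))"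
    by (auto simp: nth_Cons split: nat.split)
  then show ?case by (auto simp: Cons nth_Cons')
qed simp

lemma walk_path: "path s \<pi> \<Longrightarrow> i \<le> j \<Longrightarrow> awalk (src (\<pi> i)) (map \<pi> [i..<j]) (src (\<pi> j))"
proof (induction "j - i" arbitrary: i)
  case (Suc n)
  then have "awalk (src (\<pi> (Suc i))) (map \<pi> [Suc i..<j]) (src (\<pi> j))" by simp
  with Suc show ?case by (simp add: upt_conv_Cons path_def)
qed simp

lemma finite_range_path: "path s \<pi> \<Longrightarrow> finite (range \<pi>)"
  using finite_E by (auto simp: path_def intro: finite_subset)

lemma limit_vec_cong:
  "(\<And>j. J j \<longleftrightarrow> J' j) \<Longrightarrow> (\<And>j. \<not> J' j \<Longrightarrow> x j = y j) \<Longrightarrow> limit_vec J x = limit_vec J' y"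
  by (auto simp: limit_vec_def fun_eq_iff)

text \<open>The loop is a segment of a suffix in which only recurring edges occur, long enough to
  contain all of them.\<close>

lemma path_to_lasso:
  assumes "path s \<pi>"
  shows "\<exists>u w. lasso s u w \<and> set w = limit \<pi> \<and> lasso_limit u w = path_limit \<pi>"
proof -
  note fin = finite_range_path[OF assms]
  from limit_is_suffix[OF fin] obtain N where N: "limit \<pi> = range (suffix N \<pi>)" by blast
  have N': "\<pi> i \<in> limit \<pi>" if "N \<le> i" for i
    unfolding N using that rangeI[of "suffix N \<pi>" "i - N"] by simp
  have "\<exists>i\<ge>N. \<pi> i = e" if "e \<in> limit \<pi>" for e
  proof -
    from that obtain n where "e = \<pi> (N + n)" unfolding N by auto
    then show ?thesis by (intro exI[of _ "N + n"]) simp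
  qed
  then obtain f where f: "\<And>e. e \<in> limit \<pi> \<Longrightarrow> f e \<ge> N \<and> \<pi> (f e) = e" by metis
  have "finite (limit \<pi>)" by (rule finite_subset[OF _ fin]) (auto simp: N)
  then obtain m where m: "\<forall>i\<in>f ` limit \<pi>. i < m" using finite_nat_set_iff_bounded[of "f ` limit \<pi>"] by blast
  have "\<exists>\<^sub>\<infinity>i. \<pi> i = \<pi> N" using N'[of N] by (simp add: limit_def)
  \<comment> \<open>Returning to the edge at position \<open>N\<close> means returning to its
    source, which closes the loop. The bound \<open>m\<close> makes the loop cover all recurring
    edges, and \<open>Suc N\<close> makes it non-empty.\<close>
  then obtain M where M: "M \<ge> max m (Suc N)" "\<pi> M = \<pi> N" unfolding INFM_nat_le by blast
  define u w where "u = map \<pi> [0..<N]" and "w = map \<pi> [N..<M]"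
  have set_w: "set w = limit \<pi>"
  proof
    show "set w \<subseteq> limit \<pi>" using N' by (auto simp: w_def)
    show "limit \<pi> \<subseteq> set w"
    proof
      fix e assume e: "e \<in> limit \<pi>"
      with m have "f e < m" by blast
      with M(1) have "f e < M" by simp
      with f[OF e] show "e \<in> set w" by (auto simp: w_def intro!: image_eqI[of _ _ "f e"])
    qed
  qed
  have "src (\<pi> 0) = s" using assms by (simp add: path_def)
  then have "awalk s u (src (\<pi> N))" using walk_path[OF assms, of 0 N] by (simp add: u_def)
  moreover have "N \<le> M" "w \<noteq> []" using M(1) by (simp_all add: w_def)
  then have "awalk (src (\<pi> N)) w (src (\<pi> N))"
    using walk_path[OF assms, of N M] by (simp only: w_def M(2))
  ultimately have "lasso s u w" using \<open>w \<noteq> []\<close> unfolding lasso_def by blast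
  moreover have "lasso_limit u w = path_limit \<pi>"
    unfolding lasso_limit_def path_limit_def
  proof (rule limit_vec_cong)
    show J: "(\<exists>e\<in>set w. vec e j \<noteq> 0) \<longleftrightarrow> (\<exists>\<^sub>\<infinity>i. vec (\<pi> i) j \<noteq> 0)" for j
      unfolding set_w using INFM_iff_limit[OF fin, of "\<lambda>e. vec e j \<noteq> 0"] by simp
    show "vec_sum u j = (\<Sum>i\<in>{i. vec (\<pi> i) j \<noteq> 0}. vec (\<pi> i) j)" if "\<not> (\<exists>\<^sub>\<infinity>i. vec (\<pi> i) j \<noteq> 0)" for j
    proof -
      have "vec (\<pi> i) j = 0" if "i \<ge> N" for i
        using \<open>\<not> (\<exists>\<^sub>\<infinity>i. _ i)\<close> N'[OF that] unfolding J[symmetric] set_w by blast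
      then have "{i. vec (\<pi> i) j \<noteq> 0} \<subseteq> {0..<N}" by (metis (mono_tags, lifting) atLeastLessThan_iff mem_Collect_eq not_le subsetI zero_le)
      then have "(\<Sum>i\<in>{0..<N}. vec (\<pi> i) j) = (\<Sum>i\<in>{i. vec (\<pi> i) j \<noteq> 0}. vec (\<pi> i) j)"
        by (intro sum.mono_neutral_right) auto
      then show ?thesis by (simp add: vec_sum_def u_def comp_def interv_sum_list_conv_sum_set_nat)
    qed
  qed
  ultimately show ?thesis using set_w by blast
qed

lemma lasso_to_path:
  assumes "lasso s u w"
  shows "\<exists>\<pi>. path s \<pi> \<and> set w = limit \<pi> \<and> lasso_limit u w = path_limit \<pi>"
proof -
  from assms obtain p where w: "w \<noteq> []" and walks: "awalk s u p" "awalk p w p" by (auto simp: lasso_def)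
  define \<pi> where "\<pi> = u \<frown> w\<^sup>\<omega>"
  have \<pi>: "\<pi> i = (if i < length u then u ! i else w ! ((i - length u) mod length w))" for i
    using w by (simp add: \<pi>_def conc_def iter_def)
  note u' = walks(1)[unfolded walk_nth_iff] and w' = walks(2)[unfolded walk_nth_iff]
  have w0: "src (w ! 0) = p" and wl: "tgt (w ! (length w - 1)) = p" using w' w by auto
  have "path s \<pi>"
    unfolding path_def
  proof (intro conjI allI)
    show "src (\<pi> 0) = s" using u' w0 by (auto simp: \<pi>)
    fix i
    show "\<pi> i \<in> E" using u' w' w by (auto simp: \<pi> subset_iff)
    show "src (\<pi> (Suc i)) = tgt (\<pi> i)"
    proof (cases "i < length u")
      case True
      show ?thesis
      proof (cases "Suc i = length u")
        case True
        then have i: "i = length u - 1" "u \<noteq> []" by auto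
        then have "tgt (u ! (length u - 1)) = p" using u' by simp
        moreover have "\<pi> i = u ! i" using \<open>i < length u\<close> by (simp add: \<pi>)
        then have "\<pi> i = u ! (length u - 1)" by (simp only: i(1)[symmetric])
        moreover have "\<pi> (Suc i) = w ! 0" using True by (simp add: \<pi>)
        ultimately show ?thesis using w0 by simp
      next
        case False
        then show ?thesis using u' True by (simp add: \<pi>)
      qed
    next
      case False
      define k where "k = (i - length u) mod length w"
      have k: "k < length w" using w by (simp add: k_def)
      have "\<pi> i = w ! k" using False by (simp add: \<pi> k_def)
      moreover have "\<pi> (Suc i) = w ! (if Suc k = length w then 0 else Suc k)"
        using False by (simp add: \<pi> k_def Suc_diff_le mod_Suc)
      moreover have "src (w ! (if Suc k = length w then 0 else Suc k)) = tgt (w ! k)"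
      proof (cases "Suc k = length w")
        case True
        then have "k = length w - 1" by linarith
        then have "tgt (w ! k) = p" using wl by (simp only:)
        then show ?thesis unfolding if_P[OF True] w0 by (rule sym)
      next
        case False
        with k have "Suc k < length w" by linarith
        with w' have "src (w ! Suc k) = tgt (w ! k)" by blast
        then show ?thesis unfolding if_not_P[OF False] .
      qed
      ultimately show ?thesis by (simp only:)
    qed
  qed
  have lim: "limit \<pi> = set w" using w by (simp add: \<pi>_def)
  note fin = finite_range_path[OF \<open>path s \<pi>\<close>]
  have "lasso_limit u w = path_limit \<pi>"
    unfolding lasso_limit_def path_limit_def
  proof (rule limit_vec_cong)
    show J: "(\<exists>e\<in>set w. vec e j \<noteq> 0) \<longleftrightarrow> (\<exists>\<^sub>\<infinity>i. vec (\<pi> i) j \<noteq> 0)" for j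
      unfolding lim[symmetric] using INFM_iff_limit[OF fin, of "\<lambda>e. vec e j \<noteq> 0"] by simp
    show "vec_sum u j = (\<Sum>i\<in>{i. vec (\<pi> i) j \<noteq> 0}. vec (\<pi> i) j)" if "\<not> (\<exists>\<^sub>\<infinity>i. vec (\<pi> i) j \<noteq> 0)" for j
    proof -
      have "vec (\<pi> i) j = 0" if "i \<ge> length u" for i
        using \<open>\<not> (\<exists>\<^sub>\<infinity>i. _ i)\<close> that w unfolding J[symmetric] by (auto simp: \<pi>)
      then have "{i. vec (\<pi> i) j \<noteq> 0} \<subseteq> {0..<length u}" by (metis (mono_tags, lifting) atLeastLessThan_iff mem_Collect_eq not_le subsetI zero_le)
      then have "(\<Sum>i\<in>{i. vec (\<pi> i) j \<noteq> 0}. vec (\<pi> i) j) = (\<Sum>i\<in>{0..<length u}. vec (\<pi> i) j)"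
        by (intro sum.mono_neutral_left) auto
      also have "\<dots> = (\<Sum>i\<in>{0..<length u}. vec (u ! i) j)" by (rule sum.cong) (auto simp: \<pi>)
      also have "\<dots> = vec_sum u j" by (simp add: vec_sum_def sum_list_sum_nth)
      finally show ?thesis by simp
    qed
  qed
  then show ?thesis using \<open>path s \<pi>\<close> lim by blast
qed

section \<open>Removing and inserting cycles\<close>

lemma repeated_state:
  assumes "awalk p u q" "length u > card E"
  shows "\<exists>a c b v. u = a @ c @ b \<and> c \<noteq> [] \<and> awalk v c v"
proof -
  \<comment> \<open>Pigeonhole on the sources of edges, of which there are at most
    \<open>card E\<close>.\<close>
  have "card (set (map src u)) \<le> card E"
    using card_mono[of "src ` E" "set (map src u)"] card_image_le[OF finite_E, of src] walk_edges[OF assms(1)] finite_E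
    by (auto intro: order_trans)
  then have "\<not> distinct (map src u)" using assms(2) distinct_card by fastforce
  then obtain xs y ys zs where "map src u = xs @ [y] @ ys @ [y] @ zs" using not_distinct_decomp by blast
  then obtain a r where u: "u = a @ r" "map src r = y # ys @ y # zs" by (auto simp: map_eq_append_conv)
  then obtain e r' where r: "r = e # r'" "src e = y" "map src r' = ys @ y # zs" by auto
  then obtain c r'' where r': "r' = c @ r''" "map src r'' = y # zs" by (auto simp: map_eq_append_conv)
  then obtain e' b where "r'' = e' # b" "src e' = y" by auto
  with u r r' have u: "u = a @ (e # c) @ (e' # b)" "src e = y" "src e' = y" by simp_all
  from assms(1) obtain m m' where "awalk m (e # c) m'" "awalk m' (e' # b) q"
    unfolding u(1) walk_append by blast
  then have "awalk y (e # c) y" using u(2,3) by auto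
  with u(1) show ?thesis by blast
qed

text \<open>In a long walk, read in blocks of length \<open>card E + 1\<close>, some block has no edge that is new to
  it, and such a block contains a cycle.\<close>

lemma redundant_cycle:
  assumes "awalk p u q" "length u \<ge> Suc n * Suc (card E)" "card (E - S) \<le> n"
  shows "\<exists>a c b v. u = a @ c @ b \<and> c \<noteq> [] \<and> awalk v c v \<and> length c \<le> Suc (card E) \<and> set c \<subseteq> S \<union> set a"
  using assms
proof (induction n arbitrary: p u S)
  case (0 p u S)
  define u1 where "u1 = take (Suc (card E)) u"
  obtain m where "awalk p u1 m"
    using 0(1) walk_append[of p u1 "drop (Suc (card E)) u"] by (auto simp: u1_def)
  moreover have len: "length u1 = Suc (card E)" using 0(2) by (simp add: u1_def)
  ultimately obtain a c b v where c: "u1 = a @ c @ b" "c \<noteq> []" "awalk v c v"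
    using repeated_state[of p u1 m] by auto
  have "u = a @ c @ (b @ drop (Suc (card E)) u)"
    using append_take_drop_id[of "Suc (card E)" u] c(1) unfolding u1_def by (metis append.assoc)
  moreover have "set c \<subseteq> S" using 0(3) finite_E walk_edges[OF c(3)] by auto
  moreover have "length c \<le> Suc (card E)" using len c(1) by simp
  ultimately show ?case using c(2,3) by blast
next
  case (Suc n p u S)
  define u1 u2 where "u1 = take (Suc (card E)) u" and "u2 = drop (Suc (card E)) u"
  have u: "u = u1 @ u2" by (simp add: u1_def u2_def)
  obtain m where m: "awalk p u1 m" "awalk m u2 q"
    using Suc.prems(1) unfolding u walk_append by blast
  have len: "length u1 = Suc (card E)" using Suc.prems(2) by (simp add: u1_def)
  show ?case
  proof (cases "set u1 \<subseteq> S")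
    case True
    obtain a c b v where c: "u1 = a @ c @ b" "c \<noteq> []" "awalk v c v"
      using repeated_state[OF m(1)] len by auto
    have "u = a @ c @ (b @ u2)" by (simp add: u c(1))
    moreover have "set c \<subseteq> S" "length c \<le> Suc (card E)" using True len c(1) by auto
    ultimately show ?thesis using c(2,3) by blast
  next
    case False
    \<comment> \<open>The first block contains an edge outside \<open>S\<close>. Adding its edges to
      \<open>S\<close> lowers the number of missing edges, which pays for the block.\<close>
    have "E - (S \<union> set u1) \<subset> E - S" using False walk_edges[OF m(1)] by blast
    then have "card (E - (S \<union> set u1)) < card (E - S)" using finite_E by (intro psubset_card_mono) auto
    then have "card (E - (S \<union> set u1)) \<le> n" using Suc.prems(3) by simp
    moreover have "length u2 \<ge> Suc n * Suc (card E)" using Suc.prems(2) by (simp add: u2_def)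
    ultimately obtain a c b v where c: "u2 = a @ c @ b" "c \<noteq> []" "awalk v c v"
      "length c \<le> Suc (card E)" "set c \<subseteq> (S \<union> set u1) \<union> set a"
      using Suc.IH[OF m(2)] by blast
    then have "u = (u1 @ a) @ c @ b" "set c \<subseteq> S \<union> set (u1 @ a)" by (auto simp: u)
    with c show ?thesis by blast
  qed
qed

text \<open>Generators for prefix vectors. Cycles with edges in \<open>X\<close> can be inserted
  into any walk with edge set \<open>X\<close> without enlarging that set.\<close>

definition cycle_vecs :: "'e set \<Rightarrow> (nat \<Rightarrow> nat) set" where
  "cycle_vecs X = vec_sum ` {c. c \<noteq> [] \<and> set c \<subseteq> X \<and> length c \<le> Suc (card E) \<and> (\<exists>v. awalk v c v)}"

text \<open>A removed cycle only has edges that also occur before it. Hence the edge set is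
  invariant, and all removed cycles still fit the final walk. The lemma also shortens the loop,
  where only the edge set counts.\<close>

lemma skeleton:
  assumes "awalk p u q"
  shows "\<exists>u0. awalk p u0 q \<and> set u0 = set u \<and> length u0 \<le> Suc (card E) ^ 2 \<and>
    (\<exists>y\<in>cone (cycle_vecs (set u)). \<forall>j. vec_sum u j = vec_sum u0 j + y j)"
  using assms
proof (induction "length u" arbitrary: u rule: less_induct)
  case less
  show ?case
  proof (cases "length u \<le> Suc (card E) ^ 2")
    case True
    then show ?thesis using less.prems
      by (intro exI[of _ u]) (auto intro!: bexI[of _ "\<lambda>_. 0"] cone_zero)
  next
    case False
    then obtain a c b v where c: "u = a @ c @ b" "c \<noteq> []" "awalk v c v"
      "length c \<le> Suc (card E)" "set c \<subseteq> set a"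
      using redundant_cycle[OF less.prems, of "card E" "{}"] by (auto simp: power2_eq_square)
    from less.prems obtain m m' where "awalk p a m" "awalk m c m'" "awalk m' b q"
      unfolding c(1) walk_append by blast
    with closed_walk_ends[OF _ c(3,2)] have walk: "awalk p (a @ b) q" unfolding walk_append by blast
    have set: "set (a @ b) = set u" using c by auto
    from less.hyps[OF _ walk] c(1,2) set obtain u0 y where u0: "awalk p u0 q" "set u0 = set u"
      "length u0 \<le> Suc (card E) ^ 2" and y: "y \<in> cone (cycle_vecs (set u))"
      "\<And>j. vec_sum (a @ b) j = vec_sum u0 j + y j" by auto
    have "vec_sum c \<in> cycle_vecs (set u)" using c by (auto simp: cycle_vecs_def)
    with y(1) have "(\<lambda>j. y j + vec_sum c j) \<in> cone (cycle_vecs (set u))" by (rule cone_step)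
    moreover have "vec_sum u j = vec_sum u0 j + (y j + vec_sum c j)" for j using y(2)[of j] by (simp add: c(1))
    ultimately show ?thesis using u0
      by (intro exI[of _ u0] conjI bexI[of _ "\<lambda>j. y j + vec_sum c j"]) auto
  qed
qed

text \<open>The counterpart of \<open>skeleton\<close>: a cycle is inserted in front of an
  occurrence of its first edge. Cycles with zero vector are skipped, so each insertion raises the
  sum of the entries by at least one, which bounds the length.\<close>

lemma insert_cycles:
  assumes "y \<in> cone (cycle_vecs (set u0))" "awalk p u0 q"
  shows "\<exists>u. awalk p u q \<and> set u = set u0 \<and> (\<forall>j. vec_sum u j = vec_sum u0 j + y j) \<and>
    length u \<le> length u0 + Suc (card E) * (\<Sum>j<D. y j)"
  using assms(1)
proof (induction rule: cone.induct)
  case cone_zero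
  show ?case using assms(2) by (intro exI[of _ u0]) simp
next
  case (cone_step y z)
  then obtain u where u: "awalk p u q" "set u = set u0" "\<And>j. vec_sum u j = vec_sum u0 j + y j"
    "length u \<le> length u0 + Suc (card E) * (\<Sum>j<D. y j)" by blast
  from cone_step.hyps(2) obtain c v where c: "z = vec_sum c" "c \<noteq> []" "set c \<subseteq> set u0"
    "length c \<le> Suc (card E)" "awalk v c v" by (auto simp: cycle_vecs_def)
  show ?case
  proof (cases "(\<Sum>j<D. z j) = 0")
    case True
    then have "z j = 0" for j using vec_sum_support[of j c] by (cases "j < D") (auto simp: c(1))
    then show ?thesis using u by (intro exI[of _ u]) simp
  next
    case False
    obtain e c' where e: "c = e # c'" using c(2) by (cases c) auto
    then obtain a b where ab: "u = a @ e # b" using c(3) u(2) by (metis in_set_conv_decomp list.set_intros(1) subset_iff)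
    have "src e = v" using c(5) e by simp
    then have "awalk p a v" "awalk v (e # b) q" using u(1) unfolding ab walk_append by auto
    then have "awalk p (a @ c @ e # b) q" unfolding walk_append using c(5) by blast
    moreover have "set (a @ c @ e # b) = set u0" using c(3) ab u(2) by auto
    moreover have "vec_sum (a @ c @ e # b) j = vec_sum u0 j + (y j + z j)" for j
      using u(3)[of j] by (simp add: ab c(1))
    moreover have "length (a @ c @ e # b) \<le> length u0 + Suc (card E) * (\<Sum>j<D. y j + z j)"
    proof -
      have "length c \<le> Suc (card E) * (\<Sum>j<D. z j)"
      proof -
        have "Suc (card E) * 1 \<le> Suc (card E) * (\<Sum>j<D. z j)"
          using False by (intro mult_le_mono2) linarith
        with c(4) show ?thesis unfolding mult_1_right by (rule order_trans)
      qed
      moreover have "length (a @ c @ e # b) = length u + length c" by (simp add: ab)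
      ultimately show ?thesis using u(4) by (simp only: sum.distrib distrib_left)
    qed
    ultimately show ?thesis by blast
  qed
qed

lemma vec_sum_le: "(\<And>e. e \<in> set u \<Longrightarrow> vec e j \<le> M) \<Longrightarrow> vec_sum u j \<le> length u * M"
proof (induction u)
  case (Cons e u)
  then show ?case by (simp add: vec_sum_def add_mono)
qed (simp add: vec_sum_def)

text \<open>The prefix vector lies in the linear set given by the skeleton and its short cycles,
  which by the choice of \<open>V\<close> is recorded in the profile. So a small vector with the
  same profile lies in it too and is realised by inserting cycles.\<close>

lemma small_lasso:
  assumes "lasso s u w" and M: "\<And>e j. e \<in> E \<Longrightarrow> vec e j \<le> M" and V: "Suc (card E) ^ 2 * M \<le> V"
  obtains u' w' where "lasso s u' w'" "set w' = set w" "profile D V (vec_sum u') = profile D V (vec_sum u)"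
    "length w' \<le> Suc (card E) ^ 2"
    "length u' \<le> Suc (card E) ^ 2 + Suc (card E) * (D * witness_bound D V)"
proof -
  from assms(1) obtain p where w: "w \<noteq> []" "awalk s u p" "awalk p w p" by (auto simp: lasso_def)
  from skeleton[OF w(3)] obtain w' where w': "awalk p w' p" "set w' = set w" "length w' \<le> Suc (card E) ^ 2"
    by blast
  from skeleton[OF w(2)] obtain u0 y where u0: "awalk s u0 p" "set u0 = set u" "length u0 \<le> Suc (card E) ^ 2"
    and y: "y \<in> cone (cycle_vecs (set u0))" "\<And>j. vec_sum u j = vec_sum u0 j + y j" by metis
  obtain x where x: "\<And>j. j \<ge> D \<Longrightarrow> x j = 0" "\<And>j. x j < witness_bound D V" "profile D V x = profile D V (vec_sum u)"
    using small_profile[of D "vec_sum u" V] vec_sum_support by blast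
  have small: "vec_sum c \<in> vecs D V" if "set c \<subseteq> E" "length c \<le> Suc (card E) ^ 2" for c
  proof -
    have "vec_sum c j \<le> V" for j
    proof -
      have "vec_sum c j \<le> length c * M" using M that(1) by (intro vec_sum_le) auto
      also have "\<dots> \<le> Suc (card E) ^ 2 * M" using that(2) by (rule mult_le_mono1)
      finally show ?thesis using V by simp
    qed
    then show ?thesis by (simp add: vecs_def vec_sum_support)
  qed
  have "vec_sum u0 \<in> vecs D V" using small[OF walk_edges[OF u0(1)] u0(3)] .
  moreover have "cycle_vecs (set u0) \<subseteq> vecs D V"
    using small walk_edges[OF u0(1)] by (auto simp: cycle_vecs_def power2_eq_square)
  ultimately have "x \<in> lin (\<lambda>j. int (vec_sum u0 j)) (cycle_vecs (set u0)) \<longleftrightarrow>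
      vec_sum u \<in> lin (\<lambda>j. int (vec_sum u0 j)) (cycle_vecs (set u0))"
    by (rule profile_lin[OF x(3)])
  moreover have "vec_sum u \<in> lin (\<lambda>j. int (vec_sum u0 j)) (cycle_vecs (set u0))"
    using y by (auto simp: lin_def)
  ultimately obtain y' where y': "y' \<in> cone (cycle_vecs (set u0))" "\<And>j. x j = vec_sum u0 j + y' j"
    unfolding lin_def by (auto simp flip: of_nat_add)
  from insert_cycles[OF y'(1) u0(1)] obtain u' where u': "awalk s u' p" "\<And>j. vec_sum u' j = x j"
    "length u' \<le> length u0 + Suc (card E) * (\<Sum>j<D. y' j)" by (auto simp: y'(2))
  have "(\<Sum>j<D. y' j) \<le> (\<Sum>j<D. witness_bound D V)"
    using x(2) y'(2) by (intro sum_mono) (metis le_add2 less_imp_le le_trans)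
  then have "(\<Sum>j<D. y' j) \<le> D * witness_bound D V" by simp
  then have "Suc (card E) * (\<Sum>j<D. y' j) \<le> Suc (card E) * (D * witness_bound D V)" by (rule mult_le_mono2)
  then have "length u' \<le> Suc (card E) ^ 2 + Suc (card E) * (D * witness_bound D V)"
    using u'(3) u0(3) by linarith
  moreover have "vec_sum u' = x" using u'(2) by auto
  moreover have "lasso s u' w'" using u'(1) w' w(1) by (auto simp: lasso_def)
  ultimately show thesis using that[of u' w'] w' x(3) by simp
qed

end

section \<open>Codes of limit Parikh automata\<close>

lemma set_decode_less: "x \<in> set_decode s \<Longrightarrow> x < s"
proof -
  assume "x \<in> set_decode s"
  then have "s div 2 ^ x \<noteq> 0" by (metis even_zero set_decode_def mem_Collect_eq)
  then have "2 ^ x \<le> s" by (simp add: div_eq_0_iff)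
  then show ?thesis by (rule less_le_trans[OF less_exp])
qed

lemma set_decode_eq_empty: "set_decode s = {} \<longleftrightarrow> s = 0"
  by (metis set_decode_inverse set_decode_zero set_encode_empty)

lemma fst_prod_decode_le: "fst (prod_decode n) \<le> n" and snd_prod_decode_le: "snd (prod_decode n) \<le> n"
  by (metis le_prod_encode_1 prod.collapse prod_decode_inverse)
    (metis le_prod_encode_2 prod.collapse prod_decode_inverse)

lemma code_nth_list_encode [simp]: "i < length xs \<Longrightarrow> code_nth (list_encode xs) i = xs ! i"
  by (simp add: code_nth_def)

lemma code_length_list_encode [simp]: "code_length (list_encode xs) = length xs"
  by (simp add: code_length_def)

lemma code_nth_zero [simp]: "code_nth 0 i = 0"
  by (simp add: code_nth_def)

lemma list_encode_code_nth: "list_encode (map (code_nth c) [0..<code_length c]) = c"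
proof -
  have "map (code_nth c) [0..<code_length c] = list_decode c"
    by (intro nth_equalityI) (simp_all add: code_nth_def code_length_def)
  then show ?thesis by simp
qed

definition dec_tr :: "nat \<Rightarrow> nat \<times> nat \<times> nat list \<times> nat" where
  "dec_tr t = (code_nth t 0, code_nth t 1, list_decode (code_nth t 2), code_nth t 3)"

lemma code_dec_tr: "code_length t = 4 \<Longrightarrow> pa_transition_code (dec_tr t) = t"
  using list_encode_code_nth[of t] by (simp add: pa_transition_code_def dec_tr_def eval_nat_numeral)

lemma dec_tr_code [simp]: "dec_tr (pa_transition_code x) = x"
  by (cases x) (simp add: pa_transition_code_def dec_tr_def del: list_encode.simps)

lemma code_length_pa_transition_code [simp]: "code_length (pa_transition_code x) = 4"
  by (cases x) (simp add: pa_transition_code_def del: list_encode.simps)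

lemma code_nth_pa_transition_code [simp]:
  "code_nth (pa_transition_code (p, a, v, q)) 0 = p" "code_nth (pa_transition_code (p, a, v, q)) 1 = a"
  "code_nth (pa_transition_code (p, a, v, q)) (Suc 0) = a"
  "code_nth (pa_transition_code (p, a, v, q)) 2 = list_encode v" "code_nth (pa_transition_code (p, a, v, q)) 3 = q"
  by (simp_all add: pa_transition_code_def del: list_encode.simps)

definition dec_enat :: "nat \<Rightarrow> enat" where
  "dec_enat c = (if c = 0 then \<infinity> else enat (c - 1))"

definition dec_evec :: "nat \<Rightarrow> enat list" where
  "dec_evec c = map dec_enat (list_decode c)"

definition dec_linear :: "nat \<Rightarrow> linear_pres" where
  "dec_linear c = (dec_evec (fst (prod_decode c)), dec_evec ` set_decode (snd (prod_decode c)))"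

lemma dec_enat_code [simp]: "dec_enat (enat_code x) = x" "enat_code (dec_enat c) = c"
  by (cases x) (simp_all add: dec_enat_def)

lemma dec_evec_code [simp]: "dec_evec (evec_code x) = x" "evec_code (dec_evec c) = c"
  by (simp_all add: dec_evec_def evec_code_def comp_def)

lemma length_dec_evec: "length (dec_evec c) = code_length c"
  by (simp add: dec_evec_def code_length_def)

lemma nth_dec_evec: "j < code_length c \<Longrightarrow> dec_evec c ! j = dec_enat (code_nth c j)"
  by (simp add: dec_evec_def code_nth_def code_length_def)

lemma inj_dec_evec: "inj_on dec_evec A"
  by (rule inj_on_inverseI[of _ evec_code]) simp

lemma linear_code_dec [simp]: "linear_code (dec_linear c) = c"
  by (simp add: linear_code_def dec_linear_def image_image)

lemma dec_linear_code: "finite P \<Longrightarrow> dec_linear (linear_code (b, P)) = (b, P)"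
  by (simp add: linear_code_def dec_linear_def image_image)

section \<open>Decoding automata and recognising their codes\<close>

definition dec_pa :: "nat \<Rightarrow> (nat, nat) limit_pa" where
  "dec_pa n = \<lparr>pa_dim = code_nth n 0, pa_states = set_decode (code_nth n 1), pa_alphabet = set_decode (code_nth n 2),
     pa_initial = code_nth n 3, pa_transitions = dec_tr ` set_decode (code_nth n 4),
     pa_accepting = set_decode (code_nth n 5), pa_constr = dec_linear ` set_decode (code_nth n 6)\<rparr>"

lemma dec_pa_sel [simp]:
  "pa_dim (dec_pa n) = code_nth n 0" "pa_states (dec_pa n) = set_decode (code_nth n 1)"
  "pa_alphabet (dec_pa n) = set_decode (code_nth n 2)" "pa_initial (dec_pa n) = code_nth n 3"
  "pa_transitions (dec_pa n) = dec_tr ` set_decode (code_nth n 4)"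
  "pa_accepting (dec_pa n) = set_decode (code_nth n 5)" "pa_constr (dec_pa n) = dec_linear ` set_decode (code_nth n 6)"
  by (simp_all add: dec_pa_def)

text \<open>The length conditions exclude numbers that decode to a well-formed automaton but differ
  from its code, since \<open>dec_pa\<close> ignores surplus list entries. Quantifiers can be
  bounded by \<open>n\<close>, which exceeds every member of a set coded in it.\<close>

definition pa_ok :: "nat \<Rightarrow> bool" where
  "pa_ok n \<longleftrightarrow> code_length n = 7 \<and> 1 \<le> code_nth n 0 \<and> 0 < code_nth n 2 \<and> code_nth n 3 \<in> set_decode (code_nth n 1) \<and>
    (\<forall>t<n. t \<in> set_decode (code_nth n 4) \<longrightarrow> code_length t = 4 \<and> code_nth t 0 \<in> set_decode (code_nth n 1) \<and>
      code_nth t 1 \<in> set_decode (code_nth n 2) \<and> code_length (code_nth t 2) = code_nth n 0 \<and> code_nth t 3 \<in> set_decode (code_nth n 1)) \<and>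
    (\<forall>q<n. q \<in> set_decode (code_nth n 5) \<longrightarrow> q \<in> set_decode (code_nth n 1)) \<and>
    (\<forall>l<n. l \<in> set_decode (code_nth n 6) \<longrightarrow> code_length (fst (prod_decode l)) = code_nth n 0 \<and>
      (\<forall>p<n. p \<in> set_decode (snd (prod_decode l)) \<longrightarrow> code_length p = code_nth n 0))"

lemma set_decode_code_nth_less: "x \<in> set_decode (code_nth n i) \<Longrightarrow> x < n"
  using set_decode_less code_nth_le less_le_trans by blast

lemma pa_ok_iff:
  "pa_ok n \<longleftrightarrow> code_length n = 7 \<and> (\<forall>t\<in>set_decode (code_nth n 4). code_length t = 4) \<and> limit_pa (dec_pa n)"
proof -
  have bounded: "(\<forall>x<n. x \<in> set_decode (code_nth n i) \<longrightarrow> P x) \<longleftrightarrow> (\<forall>x\<in>set_decode (code_nth n i). P x)" for i P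
    using set_decode_code_nth_less by blast
  have bounded': "(\<forall>p<n. p \<in> set_decode (snd (prod_decode l)) \<longrightarrow> P p) \<longleftrightarrow>
      (\<forall>p\<in>set_decode (snd (prod_decode l)). P p)" if "l \<in> set_decode (code_nth n i)" for l i P
    using set_decode_code_nth_less[OF that] set_decode_less snd_prod_decode_le[of l]
    by (metis less_trans order.strict_trans2)
  show ?thesis
    unfolding pa_ok_def bounded limit_pa_def semilinear_pres_def
    by (auto simp: bounded' set_decode_eq_empty dec_tr_def dec_linear_def length_dec_evec
        code_length_def[symmetric] split: prod.splits)
qed

lemma pa_code_dec_pa: "pa_ok n \<Longrightarrow> pa_code (dec_pa n) = n"
proof -
  assume ok: "pa_ok n"
  then have "pa_transition_code ` dec_tr ` set_decode (code_nth n 4) = set_decode (code_nth n 4)"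
    unfolding image_image by (simp add: pa_ok_iff code_dec_tr)
  moreover have "linear_code ` dec_linear ` set_decode (code_nth n 6) = set_decode (code_nth n 6)"
    by (simp add: image_image)
  moreover have "[0..<code_length n] = [0, 1, 2, 3, 4, 5, 6]" using ok by (simp add: pa_ok_def upt_rec)
  ultimately show ?thesis using list_encode_code_nth[of n]
    by (simp add: pa_code_def del: list_encode.simps)
qed

lemma dec_pa_pa_code: "limit_pa A \<Longrightarrow> dec_pa (pa_code A) = A"
proof -
  assume A: "limit_pa A"
  then have fin: "finite (pa_states A)" "finite (pa_alphabet A)" "finite (pa_transitions A)"
    "finite (pa_accepting A)" "finite (pa_constr A)"
    by (auto simp: limit_pa_def semilinear_pres_def intro: finite_subset)
  have "(\<lambda>L. dec_linear (linear_code L)) ` pa_constr A = (\<lambda>L. L) ` pa_constr A"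
    using A by (intro image_cong[OF refl]) (auto simp: limit_pa_def semilinear_pres_def dec_linear_code)
  then show ?thesis
    using fin by (simp add: dec_pa_def pa_code_def image_image del: list_encode.simps)
qed

lemma pa_ok_pa_code: "limit_pa A \<Longrightarrow> pa_ok (pa_code A)"
  unfolding pa_ok_iff dec_pa_pa_code
  by (auto simp: pa_code_def limit_pa_def simp del: list_encode.simps)

lemma transition_code: "pa_ok n \<Longrightarrow> x \<in> pa_transitions (dec_pa n) \<longleftrightarrow> pa_transition_code x \<in> set_decode (code_nth n 4)"
  by (auto simp: pa_ok_iff code_dec_tr image_iff intro: bexI[of _ "pa_transition_code x"])

definition det_ok :: "nat \<Rightarrow> bool" where
  "det_ok n \<longleftrightarrow> pa_ok n \<and> (\<forall>p<n. p \<in> set_decode (code_nth n 1) \<longrightarrow> (\<forall>a<n. a \<in> set_decode (code_nth n 2) \<longrightarrow>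
    (\<exists>t<n. (t \<in> set_decode (code_nth n 4) \<and> code_nth t 0 = p \<and> code_nth t 1 = a) \<and>
      (\<forall>t'<n. t' \<in> set_decode (code_nth n 4) \<and> code_nth t' 0 = p \<and> code_nth t' 1 = a \<longrightarrow> t' = t))))"

lemma det_ok_unique:
  "det_ok n \<longleftrightarrow> pa_ok n \<and> (\<forall>p\<in>set_decode (code_nth n 1). \<forall>a\<in>set_decode (code_nth n 2).
    \<exists>!t. t \<in> set_decode (code_nth n 4) \<and> code_nth t 0 = p \<and> code_nth t 1 = a)"
proof -
  have "(\<exists>t<n. (t \<in> set_decode (code_nth n 4) \<and> code_nth t 0 = p \<and> code_nth t 1 = a) \<and>
      (\<forall>t'<n. t' \<in> set_decode (code_nth n 4) \<and> code_nth t' 0 = p \<and> code_nth t' 1 = a \<longrightarrow> t' = t)) \<longleftrightarrow>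
    (\<exists>!t. t \<in> set_decode (code_nth n 4) \<and> code_nth t 0 = p \<and> code_nth t 1 = a)" for p a
    unfolding Ex1_def using set_decode_code_nth_less[of _ n 4] by blast
  moreover have "(\<forall>x<n. x \<in> set_decode (code_nth n i) \<longrightarrow> P x) \<longleftrightarrow> (\<forall>x\<in>set_decode (code_nth n i). P x)" for i P
    using set_decode_code_nth_less by blast
  ultimately show ?thesis unfolding det_ok_def by simp
qed

text \<open>On well-formed codes \<open>dec_tr\<close> is a bijection between coded and decoded
  transitions, which transfers unique existence.\<close>

lemma det_ok_iff: "det_ok n \<longleftrightarrow> pa_ok n \<and> deterministic_limit_pa (dec_pa n)"
proof (cases "pa_ok n")
  case True
  have "(\<exists>!t. t \<in> set_decode (code_nth n 4) \<and> code_nth t 0 = p \<and> code_nth t 1 = a) \<longleftrightarrow>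
    (\<exists>!x. x \<in> pa_transitions (dec_pa n) \<and> (\<exists>v q. x = (p, a, v, q)))" (is "(\<exists>!t. ?P t) \<longleftrightarrow> (\<exists>!x. ?Q x)") for p a
  proof -
    have PQ: "?Q (dec_tr t)" if "?P t" for t
    proof -
      have "dec_tr t = (p, a, list_decode (code_nth t 2), code_nth t 3)" using that by (simp add: dec_tr_def)
      moreover have "dec_tr t \<in> pa_transitions (dec_pa n)" using that by simp
      ultimately show ?thesis by blast
    qed
    have QP: "?P (pa_transition_code x)" if "?Q x" for x using that by (auto simp: transition_code[OF True] simp del: dec_pa_sel)
    have inv: "pa_transition_code (dec_tr t) = t" if "?P t" for t
      using that True by (simp add: pa_ok_iff code_dec_tr)
    show ?thesis
    proof
      assume "\<exists>!t. ?P t"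
      then obtain t where t: "?P t" "\<And>t'. ?P t' \<Longrightarrow> t' = t" by (elim ex1E) blast
      show "\<exists>!x. ?Q x"
      proof (rule ex1I)
        show "?Q (dec_tr t)" using PQ[OF t(1)] .
        show "x = dec_tr t" if "?Q x" for x using t(2)[OF QP[OF that]] dec_tr_code[of x] by simp
      qed
    next
      assume "\<exists>!x. ?Q x"
      then obtain x where x: "?Q x" "\<And>x'. ?Q x' \<Longrightarrow> x' = x" by (elim ex1E) blast
      show "\<exists>!t. ?P t"
      proof (rule ex1I)
        show "?P (pa_transition_code x)" using QP[OF x(1)] .
        show "t = pa_transition_code x" if "?P t" for t using x(2)[OF PQ[OF that]] inv[OF that] by simp
      qed
    qed
  qed
  then show ?thesis using True by (simp add: det_ok_unique deterministic_limit_pa_def pa_ok_iff)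
qed (simp add: det_ok_def)

section \<open>The product with the completed second automaton\<close>

definition edge1 :: "nat \<Rightarrow> nat" where "edge1 e = fst (prod_decode e)"
definition edge2 :: "nat \<Rightarrow> nat" where "edge2 e = snd (prod_decode e)"

definition esrc :: "nat \<Rightarrow> nat" where "esrc e = prod_encode (code_nth (edge1 e) 0, code_nth (edge2 e) 0)"
definition etgt :: "nat \<Rightarrow> nat" where "etgt e = prod_encode (code_nth (edge1 e) 3, code_nth (edge2 e) 3)"

definition evec :: "nat \<Rightarrow> nat \<Rightarrow> nat \<Rightarrow> nat \<Rightarrow> nat" where
  "evec d1 d2 e j = (if j < d1 then code_nth (code_nth (edge1 e) 2) j
    else if j < d1 + d2 then code_nth (code_nth (edge2 e) 2) (j - d1) else 0)"

text \<open>The second automaton is completed by a sink, which is entered on letters outside its alphabet.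
  The number \<open>n2\<close> itself serves as the sink, as it exceeds all states it codes; transitions into the
  sink carry the empty vector, whose entries are read as 0 by \<open>code_nth\<close>.\<close>

definition sink_step :: "nat \<Rightarrow> nat \<Rightarrow> nat \<Rightarrow> bool" where
  "sink_step n2 a t \<longleftrightarrow> t = list_encode [code_nth t 0, a, 0, n2] \<and>
    (code_nth t 0 = n2 \<or> code_nth t 0 \<in> set_decode (code_nth n2 1) \<and> a \<notin> set_decode (code_nth n2 2))"

lemma sink_step_target:
  assumes "sink_step n2 a t" shows "code_nth t 3 = n2" and "code_nth t 2 = 0"
proof -
  have "code_nth (list_encode [code_nth t 0, a, 0, n2]) 3 = n2" "code_nth (list_encode [code_nth t 0, a, 0, n2]) 2 = 0"
    by (simp_all del: list_encode.simps)
  moreover have "list_encode [code_nth t 0, a, 0, n2] = t" using assms unfolding sink_step_def by (elim conjE) (rule sym)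
  ultimately show "code_nth t 3 = n2" "code_nth t 2 = 0" by (simp_all only:)
qed

definition pedge :: "nat \<Rightarrow> nat \<Rightarrow> nat \<Rightarrow> bool" where
  "pedge n1 n2 e \<longleftrightarrow> edge1 e \<in> set_decode (code_nth n1 4) \<and> code_nth (edge1 e) 1 = code_nth (edge2 e) 1 \<and>
    (edge2 e \<in> set_decode (code_nth n2 4) \<or> sink_step n2 (code_nth (edge1 e) 1) (edge2 e))"

text \<open>The second component is either a transition code below \<open>n2\<close> or the code of
  a sink transition, a list of four numbers up to \<open>n1 + n2\<close>.\<close>

definition edge_bound :: "nat \<Rightarrow> nat \<Rightarrow> nat" where
  "edge_bound n1 n2 = prod_encode (n1, n2 + list_bound (n1 + n2) 4)"

lemma pedge_le: "pedge n1 n2 e \<Longrightarrow> e \<le> edge_bound n1 n2"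
proof -
  assume e: "pedge n1 n2 e"
  then have 1: "edge1 e \<le> n1" by (auto simp: pedge_def dest: set_decode_code_nth_less)
  have "edge2 e \<le> n2 + list_bound (n1 + n2) 4"
  proof (cases "edge2 e \<in> set_decode (code_nth n2 4)")
    case True
    then show ?thesis by (auto dest: set_decode_code_nth_less)
  next
    case False
    then have s: "sink_step n2 (code_nth (edge1 e) 1) (edge2 e)" using e by (auto simp: pedge_def)
    have "code_nth (edge1 e) 1 \<le> n1" using 1 code_nth_le le_trans by blast
    moreover have "code_nth (edge2 e) 0 \<le> n2"
      using s by (auto simp: sink_step_def dest: set_decode_code_nth_less)
    ultimately have "list_encode [code_nth (edge2 e) 0, code_nth (edge1 e) 1, 0, n2] \<le> list_bound (n1 + n2) 4"
      by (intro list_encode_le) auto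
    moreover have "edge2 e = list_encode [code_nth (edge2 e) 0, code_nth (edge1 e) 1, 0, n2]"
      using s by (simp only: sink_step_def)
    ultimately show ?thesis by simp
  qed
  with 1 show ?thesis
    using prod_encode_mono[of "edge1 e" n1 "edge2 e"] by (simp add: edge_bound_def edge1_def edge2_def)
qed

lemma edge_encode [simp]: "edge1 (prod_encode (t1, t2)) = t1" "edge2 (prod_encode (t1, t2)) = t2"
  by (simp_all add: edge1_def edge2_def)

lemma pa_ok_transition: "pa_ok n \<Longrightarrow> t \<in> set_decode (code_nth n 4) \<Longrightarrow> code_length t = 4 \<and> code_length (code_nth t 2) = code_nth n 0 \<and>
    code_nth t 0 \<in> set_decode (code_nth n 1) \<and> code_nth t 1 \<in> set_decode (code_nth n 2) \<and> code_nth t 3 \<in> set_decode (code_nth n 1)"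
  using set_decode_code_nth_less[of t n 4] unfolding pa_ok_def by blast

lemma pa_runD: "pa_run A \<alpha> r \<Longrightarrow>
    \<exists>s v. s 0 = pa_initial A \<and> (\<forall>i. r i = (s i, \<alpha> i, v i, s (Suc i))) \<and> (\<forall>i. r i \<in> pa_transitions A)"
  unfolding pa_run_def by blast

lemma list_decode_nth: "j < code_length c \<Longrightarrow> list_decode c ! j = code_nth c j"
  by (simp add: code_nth_def code_length_def)

locale product =
  fixes n1 n2 :: nat
  assumes ok1: "pa_ok n1" and det2: "det_ok n2"
begin

abbreviation "d1 \<equiv> code_nth n1 0"
abbreviation "d2 \<equiv> code_nth n2 0"
abbreviation "A1 \<equiv> dec_pa n1"
abbreviation "A2 \<equiv> dec_pa n2"

sublocale vec_graph "{e. pedge n1 n2 e}" esrc etgt "evec d1 d2" "d1 + d2"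
proof
  show "finite {e. pedge n1 n2 e}" 
    by (rule finite_subset[of _ "{..edge_bound n1 n2}"]) (auto simp: pedge_le)
qed (simp add: evec_def)

lemma ok2: "pa_ok n2"
  using det2 by (simp add: det_ok_def)

definition start :: nat where "start = prod_encode (code_nth n1 3, code_nth n2 3)"

text \<open>Common to paths and lassos: \<open>S\<close> stands for the edges taken infinitely often
  and \<open>l\<close> for the limit vector by offset and dimension. The conditions on targets are
  the two Buechi conditions.\<close>

definition counterexample :: "nat set \<Rightarrow> (nat \<Rightarrow> nat \<Rightarrow> enat list) \<Rightarrow> bool" where
  "counterexample S l \<longleftrightarrow>
    (\<exists>e\<in>S. code_nth (edge1 e) 3 \<in> pa_accepting A1) \<and> l 0 d1 \<in> semilinear_set d1 (pa_constr A1) \<and>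
    \<not> ((\<exists>e\<in>S. code_nth (edge2 e) 3 \<in> pa_accepting A2) \<and> l d1 d2 \<in> semilinear_set d2 (pa_constr A2))"

lemma sink_not_state: "n2 \<notin> set_decode (code_nth n2 i)"
  using set_decode_code_nth_less by blast

section \<open>Paths of the product and runs of the two automata\<close>

lemma limit_parikh_path_limit:
  assumes "\<And>i j. j < d \<Longrightarrow> tr_vec (r i) ! j = evec d1 d2 (\<pi> i) (k + j)"
  shows "limit_parikh d r = path_limit \<pi> k d"
  unfolding limit_parikh_def path_limit_def limit_vec_def Let_def
  by (rule map_cong[OF refl]) (simp add: assms frequently_cofinite)

lemma transition1: "t \<in> set_decode (code_nth n1 4) \<Longrightarrow> code_length t = 4 \<and> code_length (code_nth t 2) = d1 \<and> dec_tr t \<in> pa_transitions A1"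
  and transition2: "t \<in> set_decode (code_nth n2 4) \<Longrightarrow> code_length t = 4 \<and> code_length (code_nth t 2) = d2 \<and> dec_tr t \<in> pa_transitions A2
    \<and> code_nth t 0 \<in> set_decode (code_nth n2 1) \<and> code_nth t 1 \<in> set_decode (code_nth n2 2) \<and> code_nth t 3 \<in> set_decode (code_nth n2 1)"
  using pa_ok_transition[OF ok1, of t] pa_ok_transition[OF ok2, of t] by simp_all

lemma vec1: "edge1 e \<in> set_decode (code_nth n1 4) \<Longrightarrow> j < d1 \<Longrightarrow> tr_vec (dec_tr (edge1 e)) ! j = evec d1 d2 e j"
  using transition1[of "edge1 e"] by (simp add: dec_tr_def evec_def list_decode_nth)

lemma vec2: "edge2 e \<in> set_decode (code_nth n2 4) \<Longrightarrow> j < d2 \<Longrightarrow> tr_vec (dec_tr (edge2 e)) ! j = evec d1 d2 e (d1 + j)"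
  using transition2[of "edge2 e"] by (simp add: dec_tr_def evec_def list_decode_nth)

lemma path_step: "path s \<pi> \<Longrightarrow> pedge n1 n2 (\<pi> i) \<and>
    code_nth (edge1 (\<pi> (Suc i))) 0 = code_nth (edge1 (\<pi> i)) 3 \<and> code_nth (edge2 (\<pi> (Suc i))) 0 = code_nth (edge2 (\<pi> i)) 3"
  by (simp add: path_def esrc_def etgt_def)

lemma path_accepting_run1:
  assumes path: "path start \<pi>" and acc: "counterexample (limit \<pi>) (path_limit \<pi>)"
  shows "pa_accepting_run A1 (\<lambda>i. code_nth (edge1 (\<pi> i)) 1) (\<lambda>i. dec_tr (edge1 (\<pi> i)))"
proof -
  let ?t = "\<lambda>i. edge1 (\<pi> i)"
  have t: "?t i \<in> set_decode (code_nth n1 4)" for i using path_step[OF path] by (simp add: pedge_def)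
  have "code_nth (?t 0) 0 = pa_initial A1" using path by (simp add: path_def esrc_def start_def)
  moreover have "dec_tr (?t i) = (code_nth (?t i) 0, code_nth (?t i) 1, list_decode (code_nth (?t i) 2), code_nth (?t (Suc i)) 0)" for i
    using path_step[OF path, of i] by (simp add: dec_tr_def)
  ultimately have "pa_run A1 (\<lambda>i. code_nth (?t i) 1) (\<lambda>i. dec_tr (?t i))"
    unfolding pa_run_def using transition1[OF t]
    by (intro conjI exI[of _ "\<lambda>i. code_nth (?t i) 0"] exI[of _ "\<lambda>i. list_decode (code_nth (?t i) 2)"]) blast+
  moreover have "\<exists>\<^sub>\<infinity>i. tr_target (dec_tr (?t i)) \<in> pa_accepting A1"
    using acc INFM_iff_limit[OF finite_range_path[OF path], of "\<lambda>e. code_nth (edge1 e) 3 \<in> pa_accepting A1"]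
    by (simp add: counterexample_def dec_tr_def)
  moreover have "limit_parikh d1 (\<lambda>i. dec_tr (?t i)) = path_limit \<pi> 0 d1"
    by (rule limit_parikh_path_limit) (simp add: vec1[OF t])
  ultimately show ?thesis using acc by (simp add: pa_accepting_run_def counterexample_def)
qed

text \<open>While the run and the second component are in the same state, that state is not the sink
  and the letter lies in the alphabet. So the component cannot enter the sink and must take the only
  transition there is.\<close>

lemma path_run2:
  assumes path: "path start \<pi>" and run: "pa_run A2 (\<lambda>i. code_nth (edge1 (\<pi> i)) 1) r"
  shows "edge2 (\<pi> i) \<in> set_decode (code_nth n2 4) \<and> r i = dec_tr (edge2 (\<pi> i))"
proof -
  from pa_runD[OF run] obtain s v where "s 0 = pa_initial A2"
    and r: "\<And>i. r i = (s i, code_nth (edge1 (\<pi> i)) 1, v i, s (Suc i))"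
    and tr: "\<And>i. r i \<in> pa_transitions A2" by blast
  then have s0: "s 0 = code_nth n2 3" by simp
  let ?t = "\<lambda>i. edge2 (\<pi> i)"
  have step: "?t i \<in> set_decode (code_nth n2 4) \<and> r i = dec_tr (?t i)" if eq: "code_nth (?t i) 0 = s i" for i
  proof -
    let ?a = "code_nth (edge1 (\<pi> i)) 1"
    have ri: "pa_transition_code (r i) \<in> set_decode (code_nth n2 4)"
      using tr[of i] transition_code[OF ok2] by blast
    from transition2[OF ri] have s: "s i \<in> set_decode (code_nth n2 1)" and a: "?a \<in> set_decode (code_nth n2 2)"
      by (simp_all add: r)
    have "\<not> sink_step n2 ?a (?t i)"
      using s a eq sink_not_state[of 1] by (auto simp: sink_step_def)
    with path_step[OF path, of i] have t: "?t i \<in> set_decode (code_nth n2 4)" "code_nth (?t i) 1 = ?a"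
      by (auto simp: pedge_def)
    have "\<exists>!t. t \<in> set_decode (code_nth n2 4) \<and> code_nth t 0 = s i \<and> code_nth t 1 = ?a"
      using det2 s a by (simp add: det_ok_unique)
    then obtain t0 where t0: "\<And>t. t \<in> set_decode (code_nth n2 4) \<and> code_nth t 0 = s i \<and> code_nth t 1 = ?a \<Longrightarrow> t = t0"
      by (elim ex1E) blast
    have "?t i = t0" using t eq by (intro t0) simp
    also have "\<dots> = pa_transition_code (r i)" using ri by (intro t0[symmetric]) (simp add: r)
    finally show ?thesis using t(1) by simp
  qed
  have "code_nth (?t i) 0 = s i" for i
  proof (induction i)
    case 0
    show ?case using path by (simp add: path_def esrc_def start_def s0)
  next
    case (Suc i)
    have "code_nth (?t (Suc i)) 0 = code_nth (?t i) 3" using path_step[OF path] by simp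
    also have "\<dots> = s (Suc i)" using step[OF Suc] r[of i] by (simp add: dec_tr_def)
    finally show ?case .
  qed
  with step show ?thesis by blast
qed

lemma path_not_accepted2:
  assumes path: "path start \<pi>" and acc: "counterexample (limit \<pi>) (path_limit \<pi>)"
  shows "\<not> pa_accepting_run A2 (\<lambda>i. code_nth (edge1 (\<pi> i)) 1) r"
proof
  assume "pa_accepting_run A2 (\<lambda>i. code_nth (edge1 (\<pi> i)) 1) r"
  then have run: "pa_run A2 (\<lambda>i. code_nth (edge1 (\<pi> i)) 1) r"
    and inf: "\<exists>\<^sub>\<infinity>i. tr_target (r i) \<in> pa_accepting A2"
    and C: "limit_parikh d2 r \<in> semilinear_set d2 (pa_constr A2)"
    by (simp_all add: pa_accepting_run_def)
  note r = path_run2[OF path run]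
  have "limit_parikh d2 r = path_limit \<pi> d1 d2"
    by (rule limit_parikh_path_limit) (simp add: r vec2)
  moreover have "\<exists>e\<in>limit \<pi>. code_nth (edge2 e) 3 \<in> pa_accepting A2"
    using inf INFM_iff_limit[OF finite_range_path[OF path], of "\<lambda>e. code_nth (edge2 e) 3 \<in> pa_accepting A2"]
    by (simp add: r dec_tr_def)
  ultimately show False using acc C by (simp add: counterexample_def)
qed

text \<open>Every state of the completed automaton, including the sink, has a successor for every
  letter; dependent choice iterates this.\<close>

lemma completed_run:
  assumes "\<And>i. \<alpha> i \<in> pa_alphabet A1"
  obtains f where "code_nth (f 0) 0 = code_nth n2 3" "\<And>i. code_nth (f i) 1 = \<alpha> i"
    "\<And>i. f i \<in> set_decode (code_nth n2 4) \<or> sink_step n2 (\<alpha> i) (f i)" "\<And>i. code_nth (f (Suc i)) 0 = code_nth (f i) 3"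
proof -
  let ?states = "insert n2 (set_decode (code_nth n2 1))"
  let ?P = "\<lambda>i t. (i = 0 \<longrightarrow> code_nth t 0 = code_nth n2 3) \<and> code_nth t 1 = \<alpha> i \<and>
    (t \<in> set_decode (code_nth n2 4) \<or> sink_step n2 (\<alpha> i) t) \<and> code_nth t 3 \<in> ?states"
  have total: "\<exists>t. code_nth t 0 = p \<and> code_nth t 1 = a \<and> (t \<in> set_decode (code_nth n2 4) \<or> sink_step n2 a t) \<and> code_nth t 3 \<in> ?states"
    if "p \<in> ?states" for p a
  proof (cases "p \<noteq> n2 \<and> a \<in> set_decode (code_nth n2 2)")
    case True
    with that have "p \<in> set_decode (code_nth n2 1)" by blast
    with True det2 have "\<exists>!t. t \<in> set_decode (code_nth n2 4) \<and> code_nth t 0 = p \<and> code_nth t 1 = a"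
      by (simp add: det_ok_unique)
    from ex1_implies_ex[OF this] obtain t
      where "t \<in> set_decode (code_nth n2 4)" "code_nth t 0 = p" "code_nth t 1 = a" by blast
    with transition2 show ?thesis by blast
  next
    case False
    then show ?thesis
      using that by (intro exI[of _ "list_encode [p, a, 0, n2]"])
        (auto simp: sink_step_def simp del: list_encode.simps)
  qed
  have "code_nth n2 3 \<in> ?states" using ok2 by (simp add: pa_ok_def)
  from total[OF this, of "\<alpha> 0"] have "\<exists>t. ?P 0 t" by simp
  moreover have "\<exists>t'. ?P (Suc i) t' \<and> code_nth t' 0 = code_nth t 3" if "?P i t" for i t
  proof -
    from that have "code_nth t 3 \<in> ?states" by blast
    from total[OF this, of "\<alpha> (Suc i)"] show ?thesis by auto
  qed
  ultimately have "\<exists>f. \<forall>i. ?P i (f i) \<and> code_nth (f (Suc i)) 0 = code_nth (f i) 3"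
    by (rule dependent_nat_choice)
  then obtain f where f: "\<And>i. ?P i (f i)" "\<And>i. code_nth (f (Suc i)) 0 = code_nth (f i) 3" by iprover
  show thesis by (rule that[of f]) (use f in blast)+
qed

lemma not_subset_to_path:
  assumes \<alpha>: "\<alpha> \<in> pa_language A1" "\<alpha> \<notin> pa_language A2"
  shows "\<exists>\<pi>. path start \<pi> \<and> counterexample (limit \<pi>) (path_limit \<pi>)"
proof -
  from \<alpha>(1) obtain r where letters: "\<And>i. \<alpha> i \<in> pa_alphabet A1" and acc: "pa_accepting_run A1 \<alpha> r"
    by (auto simp: pa_language_def omega_words_def)
  then have "pa_run A1 \<alpha> r" by (simp add: pa_accepting_run_def)
  from pa_runD[OF this] obtain s v where "s 0 = pa_initial A1" and r: "\<And>i. r i = (s i, \<alpha> i, v i, s (Suc i))"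
    and tr: "\<And>i. r i \<in> pa_transitions A1" by blast
  then have s0: "s 0 = code_nth n1 3" by simp
  obtain f where f: "code_nth (f 0) 0 = code_nth n2 3" "\<And>i. code_nth (f i) 1 = \<alpha> i"
    "\<And>i. f i \<in> set_decode (code_nth n2 4) \<or> sink_step n2 (\<alpha> i) (f i)" "\<And>i. code_nth (f (Suc i)) 0 = code_nth (f i) 3"
    by (rule completed_run[OF letters]) iprover
  define \<pi> where "\<pi> i = prod_encode (pa_transition_code (r i), f i)" for i
  have \<pi>: "edge1 (\<pi> i) = pa_transition_code (r i)" "edge2 (\<pi> i) = f i" for i by (simp_all add: \<pi>_def)
  have t1: "pa_transition_code (r i) \<in> set_decode (code_nth n1 4)" for i
    using tr[of i] transition_code[OF ok1] by blast
  have path: "path start \<pi>"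
    unfolding path_def using t1 f s0 by (simp add: pedge_def esrc_def etgt_def start_def \<pi> r)
  note fin = finite_range_path[OF path]
  have "limit_parikh d1 r = path_limit \<pi> 0 d1"
    using vec1[of "\<pi> _"] t1 by (intro limit_parikh_path_limit) (simp add: \<pi>)
  moreover have "\<exists>e\<in>limit \<pi>. code_nth (edge1 e) 3 \<in> pa_accepting A1"
    using acc INFM_iff_limit[OF fin, of "\<lambda>e. code_nth (edge1 e) 3 \<in> pa_accepting A1"]
    by (simp add: pa_accepting_run_def \<pi> r)
  moreover have False if F2: "\<exists>e\<in>limit \<pi>. code_nth (edge2 e) 3 \<in> pa_accepting A2"
    and C2: "path_limit \<pi> d1 d2 \<in> semilinear_set d2 (pa_constr A2)"
  proof -
    have inf: "\<exists>\<^sub>\<infinity>i. code_nth (f i) 3 \<in> pa_accepting A2"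
      using F2 INFM_iff_limit[OF fin, of "\<lambda>e. code_nth (edge2 e) 3 \<in> pa_accepting A2"] by (simp add: \<pi>)
    \<comment> \<open>The sink is absorbing, and it is not accepting because \<open>n2\<close>
      exceeds all members of the sets it codes.\<close>
    have no_sink: "code_nth (f i) 3 \<noteq> n2" for i
    proof
      assume sink: "code_nth (f i) 3 = n2"
      have "code_nth (f (i + m)) 3 = n2" for m
      proof (induction m)
        case (Suc m)
        then have "code_nth (f (i + Suc m)) 0 = n2" using f(4) by simp
        then have "f (i + Suc m) \<notin> set_decode (code_nth n2 4)" using transition2 sink_not_state by metis
        with f(3) show ?case using sink_step_target by blast
      qed (simp add: sink)
      moreover from inf obtain k where "k \<ge> i" "code_nth (f k) 3 \<in> pa_accepting A2" unfolding INFM_nat_le by blast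
      moreover have "n2 \<notin> pa_accepting A2" using sink_not_state by simp
      ultimately show False by (metis le_Suc_ex)
    qed
    have t2: "f i \<in> set_decode (code_nth n2 4)" for i
    proof (rule ccontr)
      assume "f i \<notin> set_decode (code_nth n2 4)"
      with f(3) have "code_nth (f i) 3 = n2" using sink_step_target by blast
      with no_sink show False by blast
    qed
    define r2 where "r2 i = dec_tr (f i)" for i
    have r2: "r2 i = (code_nth (f i) 0, \<alpha> i, list_decode (code_nth (f i) 2), code_nth (f (Suc i)) 0)" for i
      using f(2,4) by (simp add: r2_def dec_tr_def)
    have "pa_run A2 \<alpha> r2"
      unfolding pa_run_def using transition2[OF t2] r2 f(1)
      by (intro conjI exI[of _ "\<lambda>i. code_nth (f i) 0"] exI[of _ "\<lambda>i. list_decode (code_nth (f i) 2)"])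
        (auto simp: r2_def)
    moreover have "limit_parikh d2 r2 = path_limit \<pi> d1 d2"
      using vec2[of "\<pi> _"] t2 by (intro limit_parikh_path_limit) (simp add: \<pi> r2_def)
    moreover have "\<exists>\<^sub>\<infinity>i. tr_target (r2 i) \<in> pa_accepting A2" using inf by (simp add: r2 f(4))
    ultimately have "pa_accepting_run A2 \<alpha> r2" using C2 by (simp add: pa_accepting_run_def)
    \<comment> \<open>Acceptance also requires letters of the second alphabet, which genuine
      transitions guarantee.\<close>
    moreover have "\<alpha> \<in> omega_words (pa_alphabet A2)"
      using transition2[OF t2] f(2) by (auto simp: omega_words_def)
    ultimately show False using \<alpha>(2) by (auto simp: pa_language_def)
  qed
  ultimately have "counterexample (limit \<pi>) (path_limit \<pi>)"
    using acc by (auto simp: counterexample_def pa_accepting_run_def)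
  with path show ?thesis by blast
qed

lemma subset_iff_no_lasso:
  "pa_language A1 \<subseteq> pa_language A2 \<longleftrightarrow>
    \<not> (\<exists>u w. lasso start u w \<and> counterexample (set w) (lasso_limit u w))"
proof
  assume sub: "pa_language A1 \<subseteq> pa_language A2"
  show "\<not> (\<exists>u w. lasso start u w \<and> counterexample (set w) (lasso_limit u w))"
  proof
    assume "\<exists>u w. lasso start u w \<and> counterexample (set w) (lasso_limit u w)"
    then obtain \<pi> where \<pi>: "path start \<pi>" "counterexample (limit \<pi>) (path_limit \<pi>)"
      using lasso_to_path by metis
    let ?\<alpha> = "\<lambda>i. code_nth (edge1 (\<pi> i)) 1"
    have "?\<alpha> i \<in> pa_alphabet A1" for i
      using path_step[OF \<pi>(1), of i] pa_ok_transition[OF ok1, of "edge1 (\<pi> i)"] by (simp add: pedge_def)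
    then have "?\<alpha> \<in> pa_language A1"
      using path_accepting_run1[OF \<pi>] by (auto simp: pa_language_def omega_words_def)
    moreover have "?\<alpha> \<notin> pa_language A2" using path_not_accepted2[OF \<pi>] by (simp add: pa_language_def)
    ultimately show False using sub by blast
  qed
next
  assume "\<not> (\<exists>u w. lasso start u w \<and> counterexample (set w) (lasso_limit u w))"
  then show "pa_language A1 \<subseteq> pa_language A2"
    using not_subset_to_path path_to_lasso by (metis subsetI)
qed

end

section \<open>Bounded search for counterexamples\<close>

lemma efin_dec_enat [simp]: "efin (dec_enat c) = c - 1" "dec_enat c = \<infinity> \<longleftrightarrow> c = 0"
  by (simp_all add: dec_enat_def)

text \<open>Coefficients above all finite entries of the target belong to periods whose finite coordinates
  vanish, so they may be capped.\<close>

lemma limit_vec_in_dec_linear: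
  assumes b: "code_length (fst (prod_decode l)) = d"
    and P: "\<And>p. p \<in> set_decode (snd (prod_decode l)) \<Longrightarrow> code_length p = d"
  shows "limit_vec J x k d \<in> linear_set d (dec_linear l) \<longleftrightarrow>
    (\<exists>z<Suc (list_bound (Suc (\<Sum>j<d. x (k + j))) l). \<forall>j<d.
      (J (k + j) \<longleftrightarrow> code_nth (fst (prod_decode l)) j = 0 \<or> (\<exists>p<snd (prod_decode l).
        p \<in> set_decode (snd (prod_decode l)) \<and> code_nth p j = 0 \<and> 0 < code_nth z p)) \<and>
      (\<not> J (k + j) \<longrightarrow> x (k + j) = code_nth (fst (prod_decode l)) j - 1 + (\<Sum>p<snd (prod_decode l).
        if p \<in> set_decode (snd (prod_decode l)) then (code_nth p j - 1) * code_nth z p else 0)))"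
    (is "_ \<longleftrightarrow> (\<exists>z<?B. ?R z)")
proof -
  define c where "c = fst (prod_decode l)"
  define m where "m = snd (prod_decode l)"
  define S where "S = set_decode m"
  have S: "finite S" "S \<subseteq> {..<m}" "\<And>p. p \<in> S \<Longrightarrow> code_length p = d"
    using set_decode_less P by (auto simp: S_def m_def)
  define A where "A y \<longleftrightarrow> (\<forall>j<d. (J (k + j) \<longleftrightarrow> code_nth c j = 0 \<or> (\<exists>p\<in>S. code_nth p j = 0 \<and> 0 < y p)) \<and>
    (\<not> J (k + j) \<longrightarrow> x (k + j) = code_nth c j - 1 + (\<Sum>p\<in>S. (code_nth p j - 1) * y p)))" for y :: "nat \<Rightarrow> nat"
  have R: "?R z \<longleftrightarrow> A (code_nth z)" for z
  proof -
    have "(\<Sum>p<m. if p \<in> S then (code_nth p j - 1) * code_nth z p else 0) = (\<Sum>p\<in>S. (code_nth p j - 1) * code_nth z p)" for j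
      using S(2) by (simp add: sum.inter_restrict[symmetric] Int_absorb1)
    moreover have "(\<exists>p<m. p \<in> S \<and> code_nth p j = 0 \<and> 0 < code_nth z p) \<longleftrightarrow> (\<exists>p\<in>S. code_nth p j = 0 \<and> 0 < code_nth z p)" for j
      using S(2) by blast
    ultimately show ?thesis unfolding A_def c_def[symmetric] m_def[symmetric] S_def[symmetric] by simp
  qed
  have "limit_vec J x k d \<in> linear_set d (dec_linear l) \<longleftrightarrow> (\<exists>z. A (\<lambda>p. z (dec_evec p)))"
  proof -
    have nth: "dec_evec p ! j = dec_enat (code_nth p j)" if "p \<in> S" "j < d" for p j
      using that S(3) by (simp add: nth_dec_evec)
    have "(\<Sum>p\<in>dec_evec ` S. efin (p ! j) * z p) = (\<Sum>p\<in>S. (code_nth p j - 1) * z (dec_evec p))" if "j < d" for j z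
      using nth that by (simp add: sum.reindex[OF inj_dec_evec])
    moreover have "(\<exists>p\<in>dec_evec ` S. p ! j = \<infinity> \<and> z p \<noteq> 0) \<longleftrightarrow> (\<exists>p\<in>S. code_nth p j = 0 \<and> 0 < z (dec_evec p))"
      if "j < d" for j and z :: "enat list \<Rightarrow> nat"
      using nth that by auto
    moreover have "dec_evec c ! j = dec_enat (code_nth c j)" if "j < d" for j
      using that b by (simp add: nth_dec_evec c_def)
    ultimately show ?thesis
      unfolding dec_linear_def c_def[symmetric] m_def[symmetric] S_def[symmetric]
        limit_vec_in_linear_set[OF finite_imageI[OF S(1)]] A_def by simp
  qed
  also have "\<dots> \<longleftrightarrow> (\<exists>y. A y)"
  proof
    assume "\<exists>y. A y"
    then obtain y where "A y" by blast
    \<comment> \<open>Coefficients indexed by vectors and by codes correspond, as decoding vectors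
      is injective.\<close>
    then have "A (\<lambda>p. (y \<circ> evec_code) (dec_evec p))" by simp
    then show "\<exists>z. A (\<lambda>p. z (dec_evec p))" by blast
  qed blast
  also have "\<dots> \<longleftrightarrow> (\<exists>z<?B. A (code_nth z))"
  proof
    assume "\<exists>y. A y"
    then obtain y where y: "A y" by blast
    define X where "X = (\<Sum>j<d. x (k + j))"
    \<comment> \<open>The coefficient of the period with code \<open>p\<close> is stored at position
      \<open>p\<close>; the other positions are filler. The length \<open>m\<close> is at most
      \<open>l\<close>.\<close>
    define z where "z = list_encode (map (\<lambda>p. min (y p) (Suc X)) [0..<m])"
    have zp: "code_nth z p = min (y p) (Suc X)" if "p \<in> S" for p
      using that S(2) by (auto simp: z_def simp del: list_encode.simps)
    have "z \<le> list_bound (Suc X) l"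
      unfolding z_def by (rule list_encode_le) (auto simp: m_def snd_prod_decode_le)
    moreover have "A (code_nth z)"
      unfolding A_def
    proof (intro allI impI conjI)
      fix j assume j: "j < d"
      show "J (k + j) \<longleftrightarrow> code_nth c j = 0 \<or> (\<exists>p\<in>S. code_nth p j = 0 \<and> 0 < code_nth z p)"
        using y j by (simp add: A_def zp)
      assume "\<not> J (k + j)"
      with y j have x: "x (k + j) = code_nth c j - 1 + (\<Sum>p\<in>S. (code_nth p j - 1) * y p)" by (simp add: A_def)
      have "x (k + j) \<le> X" unfolding X_def using j by (intro member_le_sum) auto
      have "(code_nth p j - 1) * y p = (code_nth p j - 1) * code_nth z p" if p: "p \<in> S" for p
      proof (cases "y p \<le> Suc X \<or> code_nth p j - 1 = 0")
        case True
        then show ?thesis by (auto simp: zp[OF p] min_def)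
      next
        case False
        then have "1 \<le> code_nth p j - 1" by linarith
        then have "1 * y p \<le> (code_nth p j - 1) * y p" by (rule mult_le_mono1)
        also have "\<dots> \<le> (\<Sum>p\<in>S. (code_nth p j - 1) * y p)" using p S(1) by (intro member_le_sum) auto
        \<comment> \<open>A coefficient of a positive entry contributes at least itself to the sum,
          so it is below the cap.\<close>
        finally have "y p \<le> X" using x \<open>x (k + j) \<le> X\<close> by simp
        with False show ?thesis by simp
      qed
      then have "(\<Sum>p\<in>S. (code_nth p j - 1) * y p) = (\<Sum>p\<in>S. (code_nth p j - 1) * code_nth z p)"
        by (rule sum.cong[OF refl])
      with x show "x (k + j) = code_nth c j - 1 + (\<Sum>p\<in>S. (code_nth p j - 1) * code_nth z p)" by simp
    qed
    ultimately show "\<exists>z<?B. A (code_nth z)" unfolding X_def less_Suc_eq_le by blast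
  qed blast
  finally show ?thesis by (simp only: R)
qed

text \<open>Supplies the bound \<open>V\<close> for \<open>limit_vec_profile\<close>: there are at
  most \<open>n\<close> periods, and all finite entries are at most \<open>n\<close>.\<close>

lemma dec_linear_bound:
  assumes "l < n" "code_length (fst (prod_decode l)) = d" "\<And>p. p \<in> set_decode (snd (prod_decode l)) \<Longrightarrow> code_length p = d" "j < d"
  shows "efin (dec_evec (fst (prod_decode l)) ! j) +
    (\<Sum>p\<in>dec_evec ` set_decode (snd (prod_decode l)). efin (p ! j)) \<le> Suc n ^ 2"
proof -
  let ?S = "set_decode (snd (prod_decode l))"
  have less: "p < n" if "p \<in> ?S" for p
    using set_decode_less[OF that] snd_prod_decode_le[of l] assms(1) by linarith
  have "efin (dec_evec (fst (prod_decode l)) ! j) \<le> n"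
    using assms code_nth_le[of "fst (prod_decode l)" j] fst_prod_decode_le[of l] by (simp add: nth_dec_evec)
  moreover have "(\<Sum>p\<in>dec_evec ` ?S. efin (p ! j)) \<le> n * n"
  proof -
    have "(\<Sum>p\<in>dec_evec ` ?S. efin (p ! j)) = (\<Sum>p\<in>?S. efin (dec_evec p ! j))"
      by (simp add: sum.reindex[OF inj_dec_evec])
    also have "\<dots> \<le> of_nat (card ?S) * n"
    proof (rule sum_bounded_above)
      fix p assume p: "p \<in> ?S"
      then show "efin (dec_evec p ! j) \<le> n"
        using assms(3)[OF p] assms(4) less[OF p] code_nth_le[of p j] by (simp add: nth_dec_evec)
    qed
    also have "\<dots> \<le> n * n"
    proof -
      have "card ?S \<le> card {..<n}" using less by (intro card_mono) auto
      then show ?thesis by simp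
    qed
    finally show ?thesis .
  qed
  ultimately show ?thesis by (simp add: power2_eq_square)
qed

section \<open>Lassos and membership as predicates on codes\<close>

definition prefix_sum :: "nat \<Rightarrow> nat \<Rightarrow> nat \<Rightarrow> nat \<Rightarrow> nat" where
  "prefix_sum d1 d2 u j = (\<Sum>i<code_length u. evec d1 d2 (code_nth u i) j)"

definition infinite_coord :: "nat \<Rightarrow> nat \<Rightarrow> nat \<Rightarrow> nat \<Rightarrow> bool" where
  "infinite_coord d1 d2 w j \<longleftrightarrow> (\<exists>i<code_length w. 0 < evec d1 d2 (code_nth w i) j)"

definition lasso_code :: "nat \<Rightarrow> nat \<Rightarrow> nat \<Rightarrow> nat \<Rightarrow> bool" where
  "lasso_code n1 n2 u w \<longleftrightarrow> 0 < code_length w \<and>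
    (\<forall>i<code_length u. pedge n1 n2 (code_nth u i)) \<and> (\<forall>i<code_length w. pedge n1 n2 (code_nth w i)) \<and>
    (\<forall>i<code_length u. Suc i < code_length u \<longrightarrow> esrc (code_nth u (Suc i)) = etgt (code_nth u i)) \<and>
    (\<forall>i<code_length w. Suc i < code_length w \<longrightarrow> esrc (code_nth w (Suc i)) = etgt (code_nth w i)) \<and>
    etgt (code_nth w (code_length w - 1)) = esrc (code_nth w 0) \<and>
    (code_length u = 0 \<longrightarrow> esrc (code_nth w 0) = prod_encode (code_nth n1 3, code_nth n2 3)) \<and>
    (0 < code_length u \<longrightarrow> esrc (code_nth u 0) = prod_encode (code_nth n1 3, code_nth n2 3) \<and>
      etgt (code_nth u (code_length u - 1)) = esrc (code_nth w 0))"

text \<open>An entry 0 codes infinity and \<open>Suc m\<close> codes \<open>m\<close>, hence the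
  tests for 0 and the predecessors. The quantified \<open>z\<close> codes a list of coefficients,
  bounded as in \<open>limit_vec_in_dec_linear\<close>.\<close>

definition member_code :: "nat \<Rightarrow> nat \<Rightarrow> nat \<Rightarrow> nat \<Rightarrow> nat \<Rightarrow> nat \<Rightarrow> nat \<Rightarrow> bool" where
  "member_code d1 d2 u w k d C \<longleftrightarrow> (\<exists>l<C. l \<in> set_decode C \<and>
    (\<exists>z<Suc (list_bound (Suc (\<Sum>j<d. prefix_sum d1 d2 u (k + j))) l). \<forall>j<d.
      (infinite_coord d1 d2 w (k + j) \<longleftrightarrow> code_nth (fst (prod_decode l)) j = 0 \<or> (\<exists>p<snd (prod_decode l).
        p \<in> set_decode (snd (prod_decode l)) \<and> code_nth p j = 0 \<and> 0 < code_nth z p)) \<and>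
      (\<not> infinite_coord d1 d2 w (k + j) \<longrightarrow> prefix_sum d1 d2 u (k + j) =
        code_nth (fst (prod_decode l)) j - 1 + (\<Sum>p<snd (prod_decode l).
        if p \<in> set_decode (snd (prod_decode l)) then (code_nth p j - 1) * code_nth z p else 0))))"

text \<open>The first summand covers the vectors of skeletons and short cycles, as
  \<open>small_lasso\<close> demands: edges are numbers up to \<open>edge_bound n1 n2\<close>, so
  their number plus one is at most \<open>edge_bound n1 n2 + 2\<close>, and their entries are at
  most \<open>n1 + n2\<close>. The second covers the constraints, by
  \<open>dec_linear_bound\<close>.\<close>

definition vec_bound :: "nat \<Rightarrow> nat \<Rightarrow> nat" where
  "vec_bound n1 n2 = (edge_bound n1 n2 + 2) ^ 2 * (n1 + n2) + Suc (n1 + n2) ^ 2"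

text \<open>The bound of \<open>small_lasso\<close> for the prefix, which dominates that for the
  loop, with the number of edges replaced by its bound.\<close>

definition length_bound :: "nat \<Rightarrow> nat \<Rightarrow> nat" where
  "length_bound n1 n2 = (edge_bound n1 n2 + 2) ^ 2 + (edge_bound n1 n2 + 2) *
    ((code_nth n1 0 + code_nth n2 0) * witness_bound (code_nth n1 0 + code_nth n2 0) (vec_bound n1 n2))"

definition lasso_bound :: "nat \<Rightarrow> nat \<Rightarrow> nat" where
  "lasso_bound n1 n2 = Suc (list_bound (edge_bound n1 n2) (length_bound n1 n2))"

definition refuted :: "nat \<Rightarrow> nat \<Rightarrow> bool" where
  "refuted n1 n2 \<longleftrightarrow> (\<exists>u<lasso_bound n1 n2. \<exists>w<lasso_bound n1 n2. lasso_code n1 n2 u w \<and>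
    (\<exists>i<code_length w. code_nth (edge1 (code_nth w i)) 3 \<in> set_decode (code_nth n1 5)) \<and>
    member_code (code_nth n1 0) (code_nth n2 0) u w 0 (code_nth n1 0) (code_nth n1 6) \<and>
    \<not> ((\<exists>i<code_length w. code_nth (edge2 (code_nth w i)) 3 \<in> set_decode (code_nth n2 5)) \<and>
      member_code (code_nth n1 0) (code_nth n2 0) u w (code_nth n1 0) (code_nth n2 0) (code_nth n2 6)))"

lemma pa_ok_constr: "pa_ok n \<Longrightarrow> l \<in> set_decode (code_nth n 6) \<Longrightarrow> code_length (fst (prod_decode l)) = code_nth n 0 \<and>
    (\<forall>p\<in>set_decode (snd (prod_decode l)). code_length p = code_nth n 0)"
proof -
  assume ok: "pa_ok n" and l: "l \<in> set_decode (code_nth n 6)"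
  have less: "l < n" using set_decode_code_nth_less[OF l] .
  moreover have "p < n" if "p \<in> set_decode (snd (prod_decode l))" for p
    using set_decode_less[OF that] snd_prod_decode_le[of l] less by linarith
  ultimately show ?thesis using ok l unfolding pa_ok_def by blast
qed

lemma Ball_list_decode: "(\<forall>e\<in>set (list_decode c). P e) \<longleftrightarrow> (\<forall>i<code_length c. P (code_nth c i))"
  by (auto simp: all_set_conv_all_nth code_nth_def code_length_def)

lemma Bex_list_decode: "(\<exists>e\<in>set (list_decode c). P e) \<longleftrightarrow> (\<exists>i<code_length c. P (code_nth c i))"
  using Ball_list_decode[of c "\<lambda>e. \<not> P e"] by blast

section \<open>Correctness of the bounded search\<close>

context product
begin

lemma vec_sum_list_decode: "vec_sum (list_decode u) = prefix_sum d1 d2 u"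
  unfolding vec_sum_def prefix_sum_def
  by (rule ext) (simp add: sum_list_sum_nth atLeast0LessThan list_decode_nth code_length_def[symmetric])

lemma lasso_limit_decode:
  "lasso_limit (list_decode u) (list_decode w) = limit_vec (infinite_coord d1 d2 w) (prefix_sum d1 d2 u)"
  unfolding lasso_limit_def vec_sum_list_decode by (rule limit_vec_cong) (simp_all add: infinite_coord_def Bex_list_decode)

lemma member_code_iff:
  assumes "pa_ok n" "code_nth n 0 = d"
  shows "member_code d1 d2 u w k d (code_nth n 6) \<longleftrightarrow>
    lasso_limit (list_decode u) (list_decode w) k d \<in> semilinear_set d (pa_constr (dec_pa n))"
proof -
  have "limit_vec J x k d \<in> semilinear_set d (pa_constr (dec_pa n)) \<longleftrightarrow>
    (\<exists>l<code_nth n 6. l \<in> set_decode (code_nth n 6) \<and> limit_vec J x k d \<in> linear_set d (dec_linear l))" for J x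
    using set_decode_less by (auto simp: semilinear_set_def)
  moreover have "limit_vec J x k d \<in> linear_set d (dec_linear l) \<longleftrightarrow>
    (\<exists>z<Suc (list_bound (Suc (\<Sum>j<d. x (k + j))) l). \<forall>j<d.
      (J (k + j) \<longleftrightarrow> code_nth (fst (prod_decode l)) j = 0 \<or> (\<exists>p<snd (prod_decode l).
        p \<in> set_decode (snd (prod_decode l)) \<and> code_nth p j = 0 \<and> 0 < code_nth z p)) \<and>
      (\<not> J (k + j) \<longrightarrow> x (k + j) = code_nth (fst (prod_decode l)) j - 1 + (\<Sum>p<snd (prod_decode l).
        if p \<in> set_decode (snd (prod_decode l)) then (code_nth p j - 1) * code_nth z p else 0)))"
    if "l \<in> set_decode (code_nth n 6)" for l J x
    by (rule limit_vec_in_dec_linear) (use pa_ok_constr[OF assms(1) that] assms(2) in auto)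
  ultimately show ?thesis
    unfolding lasso_limit_decode member_code_def by (simp cong: conj_cong)
qed

lemma lasso_code_iff: "lasso_code n1 n2 u w \<longleftrightarrow> lasso start (list_decode u) (list_decode w)"
proof -
  have nth: "list_decode c ! i = code_nth c i" if "i < code_length c" for c i
    using that by (simp add: code_nth_def code_length_def)
  have Nil: "list_decode c = [] \<longleftrightarrow> code_length c = 0" for c by (simp add: code_length_def)
  have walk: "awalk p (list_decode c) q \<longleftrightarrow> (\<forall>i<code_length c. pedge n1 n2 (code_nth c i)) \<and>
      (if code_length c = 0 then p = q else esrc (code_nth c 0) = p \<and> etgt (code_nth c (code_length c - 1)) = q) \<and>
      (\<forall>i<code_length c. Suc i < code_length c \<longrightarrow> esrc (code_nth c (Suc i)) = etgt (code_nth c i))" for p q c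
    unfolding walk_nth_iff subset_iff mem_Collect_eq Ball_def[symmetric] Ball_list_decode Nil code_length_def[symmetric]
    by (auto simp: nth)
  show ?thesis
    unfolding lasso_def lasso_code_def walk Nil start_def[symmetric] by (cases "code_length u = 0") auto
qed

lemma evec_le: "pedge n1 n2 e \<Longrightarrow> evec d1 d2 e j \<le> n1 + n2"
proof -
  assume e: "pedge n1 n2 e"
  have 1: "edge1 e \<le> n1" using e set_decode_code_nth_less[of "edge1 e" n1 4] by (simp add: pedge_def)
  have "code_nth (code_nth (edge1 e) 2) i \<le> n1" for i using 1 code_nth_le[of "code_nth (edge1 e) 2" i] code_nth_le[of "edge1 e" 2] by linarith
  moreover have "code_nth (code_nth (edge2 e) 2) i \<le> n2" for i
  proof (cases "edge2 e \<in> set_decode (code_nth n2 4)")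
    case True
    from set_decode_code_nth_less[OF True] show ?thesis
      using code_nth_le[of "code_nth (edge2 e) 2" i] code_nth_le[of "edge2 e" 2] by linarith
  next
    case False
    then have "sink_step n2 (code_nth (edge1 e) 1) (edge2 e)" using e unfolding pedge_def by blast
    then have "code_nth (edge2 e) 2 = 0" by (rule sink_step_target)
    then show ?thesis by simp
  qed
  ultimately show ?thesis by (simp add: evec_def trans_le_add1 trans_le_add2)
qed

lemma card_edges: "card {e. pedge n1 n2 e} \<le> Suc (edge_bound n1 n2)"
proof -
  have "card {e. pedge n1 n2 e} \<le> card {..edge_bound n1 n2}" using pedge_le by (intro card_mono) auto
  then show ?thesis by simp
qed

lemma semilinear_profile:
  assumes "pa_ok n" "n \<le> n1 + n2" "code_nth n 0 = d" "k + d \<le> d1 + d2"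
    and "profile (d1 + d2) (vec_bound n1 n2) (vec_sum u) = profile (d1 + d2) (vec_bound n1 n2) (vec_sum u')"
    and "set w = set w'"
  shows "lasso_limit u w k d \<in> semilinear_set d (pa_constr (dec_pa n)) \<longleftrightarrow>
    lasso_limit u' w' k d \<in> semilinear_set d (pa_constr (dec_pa n))"
proof -
  have "lasso_limit u w k d \<in> linear_set d (dec_linear l) \<longleftrightarrow> lasso_limit u' w' k d \<in> linear_set d (dec_linear l)"
    if l: "l \<in> set_decode (code_nth n 6)" for l
    unfolding lasso_limit_def assms(6) dec_linear_def
  proof (rule limit_vec_profile[OF _ assms(4)])
    have "l < n1 + n2" using set_decode_code_nth_less[OF l] assms(2) by linarith
    note bound = dec_linear_bound[OF this]
    show "efin (dec_evec (fst (prod_decode l)) ! j) +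
        (\<Sum>p\<in>dec_evec ` set_decode (snd (prod_decode l)). efin (p ! j)) \<le> vec_bound n1 n2" if "j < d" for j
      unfolding vec_bound_def using bound[of d j] that pa_ok_constr[OF assms(1) l] assms(3) by (simp add: trans_le_add2)
    show "1 \<le> vec_bound n1 n2" unfolding vec_bound_def by (rule trans_le_add2) simp
  qed (use assms(5) vec_sum_support in auto)
  then show ?thesis by (auto simp: semilinear_set_def)
qed

text \<open>Equal profiles preserve membership and non-membership alike, so a violated constraint of
  the second automaton survives along with the satisfied one of the first. The Buechi conditions
  survive because the loop keeps its edge set.\<close>

lemma small_counterexample:
  assumes "lasso start u w" "counterexample (set w) (lasso_limit u w)"
  shows "\<exists>u' w'. lasso start u' w' \<and> counterexample (set w') (lasso_limit u' w') \<and>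
    length u' \<le> length_bound n1 n2 \<and> length w' \<le> length_bound n1 n2"
proof -
  let ?K = "Suc (card {e. pedge n1 n2 e})" and ?V = "vec_bound n1 n2" and ?D = "d1 + d2"
  have K: "?K \<le> edge_bound n1 n2 + 2" using card_edges by simp
  then have K2: "?K ^ 2 \<le> (edge_bound n1 n2 + 2) ^ 2" by (rule power_mono) simp
  have M: "evec d1 d2 e j \<le> n1 + n2" if "e \<in> {e. pedge n1 n2 e}" for e j
    using that evec_le by simp
  have V: "?K ^ 2 * (n1 + n2) \<le> ?V" unfolding vec_bound_def by (rule trans_le_add1[OF mult_le_mono1[OF K2]])
  obtain u' w' where lasso: "lasso start u' w'" and set: "set w' = set w"
    and profile: "profile ?D ?V (vec_sum u') = profile ?D ?V (vec_sum u)"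
    and len: "length w' \<le> ?K ^ 2" "length u' \<le> ?K ^ 2 + ?K * (?D * witness_bound ?D ?V)"
    by (rule small_lasso[OF assms(1) M V], assumption) (rule that)
  have "?K * (?D * witness_bound ?D ?V) \<le> (edge_bound n1 n2 + 2) * (?D * witness_bound ?D ?V)"
    using K by (rule mult_le_mono1)
  then have "length u' \<le> length_bound n1 n2" "length w' \<le> length_bound n1 n2"
    unfolding length_bound_def
    using order_trans[OF len(2) add_mono[OF K2]] order_trans[OF len(1) trans_le_add1[OF K2]] by blast+
  moreover have "counterexample (set w') (lasso_limit u' w')"
    using assms(2) semilinear_profile[OF ok1 _ refl _ profile set, of 0]
      semilinear_profile[OF ok2 _ refl _ profile set, of d1]
    unfolding counterexample_def set by simp
  ultimately show ?thesis using lasso by blast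
qed

lemma subset_iff_not_refuted: "pa_language A1 \<subseteq> pa_language A2 \<longleftrightarrow> \<not> refuted n1 n2"
proof -
  have cex: "lasso_code n1 n2 u w \<and>
      (\<exists>i<code_length w. code_nth (edge1 (code_nth w i)) 3 \<in> set_decode (code_nth n1 5)) \<and>
      member_code d1 d2 u w 0 d1 (code_nth n1 6) \<and>
      \<not> ((\<exists>i<code_length w. code_nth (edge2 (code_nth w i)) 3 \<in> set_decode (code_nth n2 5)) \<and>
        member_code d1 d2 u w d1 d2 (code_nth n2 6)) \<longleftrightarrow>
    lasso start (list_decode u) (list_decode w) \<and>
      counterexample (set (list_decode w)) (lasso_limit (list_decode u) (list_decode w))" for u w
    unfolding lasso_code_iff counterexample_def Bex_list_decode
      member_code_iff[OF ok1 refl] member_code_iff[OF ok2 refl] by simp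
  have "(\<exists>u w. lasso start u w \<and> counterexample (set w) (lasso_limit u w)) \<longleftrightarrow> refuted n1 n2"
  proof
    assume "\<exists>u w. lasso start u w \<and> counterexample (set w) (lasso_limit u w)"
    then obtain u w where uw: "lasso start u w" "counterexample (set w) (lasso_limit u w)"
      and len: "length u \<le> length_bound n1 n2" "length w \<le> length_bound n1 n2"
      using small_counterexample by blast
    have code: "list_encode v < lasso_bound n1 n2"
      if "set v \<subseteq> {e. pedge n1 n2 e}" "length v \<le> length_bound n1 n2" for v
      unfolding lasso_bound_def less_Suc_eq_le using that pedge_le by (intro list_encode_le) auto
    from uw(1) obtain p where "awalk start u p" "awalk p w p" unfolding lasso_def by blast
    then have "list_encode u < lasso_bound n1 n2" "list_encode w < lasso_bound n1 n2"
      using code walk_edges len by blast+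
    then show "refuted n1 n2"
      unfolding refuted_def cex using uw by (intro exI[of _ "list_encode u"] exI[of _ "list_encode w"] conjI) simp_all
  next
    assume "refuted n1 n2"
    then show "\<exists>u w. lasso start u w \<and> counterexample (set w) (lasso_limit u w)"
      unfolding refuted_def cex by blast
  qed
  then show ?thesis by (simp add: subset_iff_no_lasso)
qed

end

section \<open>Universality and safety automata\<close>

text \<open>Every run has limit vector \<open>[0]\<close>, the only member of the constraint, and
  visits accepting states only.\<close>

definition safety_pa :: "('q, 'a) buchi \<Rightarrow> ('q, 'a) limit_pa" where
  "safety_pa B = \<lparr>pa_dim = 1, pa_states = ba_states B, pa_alphabet = ba_alphabet B, pa_initial = ba_initial B,
     pa_transitions = (\<lambda>(p, a, q). (p, a, [0], q)) ` ba_transitions B,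
     pa_accepting = ba_states B, pa_constr = {([0], {})}\<rparr>"

lemma finite_ba_transitions: "buchi B \<Longrightarrow> finite (ba_transitions B)"
  unfolding buchi_def by (meson finite_SigmaI finite_subset)

lemma limit_pa_safety_pa: "safety_automaton B \<Longrightarrow> limit_pa (safety_pa B)"
  using finite_ba_transitions[of B]
  by (auto simp: safety_pa_def limit_pa_def safety_automaton_def buchi_def semilinear_pres_def)

lemma safety_pa_language:
  assumes "safety_automaton B"
  shows "pa_language (safety_pa B) = ba_language B"
proof -
  have wf: "ba_transitions B \<subseteq> ba_states B \<times> ba_alphabet B \<times> ba_states B" "ba_accepting B = ba_states B"
    using assms by (auto simp: safety_automaton_def buchi_def)
  have states: "s i \<in> ba_states B" if "ba_run B \<alpha> s" for \<alpha> s i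
    using that wf(1) by (auto simp: ba_run_def)
  have "(\<exists>r. pa_accepting_run (safety_pa B) \<alpha> r) \<longleftrightarrow> (\<exists>s. ba_run B \<alpha> s \<and> (\<exists>\<^sub>\<infinity>i. s i \<in> ba_accepting B))" for \<alpha>
  proof
    assume "\<exists>r. pa_accepting_run (safety_pa B) \<alpha> r"
    then obtain r where "pa_run (safety_pa B) \<alpha> r" by (auto simp: pa_accepting_run_def)
    from pa_runD[OF this] obtain s v where s0: "s 0 = pa_initial (safety_pa B)"
      and r: "\<And>i. r i = (s i, \<alpha> i, v i, s (Suc i))" and tr: "\<And>i. r i \<in> pa_transitions (safety_pa B)" by blast
    have "(s i, \<alpha> i, s (Suc i)) \<in> ba_transitions B" for i
      using tr[of i] unfolding r by (auto simp: safety_pa_def)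
    with s0 have "ba_run B \<alpha> s" by (simp add: ba_run_def safety_pa_def)
    moreover from this states wf(2) have "\<exists>\<^sub>\<infinity>i. s i \<in> ba_accepting B" by simp
    ultimately show "\<exists>s. ba_run B \<alpha> s \<and> (\<exists>\<^sub>\<infinity>i. s i \<in> ba_accepting B)" by blast
  next
    assume "\<exists>s. ba_run B \<alpha> s \<and> (\<exists>\<^sub>\<infinity>i. s i \<in> ba_accepting B)"
    then obtain s where s: "ba_run B \<alpha> s" by blast
    define r where "r i = (s i, \<alpha> i, [0::nat], s (Suc i))" for i
    have "range r \<subseteq> pa_transitions (safety_pa B)"
      using s by (force simp: safety_pa_def ba_run_def r_def)
    then have "pa_run (safety_pa B) \<alpha> r"
      using s unfolding pa_run_def
      by (intro conjI exI[of _ s] exI[of _ "\<lambda>_. [0]"]) (auto simp: r_def ba_run_def safety_pa_def)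
    moreover have "limit_parikh 1 r = [0]"
      by (simp add: limit_parikh_def r_def zero_enat_def)
    moreover have "[0] \<in> linear_set 1 ([0], {})" by (auto simp: linear_set_def)
    moreover have "\<exists>\<^sub>\<infinity>i. tr_target (r i) \<in> pa_accepting (safety_pa B)"
      using states[OF s] by (simp add: r_def safety_pa_def)
    ultimately show "\<exists>r. pa_accepting_run (safety_pa B) \<alpha> r"
      by (intro exI[of _ r]) (simp add: pa_accepting_run_def safety_pa_def semilinear_set_def)
  qed
  moreover have "pa_alphabet (safety_pa B) = ba_alphabet B" by (simp add: safety_pa_def)
  ultimately show ?thesis by (simp add: pa_language_def ba_language_def)
qed

definition all_words_automaton :: "'a set \<Rightarrow> (nat, 'a) buchi" where
  "all_words_automaton X = \<lparr>ba_states = {0}, ba_alphabet = X, ba_initial = 0,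
     ba_transitions = (\<lambda>a. (0, a, 0)) ` X, ba_accepting = {0}\<rparr>"

lemma safety_all_words_automaton: "finite X \<Longrightarrow> X \<noteq> {} \<Longrightarrow> safety_automaton (all_words_automaton X)"
  by (auto simp: safety_automaton_def buchi_def all_words_automaton_def)

lemma all_words_automaton_language: "ba_language (all_words_automaton X) = omega_words X"
proof -
  have "ba_run (all_words_automaton X) \<alpha> (\<lambda>_. 0)" if "\<alpha> \<in> omega_words X" for \<alpha>
    using that by (auto simp: ba_run_def all_words_automaton_def omega_words_def)
  then show ?thesis by (fastforce simp: ba_language_def all_words_automaton_def)
qed

text \<open>Expresses the code of an image as a bounded sum, which is computable; injectivity
  ensures that no power of two is counted twice.\<close>

lemma set_encode_image_set_decode:
  assumes "inj_on f (set_decode s)"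
  shows "set_encode (f ` set_decode s) = (\<Sum>x<s. if x \<in> set_decode s then 2 ^ f x else 0)"
proof -
  have "set_decode s \<subseteq> {..<s}" using set_decode_less by auto
  then show ?thesis
    using assms by (simp add: set_encode_def sum.reindex comp_def sum.inter_restrict[symmetric] Int_absorb1)
qed

section \<open>Codes of safety automata and their translation\<close>

definition safety_ok :: "nat \<Rightarrow> bool" where
  "safety_ok n \<longleftrightarrow> code_length n = 5 \<and> 0 < code_nth n 1 \<and> code_nth n 2 \<in> set_decode (code_nth n 0) \<and>
    (\<forall>t<n. t \<in> set_decode (code_nth n 3) \<longrightarrow> code_length t = 3 \<and> code_nth t 0 \<in> set_decode (code_nth n 0) \<and>
      code_nth t 1 \<in> set_decode (code_nth n 1) \<and> code_nth t 2 \<in> set_decode (code_nth n 0)) \<and> code_nth n 4 = code_nth n 0"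

definition dec_ba :: "nat \<Rightarrow> (nat, nat) buchi" where
  "dec_ba n = \<lparr>ba_states = set_decode (code_nth n 0), ba_alphabet = set_decode (code_nth n 1), ba_initial = code_nth n 2,
     ba_transitions = (\<lambda>t. (code_nth t 0, code_nth t 1, code_nth t 2)) ` set_decode (code_nth n 3),
     ba_accepting = set_decode (code_nth n 4)\<rparr>"

lemma set_decode_inject: "set_decode m = set_decode n \<longleftrightarrow> m = n"
  by (metis set_decode_inverse)

lemma safety_ok_iff:
  "safety_ok n \<longleftrightarrow> code_length n = 5 \<and> (\<forall>t\<in>set_decode (code_nth n 3). code_length t = 3) \<and> safety_automaton (dec_ba n)"
proof -
  have "(\<forall>t<n. t \<in> set_decode (code_nth n 3) \<longrightarrow> P t) \<longleftrightarrow> (\<forall>t\<in>set_decode (code_nth n 3). P t)" for P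
    using set_decode_code_nth_less by blast
  then show ?thesis
    unfolding safety_ok_def safety_automaton_def buchi_def dec_ba_def
    by (auto simp: set_decode_inject set_decode_eq_empty)
qed

lemma ba_code_dec_ba: "safety_ok n \<Longrightarrow> ba_code (dec_ba n) = n"
proof -
  assume ok: "safety_ok n"
  have "ba_transition_code (code_nth t 0, code_nth t 1, code_nth t 2) = t" if "t \<in> set_decode (code_nth n 3)" for t
    using ok that list_encode_code_nth[of t] by (simp add: safety_ok_iff ba_transition_code_def eval_nat_numeral)
  then have "(\<lambda>t. ba_transition_code (code_nth t 0, code_nth t 1, code_nth t 2)) ` set_decode (code_nth n 3) = set_decode (code_nth n 3)"
    by simp
  moreover have "[0..<code_length n] = [0, 1, 2, 3, 4]" using ok by (simp add: safety_ok_def upt_rec)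
  ultimately show ?thesis using list_encode_code_nth[of n]
    by (simp add: ba_code_def dec_ba_def image_image del: list_encode.simps)
qed

lemma dec_ba_ba_code: "buchi B \<Longrightarrow> dec_ba (ba_code B) = B"
proof -
  assume B: "buchi B"
  then have fin: "finite (ba_states B)" "finite (ba_alphabet B)" "finite (ba_transitions B)" "finite (ba_accepting B)"
    by (auto simp: finite_ba_transitions buchi_def intro: finite_subset)
  have "(\<lambda>x. (code_nth (ba_transition_code x) 0, code_nth (ba_transition_code x) 1, code_nth (ba_transition_code x) 2)) ` ba_transitions B
      = (\<lambda>x. x) ` ba_transitions B"
    by (rule image_cong) (auto simp: ba_transition_code_def simp del: list_encode.simps)
  then show ?thesis
    using fin by (simp add: dec_ba_def ba_code_def image_image del: list_encode.simps)
qed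

lemma safety_ok_ba_code: "safety_automaton B \<Longrightarrow> safety_ok (ba_code B)"
proof -
  assume B: "safety_automaton B"
  then have fin: "finite (ba_transitions B)" by (simp add: safety_automaton_def finite_ba_transitions)
  have "dec_ba (ba_code B) = B" using B by (simp add: safety_automaton_def dec_ba_ba_code)
  with B fin show ?thesis
    unfolding safety_ok_iff by (auto simp: ba_code_def ba_transition_code_def simp del: list_encode.simps)
qed

definition safety_pa_code :: "nat \<Rightarrow> nat" where
  "safety_pa_code n = list_encode [1, code_nth n 0, code_nth n 1, code_nth n 2,
    (\<Sum>t<code_nth n 3. if t \<in> set_decode (code_nth n 3)
      then 2 ^ list_encode [code_nth t 0, code_nth t 1, list_encode [0], code_nth t 2] else 0),
    code_nth n 0, set_encode {linear_code ([0], {})}]"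

lemma pa_code_safety_pa:
  assumes "safety_ok n"
  shows "pa_code (safety_pa (dec_ba n)) = safety_pa_code n"
proof -
  let ?f = "\<lambda>t. list_encode [code_nth t 0, code_nth t 1, list_encode [0], code_nth t 2]"
  have "inj_on ?f (set_decode (code_nth n 3))"
  proof (rule inj_onI)
    fix t t' assume t: "t \<in> set_decode (code_nth n 3)" "t' \<in> set_decode (code_nth n 3)" and eq: "?f t = ?f t'"
    have "list_encode [code_nth t 0, code_nth t 1, code_nth t 2] = t" if "t \<in> set_decode (code_nth n 3)" for t
      using assms that list_encode_code_nth[of t] by (simp add: safety_ok_iff eval_nat_numeral)
    with t eq show "t = t'" by (metis list.inject list_encode_eq)
  qed
  from set_encode_image_set_decode[OF this] show ?thesis
    by (simp add: pa_code_def safety_pa_def dec_ba_def safety_pa_code_def image_image pa_transition_code_def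
        del: list_encode.simps)
qed

text \<open>The leading 1 is the dimension; the other two are the code 2 ^ 0 of the set
  \<open>{0}\<close> of states.\<close>

definition all_words_code :: "nat \<Rightarrow> nat" where
  "all_words_code s = list_encode [1, 1, s, 0,
    (\<Sum>a<s. if a \<in> set_decode s then 2 ^ list_encode [0, a, list_encode [0], 0] else 0),
    1, set_encode {linear_code ([0], {})}]"

lemma pa_code_all_words: "pa_code (safety_pa (all_words_automaton (set_decode s))) = all_words_code s"
proof -
  have "inj_on (\<lambda>a. list_encode [0, a, list_encode [0], 0]) (set_decode s)"
    by (rule inj_onI) (simp add: list_encode_eq del: list_encode.simps)
  moreover have "set_encode {0} = 1" by (simp add: set_encode_def)
  ultimately show ?thesis using set_encode_image_set_decode
    by (simp add: pa_code_def safety_pa_def all_words_automaton_def all_words_code_def image_image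
        pa_transition_code_def del: list_encode.simps)
qed

text \<open>The left automaton may be any limit Parikh automaton, which covers the images of
  non-deterministic safety automata.\<close>

lemma language_subset_iff:
  assumes "limit_pa A1" "deterministic_limit_pa A2"
  shows "pa_language A1 \<subseteq> pa_language A2 \<longleftrightarrow> \<not> refuted (pa_code A1) (pa_code A2)"
proof -
  have A2: "limit_pa A2" using assms(2) by (simp add: deterministic_limit_pa_def)
  then interpret product "pa_code A1" "pa_code A2"
    using assms by unfold_locales (simp_all add: pa_ok_pa_code det_ok_iff dec_pa_pa_code)
  show ?thesis using subset_iff_not_refuted assms(1) A2 by (simp add: dec_pa_pa_code)
qed

lemma det_ok_pa_code: "deterministic_limit_pa A \<Longrightarrow> det_ok (pa_code A)"
  by (simp add: det_ok_iff deterministic_limit_pa_def pa_ok_pa_code dec_pa_pa_code)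

text \<open>Universality is inclusion of the language of the all-words automaton over the same
  alphabet, and entry 2 of the coded list is the alphabet.\<close>

lemma universal_code_iff:
  "n \<in> pa_code ` universal_instances \<longleftrightarrow> det_ok n \<and> \<not> refuted (all_words_code (code_nth n 2)) n"
proof -
  have "pa_language A = omega_words (pa_alphabet A) \<longleftrightarrow> \<not> refuted (all_words_code (set_encode (pa_alphabet A))) (pa_code A)"
    if A: "deterministic_limit_pa A" for A :: "(nat, nat) limit_pa"
  proof -
    let ?B = "all_words_automaton (pa_alphabet A)"
    have X: "finite (pa_alphabet A)" "pa_alphabet A \<noteq> {}"
      using A by (simp_all add: deterministic_limit_pa_def limit_pa_def)
    note B = safety_all_words_automaton[OF X]
    have "pa_language A = omega_words (pa_alphabet A) \<longleftrightarrow> pa_language (safety_pa ?B) \<subseteq> pa_language A"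
      unfolding safety_pa_language[OF B] all_words_automaton_language by (auto simp: pa_language_def)
    also have "\<dots> \<longleftrightarrow> \<not> refuted (pa_code (safety_pa ?B)) (pa_code A)"
      by (rule language_subset_iff[OF limit_pa_safety_pa[OF B] A])
    finally show ?thesis using pa_code_all_words[of "set_encode (pa_alphabet A)"] X by simp
  qed
  note universal = this
  show ?thesis
  proof
    assume "n \<in> pa_code ` universal_instances"
    then obtain A where A: "n = pa_code A" "deterministic_limit_pa A" "pa_language A = omega_words (pa_alphabet A)"
      by (auto simp: universal_instances_def)
    moreover have "code_nth n 2 = set_encode (pa_alphabet A)"
      by (simp add: A(1) pa_code_def del: list_encode.simps)
    ultimately show "det_ok n \<and> \<not> refuted (all_words_code (code_nth n 2)) n"
      using universal[OF A(2)] by (simp add: det_ok_pa_code)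
  next
    assume n: "det_ok n \<and> \<not> refuted (all_words_code (code_nth n 2)) n"
    then have "pa_ok n" "deterministic_limit_pa (dec_pa n)" by (simp_all add: det_ok_iff)
    with n universal[of "dec_pa n"] show "n \<in> pa_code ` universal_instances"
      by (intro image_eqI[of _ _ "dec_pa n"]) (simp_all add: universal_instances_def pa_code_dec_pa)
  qed
qed

text \<open>\<open>sum_encode\<close> sends left summands to even and right summands to odd numbers,
  so parity tells safety automata from limit Parikh automata.\<close>

definition included :: "nat \<Rightarrow> nat \<Rightarrow> bool" where
  "included l r \<longleftrightarrow> det_ok r \<and>
    (even l \<longrightarrow> safety_ok (l div 2) \<and> \<not> refuted (safety_pa_code (l div 2)) r) \<and>
    (\<not> even l \<longrightarrow> det_ok (l div 2) \<and> \<not> refuted (l div 2) r)"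

lemma inclusion_code_iff:
  "n \<in> inclusion_code ` inclusion_instances \<longleftrightarrow> included (fst (prod_decode n)) (snd (prod_decode n))"
proof
  assume "n \<in> inclusion_code ` inclusion_instances"
  then obtain L A where n: "n = inclusion_code (L, A)" and L: "left_wf L" "left_language L \<subseteq> pa_language A"
    and A: "deterministic_limit_pa A" by (auto simp: inclusion_instances_def)
  show "included (fst (prod_decode n)) (snd (prod_decode n))"
  proof (cases L)
    case (Inl B)
    then have B: "safety_automaton B" using L by simp
    then have dec: "dec_ba (ba_code B) = B" by (simp add: safety_automaton_def dec_ba_ba_code)
    have "pa_code (safety_pa B) = safety_pa_code (ba_code B)"
      using pa_code_safety_pa[OF safety_ok_ba_code[OF B]] by (simp add: dec)
    moreover have "\<not> refuted (pa_code (safety_pa B)) (pa_code A)"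
      using language_subset_iff[OF limit_pa_safety_pa[OF B] A] safety_pa_language[OF B] L(2) Inl by simp
    ultimately show ?thesis
      using Inl A B by (simp add: included_def n inclusion_code_def sum_encode_def det_ok_pa_code safety_ok_ba_code)
  next
    case (Inr A1)
    then have A1: "deterministic_limit_pa A1" using L by simp
    then have "\<not> refuted (pa_code A1) (pa_code A)"
      using language_subset_iff[of A1, OF _ A] L(2) Inr by (simp add: deterministic_limit_pa_def)
    then show ?thesis
      using Inr A A1 by (simp add: included_def n inclusion_code_def sum_encode_def det_ok_pa_code)
  qed
next
  assume incl: "included (fst (prod_decode n)) (snd (prod_decode n))"
  define l r where "l = fst (prod_decode n)" and "r = snd (prod_decode n)"
  have n: "n = prod_encode (l, r)" by (simp add: l_def r_def)
  have r: "pa_ok r" "deterministic_limit_pa (dec_pa r)"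
    using incl by (simp_all add: included_def r_def det_ok_iff)
  have "\<exists>L. left_wf L \<and> sum_encode (map_sum ba_code pa_code L) = l \<and> left_language L \<subseteq> pa_language (dec_pa r)"
  proof (cases "even l")
    case True
    define B where "B = dec_ba (l div 2)"
    have ok: "safety_ok (l div 2)" and nr: "\<not> refuted (safety_pa_code (l div 2)) r"
      using incl True by (simp_all add: included_def l_def r_def)
    have B: "safety_automaton B" using ok by (simp add: safety_ok_iff B_def)
    have "ba_language B \<subseteq> pa_language (dec_pa r)"
      using language_subset_iff[OF limit_pa_safety_pa[OF B] r(2)] nr
      by (simp add: safety_pa_language[OF B] pa_code_dec_pa[OF r(1)] pa_code_safety_pa[OF ok, folded B_def])
    moreover have "sum_encode (map_sum ba_code pa_code (Inl B)) = l"
      using True by (simp add: sum_encode_def B_def ba_code_dec_ba[OF ok])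
    ultimately show ?thesis using B by (intro exI[of _ "Inl B"]) simp
  next
    case False
    have ok: "det_ok (l div 2)" and nr: "\<not> refuted (l div 2) r"
      using incl False by (simp_all add: included_def l_def r_def)
    have A1: "pa_ok (l div 2)" "deterministic_limit_pa (dec_pa (l div 2))" using ok by (simp_all add: det_ok_iff)
    then have "pa_language (dec_pa (l div 2)) \<subseteq> pa_language (dec_pa r)"
      using language_subset_iff[of "dec_pa (l div 2)", OF _ r(2)] nr
      by (simp add: deterministic_limit_pa_def pa_code_dec_pa r(1))
    moreover have "sum_encode (map_sum ba_code pa_code (Inr (dec_pa (l div 2)))) = l"
      using False by (simp add: sum_encode_def pa_code_dec_pa[OF A1(1)])
    ultimately show ?thesis using A1(2) by (intro exI[of _ "Inr (dec_pa (l div 2))"]) simp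
  qed
  then obtain L where "left_wf L" "sum_encode (map_sum ba_code pa_code L) = l" "left_language L \<subseteq> pa_language (dec_pa r)"
    by blast
  then show "n \<in> inclusion_code ` inclusion_instances"
    using r by (intro image_eqI[of _ _ "(L, dec_pa r)"])
      (simp_all add: inclusion_instances_def inclusion_code_def n pa_code_dec_pa)
qed

section \<open>Computability of the bounds and of the predicates on codes\<close>

lemma computable_edge1 [computable_intros]: "computable k f \<Longrightarrow> computable k (\<lambda>e. edge1 (f e))"
  unfolding edge1_def by (intro computable_intros)

lemma computable_edge2 [computable_intros]: "computable k f \<Longrightarrow> computable k (\<lambda>e. edge2 (f e))"
  unfolding edge2_def by (intro computable_intros)

lemma computable_esrc [computable_intros]: "computable k f \<Longrightarrow> computable k (\<lambda>e. esrc (f e))"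
  unfolding esrc_def by (intro computable_intros)

lemma computable_etgt [computable_intros]: "computable k f \<Longrightarrow> computable k (\<lambda>e. etgt (f e))"
  unfolding etgt_def by (intro computable_intros)

lemma computable_evec [computable_intros]:
  "computable k a \<Longrightarrow> computable k b \<Longrightarrow> computable k f \<Longrightarrow> computable k j \<Longrightarrow> computable k (\<lambda>e. evec (a e) (b e) (f e) (j e))"
  unfolding evec_def by (intro computable_intros)

lemma decidable_pred_sink_step [computable_intros]: "computable k n \<Longrightarrow> computable k a \<Longrightarrow> computable k t \<Longrightarrow> decidable_pred k (\<lambda>e. sink_step (n e) (a e) (t e))"
  unfolding sink_step_def by (intro computable_intros)

lemma decidable_pred_pedge [computable_intros]: "computable k m \<Longrightarrow> computable k n \<Longrightarrow> computable k f \<Longrightarrow> decidable_pred k (\<lambda>e. pedge (m e) (n e) (f e))"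
  unfolding pedge_def by (intro computable_intros)

lemma computable_prefix_sum [computable_intros]:
  "computable k a \<Longrightarrow> computable k b \<Longrightarrow> computable k u \<Longrightarrow> computable k j \<Longrightarrow> computable k (\<lambda>e. prefix_sum (a e) (b e) (u e) (j e))"
  by (rule computable_compose4) (unfold prefix_sum_def, intro computable_intros, simp_all)

lemma decidable_pred_infinite_coord [computable_intros]:
  "computable k a \<Longrightarrow> computable k b \<Longrightarrow> computable k w \<Longrightarrow> computable k j \<Longrightarrow> decidable_pred k (\<lambda>e. infinite_coord (a e) (b e) (w e) (j e))"
  by (rule decidable_pred_compose4) (unfold infinite_coord_def, intro computable_intros, simp_all)

lemma decidable_pred_lasso_code [computable_intros]:
  "computable k m \<Longrightarrow> computable k n \<Longrightarrow> computable k u \<Longrightarrow> computable k w \<Longrightarrow> decidable_pred k (\<lambda>e. lasso_code (m e) (n e) (u e) (w e))"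
  by (rule decidable_pred_compose4) (unfold lasso_code_def, intro computable_intros, simp_all)

lemma decidable_pred_member_code [computable_intros]:
  assumes "computable k a" "computable k b" "computable k u" "computable k w" "computable k o'" "computable k d" "computable k c"
  shows "decidable_pred k (\<lambda>e. member_code (a e) (b e) (u e) (w e) (o' e) (d e) (c e))"
proof -
  have "decidable_pred 7 (\<lambda>e. member_code (e 0) (e 1) (e 2) (e 3) (e 4) (e 5) (e 6))"
    unfolding member_code_def by (intro computable_intros) simp_all
  then have "computable 7 (\<lambda>e. if member_code (e 0) (e 1) (e 2) (e 3) (e 4) (e 5) (e 6) then 1 else 0)"
    by (simp only: decidable_pred_def)
  note H = this
  \<comment> \<open>Composition takes a family of functions indexed by numbers; a list provides it
    for the seven arguments.\<close>
  have G: "computable k ([a, b, u, w, o', d, c] ! i)" if "i < 7" for i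
  proof -
    have "[a, b, u, w, o', d, c] ! i \<in> set [a, b, u, w, o', d, c]" using that by (intro nth_mem) simp
    then show ?thesis using assms by auto
  qed
  show ?thesis
    using computable_compose[OF H, of k "\<lambda>i. [a, b, u, w, o', d, c] ! i", OF G] by (simp add: decidable_pred_def)
qed

lemma computable_edge_bound [computable_intros]: "computable k m \<Longrightarrow> computable k n \<Longrightarrow> computable k (\<lambda>e. edge_bound (m e) (n e))"
  unfolding edge_bound_def by (intro computable_intros)

lemma computable_vec_bound [computable_intros]: "computable k m \<Longrightarrow> computable k n \<Longrightarrow> computable k (\<lambda>e. vec_bound (m e) (n e))"
  unfolding vec_bound_def by (intro computable_intros)

lemma computable_witness_bound [computable_intros]: "computable k m \<Longrightarrow> computable k n \<Longrightarrow> computable k (\<lambda>e. witness_bound (m e) (n e))"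
  unfolding witness_bound_def box_size_def by (intro computable_intros)

lemma computable_lasso_bound [computable_intros]: "computable k m \<Longrightarrow> computable k n \<Longrightarrow> computable k (\<lambda>e. lasso_bound (m e) (n e))"
  unfolding lasso_bound_def length_bound_def by (intro computable_intros)

lemma decidable_pred_refuted [computable_intros]: "computable k m \<Longrightarrow> computable k n \<Longrightarrow> decidable_pred k (\<lambda>e. refuted (m e) (n e))"
  by (rule decidable_pred_compose2) (unfold refuted_def, intro computable_intros, simp_all)

lemma decidable_pred_det_ok [computable_intros]: "computable k n \<Longrightarrow> decidable_pred k (\<lambda>e. det_ok (n e))"
  by (rule decidable_pred_compose1) (unfold det_ok_def pa_ok_def, intro computable_intros, simp_all)

lemma decidable_pred_safety_ok [computable_intros]: "computable k n \<Longrightarrow> decidable_pred k (\<lambda>e. safety_ok (n e))"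
  by (rule decidable_pred_compose1) (unfold safety_ok_def, intro computable_intros, simp_all)

lemma computable_safety_pa_code [computable_intros]: "computable k n \<Longrightarrow> computable k (\<lambda>e. safety_pa_code (n e))"
  by (rule computable_compose1) (unfold safety_pa_code_def, intro computable_intros, simp_all)

lemma computable_all_words_code [computable_intros]: "computable k n \<Longrightarrow> computable k (\<lambda>e. all_words_code (n e))"
  by (rule computable_compose1) (unfold all_words_code_def, intro computable_intros, simp_all)

lemma decidable_pred_included [computable_intros]: "computable k m \<Longrightarrow> computable k n \<Longrightarrow> decidable_pred k (\<lambda>e. included (m e) (n e))"
  unfolding included_def by (intro computable_intros)

theorem corollary33:
  shows "decidable (pa_code ` universal_instances) \<and>
         decidable (inclusion_code ` inclusion_instances)"
proof
  show "decidable (pa_code ` universal_instances)"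
    by (rule decidable_cp, unfold universal_code_iff, intro computable_intros) simp_all
  show "decidable (inclusion_code ` inclusion_instances)"
    by (rule decidable_cp, unfold inclusion_code_iff, intro computable_intros) simp_all
qed

end
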